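(* Let $N\in\mathbb N$, $\alpha\in(0,N)$ and $p,q\in[1,+\infty)$. The space $E^{\alpha,p}(\mathbb R^N)$ is continuously embedded in $L^q(\mathbb R^N)$ if and only if condition $(\mathcal Q)$ holds: $$\text{either}\quad \frac1p\ge\frac{(N-2)_+}{N+\alpha}\quad\text{and}\quad \frac12-\frac1N\le\frac1q\le\frac12-\frac{p-1}{\alpha+2p},$$ $$\text{or}\quad \frac1p<\frac{(N-2)_+}{N+\alpha}\quad\text{and}\quad \frac12-\frac1N\ge\frac1q\ge\frac12-\frac{p-1}{\alpha+2p}.$$ Moreover, if $(\mathcal Q)$ holds and $\alpha+N\ne p(N-2)$, then there exists $S=S(N,\alpha,p,q)>0$ such that for every $u\in E^{\alpha,p}(\mathbb R^N)$ $$S\Bigl(\int_{\mathbb R^N}|u|^q\Bigr)^{\frac1q}\le\Bigl(\int_{\mathbb R^N}|Du|^2\Bigr)^{\frac\theta2}\Bigl(\int_{\mathbb R^N}\bigl(I_{\alpha/2}*|u|^p\bigr)^2\Bigr)^{\frac{1-\theta}{2p}},$$ where $\theta$ is determined by $$\frac1q=\theta\Bigl(\frac12-\frac1N\Bigr)+(1-\theta)\frac{N+\alpha}{2Np},$$ with $\frac{\alpha}{2p+\alpha}\le\theta\le1$ if $N\ge2$, and $\frac{\alpha}{2p+\alpha}\le\theta<\frac{1+\alpha}{1+\alpha+p}$ if $N=1$. If $N\ge3$ and $\alpha+N=p(N-2)$, then there exists $C=C(N,\alpha)>0$ such that for every $u\in E^{\alpha,\frac{N+\alpha}{N-2}}(\mathbb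 R^N)$, $$C\int_{\mathbb R^N}|u|^{\frac{2N}{N-2}}\le\Bigl(\int_{\mathbb R^N}|Du|^2\Bigr)^{\frac{\alpha}{2+\alpha}}\Bigl(\int_{\mathbb R^N}\bigl|I_{\alpha/2}*|u|^{\frac{N+\alpha}{N-2}}\bigr|^2\Bigr)^{\frac{2}{2+\alpha}}.$$
   Context: $\mathbb N$ denotes the positive integers and $t_+=\max\{t,0\}$. For $\alpha\in(0,N)$ the Riesz potential is $I_\alpha(x)=A_\alpha|x|^{-(N-\alpha)}$ for $x\in\mathbb R^N\setminus\{0\}$, with $A_\alpha=\frac{\Gamma((N-\alpha)/2)}{\Gamma(\alpha/2)\pi^{N/2}2^\alpha}$ (so $I_{\alpha/2}(x)=A_{\alpha/2}|x|^{-(N-\alpha/2)}$). For $p\ge1$, the Coulomb--Sobolev space $E^{\alpha,p}(\mathbb R^N)$ is the vector space of (a.e. classes of) measurable functions $u:\mathbb R^N\to\mathbb R$ with $\int_{\mathbb R^N}|I_{\alpha/2}*|u|^p|^2<\infty$ that are weakly differentiable with $Du\in L^2(\mathbb R^N)$, normed by $$\|u\|_{E^{\alpha,p}}=\Bigl(\int_{\mathbb R^N}|Du|^2+\Bigl(\int_{\mathbb R^N}\bigl|I_{\alpha/2}*|u|^p\bigr|^2\Bigr)^{1/p}\Bigr)^{1/2}.$$ For $N=1,2$ the condition $\frac12-\frac1N\le\frac1q$ just means $q<+\infty$. *)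

theory Defs
  imports "HOL-Analysis.Analysis"
begin

section \<open>Riesz potentials\<close>

text \<open>The value of the kernel at the origin is irrelevant (there \<open>0 powr a = 0\<close>).\<close>

definition riesz_kernel :: "real \<Rightarrow> real ^ 'n \<Rightarrow> real" where
  "riesz_kernel \<alpha> x =
     Gamma ((real CARD('n) - \<alpha>) / 2) / (Gamma (\<alpha> / 2) * pi powr (real CARD('n) / 2) * 2 powr \<alpha>)
     * norm x powr (- (real CARD('n) - \<alpha>))"

text \<open>The convolution \<open>I\<^sub>\<alpha> * f\<close> of a nonnegative function, with values in \<open>[0, \<infinity>]\<close>.\<close>

definition riesz_potential :: "real \<Rightarrow> (real ^ 'n \<Rightarrow> real) \<Rightarrow> real ^ 'n \<Rightarrow> ennreal" where
  "riesz_potential \<alpha> f x = (\<integral>\<^sup>+ y. ennreal (riesz_kernel \<alpha> (x - y) * f y) \<partial>lebesgue)"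

definition ennreal_coulomb_energy :: "real \<Rightarrow> real \<Rightarrow> (real ^ 'n \<Rightarrow> real) \<Rightarrow> ennreal" where
  "ennreal_coulomb_energy \<alpha> p u =
     (\<integral>\<^sup>+ x. (riesz_potential (\<alpha> / 2) (\<lambda>y. \<bar>u y\<bar> powr p) x)\<^sup>2 \<partial>lebesgue)"

text \<open>Real-valued version, meaningful only where the extended one is finite.\<close>

definition coulomb_energy :: "real \<Rightarrow> real \<Rightarrow> (real ^ 'n \<Rightarrow> real) \<Rightarrow> real" where
  "coulomb_energy \<alpha> p u = enn2real (ennreal_coulomb_energy \<alpha> p u)"

section \<open>Weak differentiability\<close>

fun C_k :: "nat \<Rightarrow> ('a::real_normed_vector \<Rightarrow> 'b::real_normed_vector) \<Rightarrow> bool" where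
  "C_k 0 f \<longleftrightarrow> continuous_on UNIV f"
| "C_k (Suc k) f \<longleftrightarrow>
     (\<forall>x. f differentiable (at x)) \<and> (\<forall>v. C_k k (\<lambda>x. frechet_derivative f (at x) v))"

definition test_function :: "('a::real_normed_vector \<Rightarrow> real) \<Rightarrow> bool" where
  "test_function \<phi> \<longleftrightarrow> (\<forall>k. C_k k \<phi>) \<and> compact (closure {x. \<phi> x \<noteq> 0})"

definition locally_integrable :: "('a::euclidean_space \<Rightarrow> 'b::euclidean_space) \<Rightarrow> bool" where
  "locally_integrable f \<longleftrightarrow> (\<forall>K. compact K \<longrightarrow> f absolutely_integrable_on K)"

definition has_weak_gradient :: "(real ^ 'n \<Rightarrow> real) \<Rightarrow> (real ^ 'n \<Rightarrow> real ^ 'n) \<Rightarrow> bool" where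
  "has_weak_gradient u G \<longleftrightarrow>
     locally_integrable u \<and> locally_integrable G \<and>
     (\<forall>\<phi> i. test_function \<phi> \<longrightarrow>
        (LINT x|lebesgue. u x * frechet_derivative \<phi> (at x) (axis i 1)) =
        - (LINT x|lebesgue. G x $ i * \<phi> x))"

definition weakly_differentiable :: "(real ^ 'n \<Rightarrow> real) \<Rightarrow> bool" where
  "weakly_differentiable u \<longleftrightarrow> (\<exists>G. has_weak_gradient u G)"

text \<open>A weak gradient is unique only up to null sets, so a representative is chosen; the
  integrals below do not depend on the choice.\<close>

definition weak_gradient :: "(real ^ 'n \<Rightarrow> real) \<Rightarrow> real ^ 'n \<Rightarrow> real ^ 'n" where
  "weak_gradient u = (SOME G. has_weak_gradient u G)"

definition dirichlet_energy :: "(real ^ 'n \<Rightarrow> real) \<Rightarrow> real" where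
  "dirichlet_energy u = (LINT x|lebesgue. (norm (weak_gradient u x))\<^sup>2)"

section \<open>Function spaces\<close>

text \<open>Elements are functions rather than classes modulo equality almost everywhere;
  all notions below are invariant under modification on null sets, and the norms are seminorms on
  functions.\<close>

definition coulomb_sobolev :: "real \<Rightarrow> real \<Rightarrow> (real ^ 'n \<Rightarrow> real) set" where
  "coulomb_sobolev \<alpha> p =
     {u \<in> borel_measurable lebesgue.
        ennreal_coulomb_energy \<alpha> p u < \<infinity> \<and>
        weakly_differentiable u \<and>
        integrable lebesgue (\<lambda>x. (norm (weak_gradient u x))\<^sup>2)}"

definition coulomb_sobolev_norm :: "real \<Rightarrow> real \<Rightarrow> (real ^ 'n \<Rightarrow> real) \<Rightarrow> real" where
  "coulomb_sobolev_norm \<alpha> p u = sqrt (dirichlet_energy u + coulomb_energy \<alpha> p u powr (1 / p))"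

definition Lq_space :: "real \<Rightarrow> (real ^ 'n \<Rightarrow> real) set" where
  "Lq_space q = {u \<in> borel_measurable lebesgue. integrable lebesgue (\<lambda>x. \<bar>u x\<bar> powr q)}"

definition Lq_norm :: "real \<Rightarrow> (real ^ 'n \<Rightarrow> real) \<Rightarrow> real" where
  "Lq_norm q u = (LINT x|lebesgue. \<bar>u x\<bar> powr q) powr (1 / q)"

definition continuously_embedded ::
    "'a set \<Rightarrow> ('a \<Rightarrow> real) \<Rightarrow> 'a set \<Rightarrow> ('a \<Rightarrow> real) \<Rightarrow> bool" where
  "continuously_embedded V normV W normW \<longleftrightarrow>
     V \<subseteq> W \<and> (\<exists>C. \<forall>u\<in>V. normW u \<le> C * normV u)"

section \<open>The condition on the exponents\<close>

definition condition_Q :: "nat \<Rightarrow> real \<Rightarrow> real \<Rightarrow> real \<Rightarrow> bool" where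
  "condition_Q N \<alpha> p q \<longleftrightarrow>
     (1 / p \<ge> max (real N - 2) 0 / (real N + \<alpha>) \<and>
      1 / 2 - 1 / real N \<le> 1 / q \<and> 1 / q \<le> 1 / 2 - (p - 1) / (\<alpha> + 2 * p)) \<or>
     (1 / p < max (real N - 2) 0 / (real N + \<alpha>) \<and>
      1 / 2 - 1 / real N \<ge> 1 / q \<and> 1 / q \<ge> 1 / 2 - (p - 1) / (\<alpha> + 2 * p))"

end

theory Submission
  imports Defs
begin

text \<open>
  Write \<open>N\<close> for the dimension, \<open>D\<close> and \<open>V\<close> for the Dirichlet and the Coulomb energy of \<open>u\<close>, and
  \<open>W = I\<^sub>\<alpha>\<^sub>/\<^sub>2 * \<bar>u\<bar>\<^sup>p\<close>, so that \<open>V\<close> is the integral of \<open>W\<^sup>2\<close>.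

  Sufficiency. The function is compared with its averages \<open>A\<^sub>r u\<close> against smooth kernels \<open>k\<^sub>r\<close> that
  live on the annuli \<open>r / 2 < \<bar>y\<bar> < r\<close> (\<open>shell_kernel\<close>). The kernels are chosen such that
  \<open>k\<^sub>r\<^sub>/\<^sub>2 - k\<^sub>r\<close> is the divergence of an explicit smooth field of size \<open>r\<^sup>1\<^sup>-\<^sup>N\<close> supported in the ball of
  radius \<open>r\<close> (\<open>flux_divergence\<close>). Testing the definition of the weak gradient with the components of
  this field bounds \<open>\<bar>A\<^sub>r\<^sub>/\<^sub>2 u - A\<^sub>r u\<bar>\<close> by a constant times \<open>r\<close> times the average of \<open>\<bar>Du\<bar>\<close> over a ball of radius \<open>r\<close>
  (\<open>shell_avg_difference\<close>), so that \<open>u\<close> need not be approximated by smooth functions. That average is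
  at most the maximal function \<open>M\<close> of \<open>\<bar>Du\<bar>\<close>, whose square has integral at most a constant times \<open>D\<close>
  (\<open>dyadic_max_L2\<close>), and at most a constant times \<open>r powr (- N / 2) * sqrt D\<close> by the Cauchy-Schwarz
  inequality. Since the Riesz kernel is bounded below on balls, Jensen's inequality bounds
  \<open>\<bar>A\<^sub>r u\<bar>\<close> by the powers \<open>1 / p\<close> of \<open>r powr (- \<alpha> / 2) * W\<close> and of
  \<open>r powr (- (N + \<alpha>) / 2) * sqrt V\<close>. These four bounds make up \<open>controlled_averages\<close>.

  Take the geometric mean, with weights \<open>s\<close> and \<open>1 - s\<close>, of the two bounds for differences, and
  likewise of the two bounds for averages. As \<open>A\<^sub>r u\<close> tends to a multiple of \<open>u\<close> almost everywhere
  (\<open>shell_avg_tendsto_lebesgue\<close>), summing the differences over the dyadic scales below \<open>R\<close> gives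
  \<open>\<bar>u\<bar> \<le> C (R powr \<beta> * P + R powr (- \<gamma>) * Q)\<close> with \<open>P = M powr s * sqrt D powr (1 - s)\<close> and
  \<open>Q = (W powr s * sqrt V powr (1 - s)) powr (1 / p)\<close>, and the best \<open>R\<close> turns this into
  \<open>\<bar>u\<bar> \<le> C * P powr \<theta> * Q powr (1 - \<theta>)\<close> (\<open>pointwise_subcritical\<close>). The weight \<open>s\<close> is chosen such that
  the power \<open>q\<close> of the right-hand side contains \<open>M\<close> and \<open>W\<close> with exponents of sum 2, and then
  integration gives the inequality (\<open>gagliardo_nirenberg_subcritical\<close>). The requirement \<open>s \<le> 1\<close> is
  exactly \<open>\<alpha> / (2 * p + \<alpha>) \<le> \<theta>\<close> (\<open>exponent_relations\<close>); this is how the endpoint of \<open>(Q)\<close> that depends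
  on \<open>\<alpha>\<close> arises. For \<open>\<theta> = 1\<close>, the Sobolev exponent, the differences are also summed over the scales
  above \<open>R\<close> (\<open>pointwise_critical\<close>).

  Necessity. Dilate a bump by \<open>2\<^sup>t\<close> and add up \<open>2\<^sup>k\<close> translates of it that are so far apart that their
  Coulomb interaction is negligible. The integral of \<open>\<bar>u\<bar>\<^sup>q\<close>, \<open>D\<close> and (up to a constant) \<open>V\<close> are then
  multiplied by powers of 2 whose exponents are linear in \<open>t\<close> and \<open>k\<close>, and the logarithm of the
  embedding inequality is a piecewise linear inequality in \<open>t\<close> and \<open>k\<close> (\<open>embedded_imp_growth\<close>). Its
  growth along three rays is \<open>(Q)\<close> (\<open>embedded_imp_condition_Q\<close>).
\<close>

section \<open>Smooth functions of one variable\<close>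

text \<open>On the line the successive derivatives can be named, which keeps the smoothness proofs for
  explicit functions short; \<open>C_k_radial\<close> carries the result over to \<open>C_k\<close>.\<close>

fun smooth_upto :: "nat \<Rightarrow> (real \<Rightarrow> real) \<Rightarrow> bool" where
  "smooth_upto 0 f \<longleftrightarrow> continuous_on UNIV f"
| "smooth_upto (Suc n) f \<longleftrightarrow> (\<exists>f'. (\<forall>x. (f has_real_derivative f' x) (at x)) \<and> smooth_upto n f')"

lemma smooth_upto_SucI: "(\<And>x. (f has_real_derivative f' x) (at x)) \<Longrightarrow> smooth_upto n f' \<Longrightarrow> smooth_upto (Suc n) f"
  by auto

lemma smooth_upto_SucD: "smooth_upto (Suc n) f \<Longrightarrow> smooth_upto n f"
proof (induction n arbitrary: f)
  case 0
  then show ?case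
    by (auto simp: continuous_on_eq_continuous_at intro: DERIV_isCont)
next
  case (Suc n)
  from Suc.prems obtain f' where *: "\<And>x. (f has_real_derivative f' x) (at x)" "smooth_upto (Suc n) f'"
    using smooth_upto.simps(2)[of "Suc n" f] by blast
  show ?case by (rule smooth_upto_SucI[OF *(1) Suc.IH[OF *(2)]])
qed

lemma smooth_upto_continuous: "smooth_upto n f \<Longrightarrow> continuous_on UNIV f"
proof (induction n)
  case (Suc n)
  show ?case by (rule Suc.IH[OF smooth_upto_SucD[OF Suc.prems]])
qed auto

lemma smooth_upto_const [simp]: "smooth_upto n (\<lambda>_. c)"
proof (induction n arbitrary: c)
  case (Suc n)
  show ?case by (rule smooth_upto_SucI[where f' = "\<lambda>_. 0"]) (auto intro: Suc)
qed auto

lemma smooth_upto_add: "smooth_upto n f \<Longrightarrow> smooth_upto n g \<Longrightarrow> smooth_upto n (\<lambda>x. f x + g x)"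
proof (induction n arbitrary: f g)
  case 0
  then show ?case by (auto intro!: continuous_on_add continuous_on_mult)
next
  case (Suc n)
  from Suc.prems obtain f' g' where
    "\<And>x. (f has_real_derivative f' x) (at x)" "smooth_upto n f'"
    "\<And>x. (g has_real_derivative g' x) (at x)" "smooth_upto n g'" by auto
  then show ?case
    by (intro smooth_upto_SucI[where f' = "\<lambda>x. f' x + g' x"] Suc.IH) (auto intro: DERIV_add)
qed

lemma smooth_upto_mult: "smooth_upto n f \<Longrightarrow> smooth_upto n g \<Longrightarrow> smooth_upto n (\<lambda>x. f x * g x)"
proof (induction n arbitrary: f g)
  case 0
  then show ?case by (auto intro!: continuous_on_add continuous_on_mult)
next
  case (Suc n)
  from Suc.prems obtain f' g' where
    *: "\<And>x. (f has_real_derivative f' x) (at x)" "smooth_upto n f'"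
    "\<And>x. (g has_real_derivative g' x) (at x)" "smooth_upto n g'" by auto
  note sf = smooth_upto_SucD[OF Suc.prems(1)] smooth_upto_SucD[OF Suc.prems(2)]
  from * sf show ?case
    by (intro smooth_upto_SucI[where f' = "\<lambda>x. f x * g' x + g x * f' x"] smooth_upto_add Suc.IH)
       (auto intro!: derivative_eq_intros)
qed

lemma smooth_upto_affine: "smooth_upto n f \<Longrightarrow> smooth_upto n (\<lambda>x. f (a * x + b))"
proof (induction n arbitrary: f)
  case 0
  then show ?case 
    by (auto intro!: continuous_on_compose2[of UNIV f UNIV "\<lambda>x. a * x + b"] continuous_intros)
next
  case (Suc n)
  then obtain f' where *: "\<And>x. (f has_real_derivative f' x) (at x)" "smooth_upto n f'" by auto
  show ?case
  proof (rule smooth_upto_SucI[where f' = "\<lambda>x. f' (a * x + b) * a"])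
    show "((\<lambda>x. f (a * x + b)) has_real_derivative f' (a * x + b) * a) (at x)" for x
      by (rule DERIV_chain2[of f _ "\<lambda>x. a * x + b", OF *(1)]) (auto intro!: derivative_eq_intros)
    show "smooth_upto n (\<lambda>x. f' (a * x + b) * a)"
      by (rule smooth_upto_mult[OF Suc.IH[OF *(2)] smooth_upto_const])
  qed
qed

lemma has_real_derivative_locally_zero:
  fixes f :: "real \<Rightarrow> real"
  assumes "open S" "x \<in> S" "\<And>y. y \<in> S \<Longrightarrow> f y = 0"
  shows "(f has_real_derivative 0) (at x)"
proof -
  have "((\<lambda>_. 0) has_real_derivative 0) (at x)" by simp
  then show ?thesis
    by (rule has_field_derivative_transform_within_open[OF _ assms(1,2)]) (use assms in auto)
qed

text \<open>Both the averaging kernel and its flux contain a power of \<open>\<bar>y\<bar>\<close> that is singular at the origin in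
  general. A factor that vanishes near 0 removes the singularity, and this property is inherited by
  its derivative, which keeps the induction going.\<close>

lemma smooth_upto_mult_powr:
  assumes "0 < \<delta>"
  shows "smooth_upto n g \<Longrightarrow> (\<And>s. s < \<delta> \<Longrightarrow> g s = 0) \<Longrightarrow> smooth_upto n (\<lambda>s. g s * s powr a)"
proof (induction n arbitrary: g a)
  case 0
  have "isCont (\<lambda>s. g s * s powr a) x" for x
  proof (cases "x < \<delta>")
    case True
    have "((\<lambda>s. g s * s powr a) has_real_derivative 0) (at x)"
      by (rule has_real_derivative_locally_zero[of "{..<\<delta>}"]) (use True 0(2) in auto)
    then show ?thesis by (rule DERIV_isCont)
  next
    case False
    then have "x \<noteq> 0" using assms by auto
    moreover have "isCont g x" using 0 by (simp add: continuous_on_eq_continuous_at)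
    ultimately show ?thesis by (intro continuous_intros) auto
  qed
  then show ?case by (simp add: continuous_on_eq_continuous_at)
next
  case (Suc n)
  then obtain g' where *: "\<And>x. (g has_real_derivative g' x) (at x)" "smooth_upto n g'" by auto
  have g'0: "g' s = 0" if "s < \<delta>" for s
    by (rule DERIV_unique[OF *(1)], rule has_real_derivative_locally_zero[of "{..<\<delta>}"])
       (use that Suc.prems(2) in auto)
  note smg = smooth_upto_SucD[OF Suc.prems(1)]
  show ?case
  proof (rule smooth_upto_SucI[where f' = "\<lambda>s. g' s * s powr a + a * (g s * s powr (a - 1))"])
    fix x
    show "((\<lambda>s. g s * s powr a) has_real_derivative g' x * x powr a + a * (g x * x powr (a - 1))) (at x)"
    proof (cases "x < \<delta>")
      case True
      have "((\<lambda>s. g s * s powr a) has_real_derivative 0) (at x)"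
        by (rule has_real_derivative_locally_zero[of "{..<\<delta>}"]) (use True Suc.prems(2) in auto)
      then show ?thesis using True g'0 Suc.prems(2) by simp
    next
      case False
      then have "x > 0" using assms by auto
      from DERIV_mult[OF *(1)[of x] has_real_derivative_powr[OF this, of a]] show ?thesis
        by (simp add: algebra_simps)
    qed
    show "smooth_upto n (\<lambda>s. g' s * s powr a + a * (g s * s powr (a - 1)))"
      by (rule smooth_upto_add[OF Suc.IH[OF *(2) g'0] smooth_upto_mult[OF smooth_upto_const Suc.IH[OF smg Suc.prems(2)]]])
  qed
qed

section \<open>A smooth bump on an interval and its primitive\<close>

text \<open>The powers of \<open>1 / t\<close> are included because the derivative of \<open>exp (- 1 / t)\<close> and all further ones
  are combinations of these functions.\<close>

definition flat_exp :: "nat \<Rightarrow> real \<Rightarrow> real" where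
  "flat_exp m t = (if t > 0 then (1 / t) ^ m * exp (- 1 / t) else 0)"

lemma flat_exp_tendsto_0: "(flat_exp m \<longlongrightarrow> 0) (at_right 0)"
proof -
  have "((\<lambda>x. x ^ m / exp x) \<longlongrightarrow> (0::real)) at_top"
    by (rule tendsto_power_div_exp_0)
  then have "((\<lambda>t. (inverse t) ^ m / exp (inverse t)) \<longlongrightarrow> (0::real)) (at_right 0)"
    by (rule filterlim_compose[OF _ filterlim_inverse_at_top_right])
  moreover have "eventually (\<lambda>t. (inverse t) ^ m / exp (inverse t) = flat_exp m t) (at_right (0::real))"
    by (auto simp: eventually_at_filter flat_exp_def exp_minus field_simps)
  ultimately show ?thesis by (rule Lim_transform_eventually)
qed

text \<open>The point 0 is the only delicate one: there the difference quotient of \<open>flat_exp m\<close> from the right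
  is \<open>flat_exp (m + 1)\<close>, which tends to 0.\<close>

lemma flat_exp_deriv: "(flat_exp m has_real_derivative (flat_exp (m + 2) t - real m * flat_exp (m + 1) t)) (at t)"
proof -
  consider "t > 0" | "t < 0" | "t = 0" by linarith
  then show ?thesis
  proof cases
    case 1
    have "((\<lambda>t. (1 / t) ^ m * exp (- 1 / t)) has_real_derivative
        flat_exp (m + 2) t - real m * flat_exp (m + 1) t) (at t)"
    proof (cases m)
      case 0
      show ?thesis unfolding flat_exp_def using 1 0
        by (auto intro!: derivative_eq_intros simp: field_simps power2_eq_square)
    next
      case (Suc k)
      have r: "((\<lambda>t. 1 / t) has_real_derivative - ((1 / t) ^ 2)) (at t)"
        using 1 by (auto intro!: derivative_eq_intros simp: power2_eq_square)
      from DERIV_mult[OF DERIV_power[OF r, of m] DERIV_chain2[OF DERIV_exp DERIV_minus[OF r]]]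
      show ?thesis unfolding flat_exp_def using 1 Suc by (simp add: algebra_simps power2_eq_square)
    qed
    then show ?thesis
      by (rule has_field_derivative_transform_within_open[of _ _ _ "{0<..}"])
         (use 1 in \<open>auto simp: flat_exp_def\<close>)
  next
    case 2
    have "(flat_exp m has_real_derivative 0) (at t)"
      by (rule has_real_derivative_locally_zero[of "{..<0}"]) (use 2 in \<open>auto simp: flat_exp_def\<close>)
    then show ?thesis using 2 by (simp add: flat_exp_def)
  next
    case 3
    have "((\<lambda>h. flat_exp m h / h) \<longlongrightarrow> 0) (at_left 0)"
      by (rule Lim_transform_eventually[of "\<lambda>_. 0"])
         (auto simp: eventually_at_filter flat_exp_def)
    moreover have "((\<lambda>h. flat_exp m h / h) \<longlongrightarrow> 0) (at_right 0)"
      by (rule Lim_transform_eventually[OF flat_exp_tendsto_0[of "Suc m"]])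
         (auto simp: eventually_at_filter flat_exp_def)
    ultimately have "((\<lambda>h. flat_exp m h / h) \<longlongrightarrow> 0) (at 0)"
      by (simp add: filterlim_split_at)
    then show ?thesis using 3 by (simp add: DERIV_def flat_exp_def)
  qed
qed

lemma smooth_upto_flat_exp: "smooth_upto n (flat_exp m)"
proof (induction n arbitrary: m)
  case 0
  show ?case by (auto simp: continuous_on_eq_continuous_at intro: DERIV_isCont flat_exp_deriv)
next
  case (Suc n)
  show ?case
  proof (rule smooth_upto_SucI[OF flat_exp_deriv])
    have "smooth_upto n (\<lambda>t. flat_exp (m + 2) t + (- real m) * flat_exp (m + 1) t)"
      by (intro smooth_upto_add smooth_upto_mult[where f = "\<lambda>_. - real m"] Suc smooth_upto_const)
    then show "smooth_upto n (\<lambda>t. flat_exp (m + 2) t - real m * flat_exp (m + 1) t)" by simp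
  qed
qed

text \<open>Evaluated at \<open>\<bar>y\<bar>\<^sup>2 / r\<^sup>2\<close>, this is a bump on the annulus \<open>r / 2 < \<bar>y\<bar> < r\<close>.\<close>

definition annulus_bump :: "real \<Rightarrow> real" where
  "annulus_bump s = flat_exp 0 (s - 1/4) * flat_exp 0 (1 - s)"

lemma smooth_upto_annulus_bump: "smooth_upto n annulus_bump"
proof -
  have "smooth_upto n (\<lambda>s. flat_exp 0 (1 * s + (-1/4)) * flat_exp 0 ((-1) * s + 1))"
    by (intro smooth_upto_mult smooth_upto_affine smooth_upto_flat_exp)
  then show ?thesis by (simp add: annulus_bump_def[abs_def])
qed

lemma annulus_bump_nonneg: "annulus_bump s \<ge> 0"
  and annulus_bump_eq_0: "s \<le> 1/4 \<or> 1 \<le> s \<Longrightarrow> annulus_bump s = 0"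
  and annulus_bump_pos: "1/4 < s \<Longrightarrow> s < 1 \<Longrightarrow> 0 < annulus_bump s"
  and annulus_bump_le_1: "annulus_bump s \<le> 1"
  by (auto simp: annulus_bump_def flat_exp_def mult_le_one)

definition bump_primitive :: "real \<Rightarrow> real" where
  "bump_primitive s = integral {0..s} annulus_bump"

lemma annulus_bump_continuous: "continuous_on S annulus_bump"
  using smooth_upto_continuous[OF smooth_upto_annulus_bump] continuous_on_subset by blast

lemma bump_primitive_zero: "s \<le> 1/4 \<Longrightarrow> bump_primitive s = 0"
proof -
  assume s: "s \<le> 1/4"
  have "integral {0..s} annulus_bump = integral {0..s} (\<lambda>_. 0)"
    by (rule integral_cong) (use s in \<open>auto intro: annulus_bump_eq_0\<close>)
  then show ?thesis by (simp add: bump_primitive_def)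
qed

lemma bump_primitive_deriv: "(bump_primitive has_real_derivative annulus_bump s) (at s)"
proof (cases "s > 0")
  case True
  have "((\<lambda>x. integral {0..x} annulus_bump) has_real_derivative annulus_bump s) (at s within {0..s + 1})"
    by (rule integral_has_real_derivative) (use True annulus_bump_continuous in auto)
  then have "((\<lambda>x. integral {0..x} annulus_bump) has_real_derivative annulus_bump s) (at s)"
    using True by (subst (asm) at_within_interior) auto
  then show ?thesis by (simp add: bump_primitive_def[abs_def])
next
  case False
  have "(bump_primitive has_real_derivative 0) (at s)"
    by (rule has_real_derivative_locally_zero[of "{..<1/4}"]) (use False bump_primitive_zero in auto)
  then show ?thesis using False by (simp add: annulus_bump_eq_0)
qed

lemma smooth_upto_bump_primitive: "smooth_upto n bump_primitive"
  by (rule smooth_upto_SucD, rule smooth_upto_SucI[OF bump_primitive_deriv smooth_upto_annulus_bump])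

lemma bump_primitive_mono: "s \<le> t \<Longrightarrow> bump_primitive s \<le> bump_primitive t"
  by (rule DERIV_nonneg_imp_nondecreasing) (auto intro: bump_primitive_deriv annulus_bump_nonneg)

lemma bump_primitive_const: assumes "1 \<le> s" shows "bump_primitive s = bump_primitive 1"
proof (rule DERIV_isconst2[where a = 1 and b = "s + 1"])
  show "continuous_on {1..s + 1} bump_primitive"
    using smooth_upto_continuous[OF smooth_upto_bump_primitive] continuous_on_subset by blast
  show "(bump_primitive has_real_derivative 0) (at x)" if "1 < x" "x < s + 1" for x
    using bump_primitive_deriv[of x] annulus_bump_eq_0[of x] that by auto
qed (use assms in auto)

lemma bump_primitive_bounds: "0 \<le> bump_primitive s" "bump_primitive s \<le> bump_primitive 1"
proof -
  have "bump_primitive s \<ge> bump_primitive (min s 0)" by (rule bump_primitive_mono) auto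
  then show "0 \<le> bump_primitive s" by (simp add: bump_primitive_zero)
  have "bump_primitive s \<le> bump_primitive (max s 1)" by (rule bump_primitive_mono) auto
  then show "bump_primitive s \<le> bump_primitive 1" using bump_primitive_const[of "max s 1"] by simp
qed

section \<open>Radial test functions\<close>

text \<open>These two rules replace the derivative in the definition of \<open>C_k\<close> by one given in closed form.\<close>

lemma C_k_SucI:
  assumes "\<And>x. (f has_derivative D x) (at x)" "\<And>v. C_k k (\<lambda>x. D x v)"
  shows "C_k (Suc k) f"
proof -
  have "frechet_derivative f (at x) = D x" for x
    using frechet_derivative_at[OF assms(1)] by simp
  then show ?thesis using assms by (auto intro: differentiableI)
qed

lemma C_k_SucD:
  assumes "C_k (Suc k) f"
  obtains D where "\<And>x. (f has_derivative D x) (at x)" "\<And>v. C_k k (\<lambda>x. D x v)"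
proof (rule that)
  show "(f has_derivative frechet_derivative f (at x)) (at x)" for x
    using assms frechet_derivative_works by auto
  show "C_k k (\<lambda>x. frechet_derivative f (at x) v)" for v using assms by auto
qed

lemma C_k_Suc_imp_C_k: "C_k (Suc k) f \<Longrightarrow> C_k k f"
proof (induction k arbitrary: f rule: nat.induct)
  case zero
  then show ?case
    by (auto simp: continuous_on_eq_continuous_at intro: differentiable_imp_continuous_within)
next
  case (Suc k)
  from Suc.prems obtain D where D: "\<And>x. (f has_derivative D x) (at x)" "\<And>v. C_k (Suc k) (\<lambda>x. D x v)"
    by (rule C_k_SucD) (rule that)
  show ?case by (rule C_k_SucI[OF D(1) Suc.IH[OF D(2)]])
qed

lemma C_k_const: "C_k k (\<lambda>_. c)"
proof (induction k arbitrary: c)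
  case (Suc k)
  show ?case by (rule C_k_SucI[OF has_derivative_const Suc.IH])
qed auto

lemma C_k_add: "C_k k f \<Longrightarrow> C_k k g \<Longrightarrow> C_k k (\<lambda>x. f x + g x)"
proof (induction k arbitrary: f g)
  case 0
  then show ?case by (simp add: continuous_on_add)
next
  case (Suc k)
  from Suc.prems(1) obtain D where D: "\<And>x. (f has_derivative D x) (at x)" "\<And>v. C_k k (\<lambda>x. D x v)"
    by (rule C_k_SucD) (rule that)
  from Suc.prems(2) obtain E where E: "\<And>x. (g has_derivative E x) (at x)" "\<And>v. C_k k (\<lambda>x. E x v)"
    by (rule C_k_SucD) (rule that)
  show ?case
    by (rule C_k_SucI[OF has_derivative_add[OF D(1) E(1)] Suc.IH[OF D(2) E(2)]])
qed

lemma C_k_mult: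
  fixes f g :: "'a::real_normed_vector \<Rightarrow> real"
  shows "C_k k f \<Longrightarrow> C_k k g \<Longrightarrow> C_k k (\<lambda>x. f x * g x)"
proof (induction k arbitrary: f g)
  case 0
  then show ?case by (simp add: continuous_on_mult)
next
  case (Suc k)
  from Suc.prems(1) obtain D where D: "\<And>x. (f has_derivative D x) (at x)" "\<And>v. C_k k (\<lambda>x. D x v)"
    by (rule C_k_SucD) (rule that)
  from Suc.prems(2) obtain E where E: "\<And>x. (g has_derivative E x) (at x)" "\<And>v. C_k k (\<lambda>x. E x v)"
    by (rule C_k_SucD) (rule that)
  show ?case
    by (rule C_k_SucI[OF has_derivative_mult[OF D(1) E(1)]
      C_k_add[OF Suc.IH[OF C_k_Suc_imp_C_k[OF Suc.prems(1)] E(2)] Suc.IH[OF D(2) C_k_Suc_imp_C_k[OF Suc.prems(2)]]]])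
qed

lemma C_k_inner:
  fixes a v :: "'a::real_inner"
  shows "C_k k (\<lambda>x. (x - a) \<bullet> v)"
proof (cases k)
  case 0
  then show ?thesis by (auto intro!: continuous_intros)
next
  case (Suc j)
  have "((\<lambda>x. (x - a) \<bullet> v) has_derivative (\<lambda>h. h \<bullet> v)) (at x)" for x
    by (auto intro!: derivative_eq_intros)
  from C_k_SucI[OF this C_k_const] show ?thesis using Suc by simp
qed

lemma has_derivative_radial:
  fixes a :: "'a::real_inner"
  assumes "\<And>s. (g has_real_derivative g' s) (at s)"
  shows "((\<lambda>x. g ((x - a) \<bullet> (x - a))) has_derivative
           (\<lambda>v. g' ((x - a) \<bullet> (x - a)) * (2 * ((x - a) \<bullet> v)))) (at x)"
proof -
  have "((\<lambda>x. (x - a) \<bullet> (x - a)) has_derivative (\<lambda>v. 2 * ((x - a) \<bullet> v))) (at x)"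
    by (auto intro!: derivative_eq_intros simp: inner_commute)
  from has_derivative_compose[OF this assms[of "(x - a) \<bullet> (x - a)", unfolded has_field_derivative_def]]
  show ?thesis by simp
qed

lemma C_k_radial:
  fixes a :: "'a::real_inner"
  shows "smooth_upto k g \<Longrightarrow> C_k k (\<lambda>x. g ((x - a) \<bullet> (x - a)))"
proof (induction k arbitrary: g)
  case 0
  then show ?case
    by (auto intro!: continuous_on_compose2[of UNIV g UNIV "\<lambda>x. (x - a) \<bullet> (x - a)"] continuous_intros)
next
  case (Suc k)
  then obtain g' where g': "\<And>x. (g has_real_derivative g' x) (at x)" "smooth_upto k g'" by auto
  have "C_k k (\<lambda>x. 2 * ((x - a) \<bullet> v))" for v :: 'a
    by (rule C_k_mult[OF C_k_const C_k_inner])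
  from C_k_SucI[OF has_derivative_radial[OF g'(1)] C_k_mult[OF Suc.IH[OF g'(2)] this]]
  show ?case .
qed

lemma test_function_I:
  fixes \<phi> :: "'a::euclidean_space \<Rightarrow> real"
  assumes "\<And>k. C_k k \<phi>" "\<And>x. R < dist a x \<Longrightarrow> \<phi> x = 0"
  shows "test_function \<phi>"
proof -
  have "{x. \<phi> x \<noteq> 0} \<subseteq> cball a R" using assms(2) by (auto simp: not_less[symmetric])
  then have "bounded {x. \<phi> x \<noteq> 0}" using bounded_cball bounded_subset by blast
  then show ?thesis using assms(1) by (simp add: test_function_def)
qed

section \<open>The dyadic maximal function\<close>

text \<open>The normalisation is \<open>r\<^sup>-\<^sup>N\<close> rather than the inverse volume of the ball. Radii are powers of 2, so
  that the supremum below is countable and measurable.\<close>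

definition dyadic_avg :: "int \<Rightarrow> ('a::euclidean_space \<Rightarrow> ennreal) \<Rightarrow> 'a \<Rightarrow> ennreal" where
  "dyadic_avg j f x = ennreal ((2 powi j) powr - real DIM('a)) * (\<integral>\<^sup>+ y\<in>ball x (2 powi j). f y \<partial>lborel)"

definition dyadic_max :: "('a::euclidean_space \<Rightarrow> ennreal) \<Rightarrow> 'a \<Rightarrow> ennreal" where
  "dyadic_max f x = (SUP j. dyadic_avg j f x)"

lemma ball_in_borel [measurable]: "ball x r \<in> sets borel"
  by simp

lemma borel_measurable_ball_integral [measurable]:
  fixes f :: "'a::euclidean_space \<Rightarrow> ennreal"
  assumes [measurable]: "f \<in> borel_measurable borel"
  shows "(\<lambda>x. \<integral>\<^sup>+ y\<in>ball x r. f y \<partial>lborel) \<in> borel_measurable borel"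
proof -
  have "(\<lambda>x. \<integral>\<^sup>+ y. f y * (if dist x y < r then 1 else 0) \<partial>lborel) \<in> borel_measurable borel"
    by measurable
  then show ?thesis by (simp add: indicator_def ball_def if_distrib cong: if_cong)
qed

lemma borel_measurable_dyadic_avg [measurable]:
  "f \<in> borel_measurable borel \<Longrightarrow> dyadic_avg j f \<in> borel_measurable borel"
  unfolding dyadic_avg_def[abs_def] by measurable

lemma borel_measurable_dyadic_max [measurable]:
  "f \<in> borel_measurable borel \<Longrightarrow> dyadic_max f \<in> borel_measurable borel"
  unfolding dyadic_max_def[abs_def] by measurable

lemma dyadic_avg_le_max: "dyadic_avg j f x \<le> dyadic_max f x"
  unfolding dyadic_max_def by (rule SUP_upper) auto

lemma dyadic_avg_mono: "(\<And>y. f y \<le> g y) \<Longrightarrow> dyadic_avg j f x \<le> dyadic_avg j g x"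
  unfolding dyadic_avg_def by (intro mult_left_mono nn_integral_mono mult_right_mono) auto

lemma emeasure_ball_powr:
  fixes x :: "'a::euclidean_space"
  assumes "r > 0"
  shows "emeasure lborel (ball x r) = ennreal (unit_ball_vol (real DIM('a)) * r powr real DIM('a))"
  using assms by (simp add: emeasure_ball powr_realpow)

lemma dyadic_avg_const:
  "dyadic_avg j (\<lambda>_. c) (x::'a::euclidean_space) = ennreal (unit_ball_vol (real DIM('a))) * c"
proof -
  have "ennreal ((2 powi j) powr - real DIM('a)) * (c * emeasure lborel (ball x (2 powi j)))
     = c * ennreal ((2 powi j) powr - real DIM('a) * (unit_ball_vol (real DIM('a)) * (2 powi j) powr real DIM('a)))"
    by (subst emeasure_ball_powr) (auto simp: ennreal_mult'' mult_ac)
  then show ?thesis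
    unfolding dyadic_avg_def by (simp add: nn_integral_cmult_indicator powr_minus mult_ac)
qed

lemma dyadic_avg_add:
  assumes [measurable]: "f \<in> borel_measurable borel" "g \<in> borel_measurable borel"
  shows "dyadic_avg j (\<lambda>y. f y + g y) x = dyadic_avg j f x + dyadic_avg j g x"
proof -
  have "(\<integral>\<^sup>+ y\<in>ball x (2 powi j). (f y + g y) \<partial>lborel)
      = (\<integral>\<^sup>+ y\<in>ball x (2 powi j). f y \<partial>lborel) + (\<integral>\<^sup>+ y\<in>ball x (2 powi j). g y \<partial>lborel)"
    unfolding distrib_right by (rule nn_integral_add) measurable
  then show ?thesis unfolding dyadic_avg_def by (simp add: distrib_left)
qed

text \<open>Vitali's argument: every point of the level set is the centre of a ball on which \<open>f\<close> has mass more
  than \<open>c r\<^sup>N\<close>; a disjoint subfamily of these balls, enlarged five times, still covers the level set.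
  Selecting the subfamily needs bounded radii, hence the bound on \<open>j\<close>.\<close>

lemma dyadic_max_weak_type_bounded:
  fixes f :: "'a::euclidean_space \<Rightarrow> ennreal"
  assumes [measurable]: "f \<in> borel_measurable borel" and lam: "0 < c"
  shows "ennreal c * emeasure lborel {x. \<exists>j\<le>n. ennreal c < dyadic_avg j f x}
    \<le> ennreal (5 ^ DIM('a) * unit_ball_vol (real DIM('a))) * (\<integral>\<^sup>+ y. f y \<partial>lborel)"
proof -
  let ?N = "real DIM('a)"
  let ?w = "unit_ball_vol ?N"
  define S where "S = {x. \<exists>j\<le>n. ennreal c < dyadic_avg j f x}"
  have [measurable]: "S \<in> sets borel" unfolding S_def by measurable
  have "\<forall>x\<in>S. \<exists>j\<le>n. ennreal c < dyadic_avg j f x" by (auto simp: S_def)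
  then obtain J where J: "\<And>x. x \<in> S \<Longrightarrow> J x \<le> n \<and> ennreal c < dyadic_avg (J x) f x" by metis
  define r where "r x = (2::real) powi J x" for x
  have rpos: "r x > 0" for x by (simp add: r_def)
  have r_bound: "0 < r x \<and> r x \<le> 2 powi n" if "x \<in> S" for x
    using J[OF that] rpos by (auto simp: r_def intro: power_int_increasing)
  have big: "ennreal c * emeasure lborel (ball x (5 * r x))
      \<le> ennreal (5 ^ DIM('a) * ?w) * (\<integral>\<^sup>+ y\<in>ball x (r x). f y \<partial>lborel)" if "x \<in> S" for x
  proof -
    have "ennreal (r x powr ?N) * ennreal c
        \<le> ennreal (r x powr ?N) * (ennreal (r x powr - ?N) * (\<integral>\<^sup>+ y\<in>ball x (r x). f y \<partial>lborel))"
      using J[OF that] by (intro mult_left_mono) (auto simp: dyadic_avg_def r_def)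
    also have "\<dots> = (\<integral>\<^sup>+ y\<in>ball x (r x). f y \<partial>lborel)"
      using rpos[of x] by (simp add: mult.assoc[symmetric] ennreal_mult[symmetric] powr_minus)
    finally have *: "ennreal (r x powr ?N) * ennreal c \<le> (\<integral>\<^sup>+ y\<in>ball x (r x). f y \<partial>lborel)" .
    have "ennreal c * emeasure lborel (ball x (5 * r x))
       = ennreal (5 ^ DIM('a) * ?w) * (ennreal (r x powr ?N) * ennreal c)"
      using rpos[of x] lam
      by (subst emeasure_ball_powr) (auto simp: powr_mult powr_realpow ennreal_mult[symmetric] mult_ac)
    also have "\<dots> \<le> ennreal (5 ^ DIM('a) * ?w) * (\<integral>\<^sup>+ y\<in>ball x (r x). f y \<partial>lborel)"
      by (intro mult_left_mono *) auto
    finally show ?thesis .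
  qed
  obtain C where C: "countable C" "C \<subseteq> S"
      "pairwise (\<lambda>i j. disjnt (ball i (r i)) (ball j (r j))) C"
      "S \<subseteq> (\<Union>i\<in>C. ball i (5 * r i))"
  proof (rule Vitali_covering_lemma_balls[where S = S and K = S and a = "\<lambda>x. x" and r = r and B = "2 powi n"])
    show "S \<subseteq> (\<Union>i\<in>S. ball i (r i))" using rpos by (auto intro!: bexI)
  qed (use r_bound in auto)
  \<comment> \<open>The family is indexed by the natural numbers so that countable subadditivity applies.\<close>
  define A where "A k = (if k \<in> to_nat_on C ` C then ball (from_nat_into C k) (5 * r (from_nat_into C k)) else {})" for k
  define B where "B k = (if k \<in> to_nat_on C ` C then ball (from_nat_into C k) (r (from_nat_into C k)) else {})" for k
  have [measurable]: "A k \<in> sets borel" "B k \<in> sets borel" for k by (auto simp: A_def B_def)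
  have SA: "S \<subseteq> (\<Union>k. A k)"
  proof
    fix x assume "x \<in> S"
    then obtain i where "i \<in> C" "x \<in> ball i (5 * r i)" using C(4) by auto
    then have "x \<in> A (to_nat_on C i)" using C(1) by (auto simp: A_def)
    then show "x \<in> (\<Union>k. A k)" by auto
  qed
  have disj: "disjoint_family B"
    unfolding disjoint_family_on_def
  proof (intro ballI impI)
    fix m k :: nat assume "m \<noteq> k"
    show "B m \<inter> B k = {}"
    proof (cases "m \<in> to_nat_on C ` C \<and> k \<in> to_nat_on C ` C")
      case True
      then obtain a b where ab: "a \<in> C" "b \<in> C" "m = to_nat_on C a" "k = to_nat_on C b" by auto
      with \<open>m \<noteq> k\<close> have "a \<noteq> b" by auto
      with C(3) ab have "disjnt (ball a (r a)) (ball b (r b))" by (auto simp: pairwise_def)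
      then show ?thesis using ab C(1) by (simp add: B_def disjnt_def)
    qed (auto simp: B_def)
  qed
  have AB: "ennreal c * emeasure lborel (A k) \<le> ennreal (5 ^ DIM('a) * ?w) * (\<integral>\<^sup>+ y\<in>B k. f y \<partial>lborel)" for k
  proof (cases "k \<in> to_nat_on C ` C")
    case True
    then obtain a where "a \<in> C" "k = to_nat_on C a" by auto
    then show ?thesis using big[of a] C(1,2) by (auto simp: A_def B_def)
  qed (auto simp: A_def)
  have "ennreal c * emeasure lborel S \<le> ennreal c * emeasure lborel (\<Union>k. A k)"
    by (intro mult_left_mono emeasure_mono SA) auto
  also have "\<dots> \<le> ennreal c * (\<Sum>k. emeasure lborel (A k))"
    by (intro mult_left_mono emeasure_subadditive_countably) auto
  also have "\<dots> = (\<Sum>k. ennreal c * emeasure lborel (A k))" by simp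
  also have "\<dots> \<le> (\<Sum>k. ennreal (5 ^ DIM('a) * ?w) * (\<integral>\<^sup>+ y\<in>B k. f y \<partial>lborel))"
    by (intro suminf_le AB) auto
  also have "\<dots> = ennreal (5 ^ DIM('a) * ?w) * (\<Sum>k. (\<integral>\<^sup>+ y\<in>B k. f y \<partial>lborel))" by simp
  also have "\<dots> = ennreal (5 ^ DIM('a) * ?w) * (\<integral>\<^sup>+ y\<in>(\<Union>k. B k). f y \<partial>lborel)"
    using disj by (subst nn_integral_disjoint_family) auto
  also have "\<dots> \<le> ennreal (5 ^ DIM('a) * ?w) * (\<integral>\<^sup>+ y. f y \<partial>lborel)"
    by (intro mult_left_mono nn_integral_mono) (auto simp: indicator_def)
  finally show ?thesis unfolding S_def .
qed

lemma dyadic_max_weak_type: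
  fixes f :: "'a::euclidean_space \<Rightarrow> ennreal"
  assumes [measurable]: "f \<in> borel_measurable borel" and lam: "0 < c"
  shows "ennreal c * emeasure lborel {x. ennreal c < dyadic_max f x}
    \<le> ennreal (5 ^ DIM('a) * unit_ball_vol (real DIM('a))) * (\<integral>\<^sup>+ y. f y \<partial>lborel)"
proof -
  define S where "S n = {x. \<exists>j\<le>int n. ennreal c < dyadic_avg j f x}" for n
  have [measurable]: "S n \<in> sets borel" for n unfolding S_def by measurable
  have "{x. ennreal c < dyadic_max f x} = (\<Union>n. S n)"
    by (auto simp: S_def dyadic_max_def less_SUP_iff) (metis nat_le_iff order_refl)
  moreover have "emeasure lborel (\<Union>n. S n) = (SUP n. emeasure lborel (S n))"
    by (intro SUP_emeasure_incseq[symmetric]) (auto simp: S_def incseq_def intro: order_trans[OF _ of_nat_mono])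
  ultimately have "ennreal c * emeasure lborel {x. ennreal c < dyadic_max f x}
      = (SUP n. ennreal c * emeasure lborel (S n))"
    by (simp add: SUP_mult_left_ennreal)
  also have "\<dots> \<le> ennreal (5 ^ DIM('a) * unit_ball_vol (real DIM('a))) * (\<integral>\<^sup>+ y. f y \<partial>lborel)"
    unfolding S_def by (intro SUP_least dyadic_max_weak_type_bounded assms)
  finally show ?thesis .
qed

text \<open>The layer cake formula for the square; with values in \<open>[0, \<infinity>]\<close> the inequality is what Fubini's
  theorem is applied to below.\<close>

lemma square_le_layer_integral:
  "(c::ennreal)\<^sup>2 \<le> (\<integral>\<^sup>+ t\<in>{t. 0 < t \<and> ennreal t < c}. ennreal (2 * t) \<partial>lborel)"
proof -
  have *: "ennreal (a\<^sup>2) = (\<integral>\<^sup>+ t\<in>{0<..<a}. ennreal (2 * t) \<partial>lborel)" if "0 \<le> a" for a :: real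
  proof -
    have "(\<integral>\<^sup>+ t. ennreal (2 * t) * indicator {0..a} t \<partial>lborel) = a\<^sup>2 - 0\<^sup>2"
      by (rule nn_integral_FTC_Icc) (use that in \<open>auto intro!: derivative_eq_intros\<close>)
    moreover have "(\<integral>\<^sup>+ t. ennreal (2 * t) * indicator {0..a} t \<partial>lborel)
        = (\<integral>\<^sup>+ t\<in>{0<..<a}. ennreal (2 * t) \<partial>lborel)"
      by (intro nn_integral_cong_AE AE_mp[OF AE_lborel_singleton[of a] AE_I2])
         (auto simp: indicator_def)
    ultimately show ?thesis by simp
  qed
  show ?thesis
  proof (cases c)
    case (real a)
    then have "{t. 0 < t \<and> ennreal t < c} = {0<..<a}" by (auto simp: ennreal_less_iff)
    then show ?thesis using * real by (simp add: ennreal_power)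
  next
    case top
    have "ennreal (real n) \<le> (\<integral>\<^sup>+ t\<in>{t. 0 < t \<and> ennreal t < c}. ennreal (2 * t) \<partial>lborel)" for n :: nat
    proof -
      have "real n \<le> (real n)\<^sup>2" by (cases n) (auto simp: power2_eq_square)
      then have "ennreal (real n) \<le> ennreal ((real n)\<^sup>2)" by (rule ennreal_leI)
      also have "\<dots> = (\<integral>\<^sup>+ t\<in>{0<..<real n}. ennreal (2 * t) \<partial>lborel)" by (rule *) simp
      also have "\<dots> \<le> (\<integral>\<^sup>+ t\<in>{t. 0 < t \<and> ennreal t < c}. ennreal (2 * t) \<partial>lborel)"
        by (intro nn_integral_mono) (auto simp: indicator_def top)
      finally show ?thesis .
    qed
    then have "(\<integral>\<^sup>+ t\<in>{t. 0 < t \<and> ennreal t < c}. ennreal (2 * t) \<partial>lborel) = top"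
      by (metis ennreal_Ex_less_of_nat ennreal_of_nat_eq_real_of_nat leD top.not_eq_extremum)
    then show ?thesis by simp
  qed
qed

lemma layer_emeasure_le: "emeasure lborel {t::real. 0 < t \<and> ennreal t < c} \<le> c"
proof (cases c)
  case (real a)
  then have "{t. 0 < t \<and> ennreal t < c} = {0<..<a}" by (auto simp: ennreal_less_iff)
  then show ?thesis using real by simp
qed simp

definition maximal_const :: "'a::euclidean_space itself \<Rightarrow> real" where
  "maximal_const _ = 8 * 5 ^ DIM('a) * (unit_ball_vol (real DIM('a)))\<^sup>2"

text \<open>Marcinkiewicz interpolation between the weak type bound and the trivial bound for bounded functions:
  at level \<open>t\<close> the values of \<open>f\<close> below \<open>t / (2 w)\<close>, with \<open>w\<close> the volume of the unit ball, contribute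
  at most \<open>t / 2\<close> to every average, so only the part \<open>h t\<close> of \<open>f\<close> above that value has to be
  controlled, and the weak type bounds for these parts are integrated in \<open>t\<close>.\<close>

theorem dyadic_max_L2:
  fixes f :: "'a::euclidean_space \<Rightarrow> ennreal"
  assumes [measurable]: "f \<in> borel_measurable borel"
  shows "(\<integral>\<^sup>+ x. (dyadic_max f x)\<^sup>2 \<partial>lborel) \<le> ennreal (maximal_const TYPE('a)) * (\<integral>\<^sup>+ y. (f y)\<^sup>2 \<partial>lborel)"
proof -
  let ?w = "unit_ball_vol (real DIM('a))"
  let ?K = "5 ^ DIM('a) * ?w"
  have w: "?w > 0" by simp
  define h where "h t y = (if ennreal t < ennreal (2 * ?w) * f y then f y else 0)" for t y
  have [measurable]: "(\<lambda>(t, y). h t y) \<in> borel_measurable (borel \<Otimes>\<^sub>M borel)"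
    unfolding h_def split_beta by measurable
  have [measurable]: "h t \<in> borel_measurable borel" for t unfolding h_def by measurable
  have level: "ennreal (2 * t) * emeasure lborel {x. ennreal t < dyadic_max f x}
      \<le> ennreal (4 * ?K) * (\<integral>\<^sup>+ y. h t y \<partial>lborel)" if t: "t > 0" for t
  proof -
    have "f y \<le> h t y + ennreal (t / (2 * ?w))" for y
    proof (cases "ennreal t < ennreal (2 * ?w) * f y")
      case False
      then have "ennreal (2 * ?w) * f y \<le> ennreal t" by simp
      then have "ennreal (1 / (2 * ?w)) * (ennreal (2 * ?w) * f y) \<le> ennreal (1 / (2 * ?w)) * ennreal t"
        by (rule mult_left_mono) simp
      moreover have "ennreal (1 / (2 * ?w)) * (ennreal (2 * ?w) * f y) = f y"
        using less_imp_neq[OF w] by (simp add: mult.assoc[symmetric] ennreal_mult[symmetric])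
      moreover have "ennreal (1 / (2 * ?w)) * ennreal t = ennreal (t / (2 * ?w))"
        using w t by (simp add: ennreal_mult[symmetric])
      ultimately show ?thesis by (simp add: h_def False)
    qed (simp add: h_def)
    then have "dyadic_avg j f x \<le> dyadic_avg j (\<lambda>y. h t y + ennreal (t / (2 * ?w))) x" for j x
      by (rule dyadic_avg_mono)
    also have "dyadic_avg j (\<lambda>y. h t y + ennreal (t / (2 * ?w))) x
        = dyadic_avg j (h t) x + ennreal (t / 2)" for j x
      using less_imp_neq[OF w] t by (subst dyadic_avg_add) (auto simp: dyadic_avg_const ennreal_mult[symmetric])
    also have "dyadic_avg j (h t) x + ennreal (t / 2) \<le> dyadic_max (h t) x + ennreal (t / 2)" for j x
      by (intro add_right_mono dyadic_avg_le_max)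
    finally have *: "dyadic_max f x \<le> dyadic_max (h t) x + ennreal (t / 2)" for x
      unfolding dyadic_max_def[of f] by (intro SUP_least)
    have "{x. ennreal t < dyadic_max f x} \<subseteq> {x. ennreal (t / 2) < dyadic_max (h t) x}"
    proof safe
      fix x assume "ennreal t < dyadic_max f x"
      also note *
      finally have "ennreal t < dyadic_max (h t) x + ennreal (t / 2)" .
      moreover have "ennreal t = ennreal (t / 2) + ennreal (t / 2)"
        using t by (simp add: ennreal_plus[symmetric] del: ennreal_plus)
      ultimately show "ennreal (t / 2) < dyadic_max (h t) x"
        by (metis add_right_mono not_le)
    qed
    then have "emeasure lborel {x. ennreal t < dyadic_max f x}
        \<le> emeasure lborel {x. ennreal (t / 2) < dyadic_max (h t) x}"
      by (intro emeasure_mono) auto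
    then have "ennreal (2 * t) * emeasure lborel {x. ennreal t < dyadic_max f x}
        \<le> ennreal 4 * (ennreal (t / 2) * emeasure lborel {x. ennreal (t / 2) < dyadic_max (h t) x})"
      using t by (simp add: mult.assoc[symmetric] ennreal_mult[symmetric] mult_left_mono del: ennreal_numeral)
    also have "\<dots> \<le> ennreal 4 * (ennreal ?K * (\<integral>\<^sup>+ y. h t y \<partial>lborel))"
      using t by (intro mult_left_mono dyadic_max_weak_type) auto
    also have "\<dots> = ennreal (4 * ?K) * (\<integral>\<^sup>+ y. h t y \<partial>lborel)"
      using w by (simp add: mult.assoc[symmetric] ennreal_mult[symmetric] del: ennreal_numeral)
    finally show ?thesis .
  qed
  have [measurable]: "(\<lambda>z. dyadic_max f (fst z)) \<in> borel_measurable (borel \<Otimes>\<^sub>M borel)"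
    by measurable
  have "(\<integral>\<^sup>+ x. (dyadic_max f x)\<^sup>2 \<partial>lborel)
      \<le> (\<integral>\<^sup>+ x. (\<integral>\<^sup>+ t\<in>{t. 0 < t \<and> ennreal t < dyadic_max f x}. ennreal (2 * t) \<partial>lborel) \<partial>lborel)"
    by (intro nn_integral_mono square_le_layer_integral)
  also have "\<dots> = (\<integral>\<^sup>+ x. (\<integral>\<^sup>+ t. (if 0 < t \<and> ennreal t < dyadic_max f x then ennreal (2 * t) else 0) \<partial>lborel) \<partial>lborel)"
    by (intro nn_integral_cong) (auto simp: indicator_def)
  also have "\<dots> = (\<integral>\<^sup>+ t. (\<integral>\<^sup>+ x. (if 0 < t \<and> ennreal t < dyadic_max f x then ennreal (2 * t) else 0) \<partial>lborel) \<partial>lborel)"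
    by (rule lborel_pair.Fubini') measurable
  also have "\<dots> \<le> (\<integral>\<^sup>+ t. (if 0 < t then ennreal (4 * ?K) * (\<integral>\<^sup>+ y. h t y \<partial>lborel) else 0) \<partial>lborel)"
  proof (rule nn_integral_mono)
    fix t :: real
    show "(\<integral>\<^sup>+ x. (if 0 < t \<and> ennreal t < dyadic_max f x then ennreal (2 * t) else 0) \<partial>lborel)
      \<le> (if 0 < t then ennreal (4 * ?K) * (\<integral>\<^sup>+ y. h t y \<partial>lborel) else 0)"
    proof (cases "0 < t")
      case True
      have "(\<integral>\<^sup>+ x. (if 0 < t \<and> ennreal t < dyadic_max f x then ennreal (2 * t) else 0) \<partial>lborel)
        = (\<integral>\<^sup>+ x. ennreal (2 * t) * indicator {x. ennreal t < dyadic_max f x} x \<partial>lborel)"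
        using True by (intro nn_integral_cong) (auto simp: indicator_def)
      also have "\<dots> = ennreal (2 * t) * emeasure lborel {x. ennreal t < dyadic_max f x}"
        by (rule nn_integral_cmult_indicator) measurable
      finally show ?thesis using level[OF True] True by simp
    qed simp
  qed
  also have "\<dots> = (\<integral>\<^sup>+ t. (\<integral>\<^sup>+ y. ennreal (4 * ?K) * (if 0 < t then h t y else 0) \<partial>lborel) \<partial>lborel)"
    by (intro nn_integral_cong) (auto simp: nn_integral_cmult)
  also have "\<dots> = (\<integral>\<^sup>+ y. (\<integral>\<^sup>+ t. ennreal (4 * ?K) * (if 0 < t then h t y else 0) \<partial>lborel) \<partial>lborel)"
    by (rule lborel_pair.Fubini') measurable
  also have "\<dots> \<le> (\<integral>\<^sup>+ y. ennreal (maximal_const TYPE('a)) * (f y)\<^sup>2 \<partial>lborel)"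
  proof (rule nn_integral_mono)
    fix y :: 'a
    have "(\<integral>\<^sup>+ t. ennreal (4 * ?K) * (if 0 < t then h t y else 0) \<partial>lborel)
      = (\<integral>\<^sup>+ t. (ennreal (4 * ?K) * f y) * indicator {t. 0 < t \<and> ennreal t < ennreal (2 * ?w) * f y} t \<partial>lborel)"
      by (intro nn_integral_cong) (auto simp: indicator_def h_def)
    also have "\<dots> = (ennreal (4 * ?K) * f y) * emeasure lborel {t. 0 < t \<and> ennreal t < ennreal (2 * ?w) * f y}"
      by (rule nn_integral_cmult_indicator) measurable
    also have "\<dots> \<le> (ennreal (4 * ?K) * f y) * (ennreal (2 * ?w) * f y)"
      by (intro mult_left_mono layer_emeasure_le) auto
    also have "\<dots> = (ennreal (4 * ?K) * ennreal (2 * ?w)) * (f y)\<^sup>2"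
      by (simp add: power2_eq_square mult_ac)
    also have "ennreal (4 * ?K) * ennreal (2 * ?w) = ennreal (maximal_const TYPE('a))"
      using w by (simp add: ennreal_mult[symmetric] maximal_const_def power2_eq_square mult_ac)
    finally show "(\<integral>\<^sup>+ t. ennreal (4 * ?K) * (if 0 < t then h t y else 0) \<partial>lborel)
       \<le> ennreal (maximal_const TYPE('a)) * (f y)\<^sup>2" .
  qed
  also have "\<dots> = ennreal (maximal_const TYPE('a)) * (\<integral>\<^sup>+ y. (f y)\<^sup>2 \<partial>lborel)"
    by (rule nn_integral_cmult) measurable
  finally show ?thesis .
qed

section \<open>Density of continuous functions in L1\<close>

lemma cball_in_borel [measurable]: "cball x r \<in> sets borel"
  by simp

lemma nn_integral_lborel_affine:
  fixes f :: "'a::euclidean_space \<Rightarrow> ennreal"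
  assumes [measurable]: "f \<in> borel_measurable borel" and "c \<noteq> 0"
  shows "(\<integral>\<^sup>+ x. f x \<partial>lborel) = ennreal (\<bar>c\<bar> ^ DIM('a)) * (\<integral>\<^sup>+ x. f (t + c *\<^sub>R x) \<partial>lborel)"
proof -
  have "(\<integral>\<^sup>+ x. f x \<partial>lborel)
      = (\<integral>\<^sup>+ x. f x \<partial>density (distr lborel borel (\<lambda>x. t + c *\<^sub>R x)) (\<lambda>_. ennreal (\<bar>c\<bar> ^ DIM('a))))"
    by (rule arg_cong[where f = "\<lambda>M. nn_integral M f", OF lborel_affine[OF assms(2), of t]])
  also have "\<dots> = ennreal (\<bar>c\<bar> ^ DIM('a)) * (\<integral>\<^sup>+ x. f (t + c *\<^sub>R x) \<partial>lborel)"
    by (subst nn_integral_density; (subst nn_integral_distr)?; (subst nn_integral_cmult)?; measurable?)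
  finally show ?thesis .
qed

lemma nn_integral_lborel_translate:
  fixes f :: "'a::euclidean_space \<Rightarrow> ennreal"
  assumes "f \<in> borel_measurable borel"
  shows "(\<integral>\<^sup>+ x. f (x + t) \<partial>lborel) = (\<integral>\<^sup>+ x. f x \<partial>lborel)"
  using nn_integral_lborel_affine[OF assms, of 1 t, symmetric] by (simp add: add.commute)

lemma AE_lborel_of_negligible: "negligible N \<Longrightarrow> AE x in lborel. x \<notin> N"
  using AE_not_in[of N lebesgue] by (simp add: negligible_iff_null_sets AE_completion_iff)

text \<open>A measurable function is an almost everywhere limit of continuous functions, but without a common
  integrable bound. Truncating in height and in space, by continuous operations, supplies the bound
  and is itself harmless in the limit.\<close>

lemma continuous_dense_L1:
  fixes f :: "'a::euclidean_space \<Rightarrow> real"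
  assumes [measurable]: "f \<in> borel_measurable borel" and fin: "(\<integral>\<^sup>+ x. ennreal \<bar>f x\<bar> \<partial>lborel) < \<infinity>"
    and e: "0 < (e::real)"
  obtains g where "continuous_on UNIV g" "(\<integral>\<^sup>+ x. ennreal \<bar>f x - g x\<bar> \<partial>lborel) < ennreal e"
proof -
  define clip where "clip n t = max (- real n) (min (real n) t)" for n t
  define cut where "cut n x = max 0 (min 1 (real n + 1 - norm x))" for n and x :: 'a
  have clip_cont: "isCont (clip n) t" for n t unfolding clip_def by (intro continuous_intros)
  have cut_cont: "continuous_on UNIV (cut n)" for n unfolding cut_def[abs_def] by (intro continuous_intros)
  have [measurable]: "clip n \<in> borel_measurable borel" "cut n \<in> borel_measurable borel" for n
    unfolding clip_def[abs_def] cut_def[abs_def] by measurable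
  have cut01: "0 \<le> cut n x" "cut n x \<le> 1" for n x by (auto simp: cut_def)
  have clip_abs: "\<bar>clip n t\<bar> \<le> \<bar>t\<bar>" "\<bar>clip n t\<bar> \<le> real n" for n t by (auto simp: clip_def)
  have "(\<lambda>n. (\<integral>\<^sup>+ x. ennreal (norm (f x - clip n (f x) * cut n x)) \<partial>lborel)) \<longlonglongrightarrow> 0"
  proof (rule nn_integral_dominated_convergence_norm[where w = "\<lambda>x. \<bar>f x\<bar>"])
    show "AE x in lborel. (\<lambda>n. clip n (f x) * cut n x) \<longlonglongrightarrow> f x"
    proof (rule AE_I2)
      fix x
      have "eventually (\<lambda>n. clip n (f x) * cut n x = f x) sequentially"
        using eventually_ge_at_top[of "nat \<lceil>\<bar>f x\<bar> + norm x\<rceil>"]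
      proof eventually_elim
        case (elim n)
        then have "\<bar>f x\<bar> + norm x \<le> real n" by linarith
        then have "\<bar>f x\<bar> \<le> real n" "norm x \<le> real n"
          using norm_ge_zero[of x] by linarith+
        then show ?case by (auto simp: clip_def cut_def)
      qed
      then show "(\<lambda>n. clip n (f x) * cut n x) \<longlonglongrightarrow> f x" by (rule tendsto_eventually)
    qed
    show "AE x in lborel. norm (clip j (f x) * cut j x) \<le> \<bar>f x\<bar>" for j
      using mult_mono[OF clip_abs(1) cut01(2)] cut01 by (intro AE_I2) (auto simp: abs_mult)
  qed (use fin in auto)
  then have "eventually (\<lambda>n. (\<integral>\<^sup>+ x. ennreal (norm (f x - clip n (f x) * cut n x)) \<partial>lborel) < ennreal (e/2)) sequentially"
    using e by (auto dest: order_tendstoD(2)[where a = "ennreal (e/2)"])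
  then obtain n where n: "(\<integral>\<^sup>+ x. ennreal \<bar>f x - clip n (f x) * cut n x\<bar> \<partial>lborel) < ennreal (e/2)"
    by (auto dest: eventually_happens)
  \<comment> \<open>The truncation of height and support fixed so far is now applied to continuous functions that tend to f.\<close>
  have "f measurable_on UNIV"
    by (subst measurable_on_iff_borel_measurable) (auto intro!: measurable_restrict_space1 measurable_completion)
  then obtain N g where N: "negligible N" and g: "\<And>k. continuous_on UNIV (g k :: 'a \<Rightarrow> real)"
      and lim: "\<And>x. x \<notin> N \<Longrightarrow> (\<lambda>k. g k x) \<longlonglongrightarrow> f x"
    by (auto simp: measurable_on_def)
  have [measurable]: "g k \<in> borel_measurable borel" for k
    using g borel_measurable_continuous_onI by blast
  have "(\<lambda>k. (\<integral>\<^sup>+ x. ennreal (norm (clip n (f x) * cut n x - clip n (g k x) * cut n x)) \<partial>lborel)) \<longlonglongrightarrow> 0"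
  proof (rule nn_integral_dominated_convergence_norm[where w = "\<lambda>x. real n * indicator (cball 0 (real n + 1)) x"])
    show "AE x in lborel. (\<lambda>k. clip n (g k x) * cut n x) \<longlonglongrightarrow> clip n (f x) * cut n x"
      using AE_lborel_of_negligible[OF N]
    proof eventually_elim
      case (elim x)
      show ?case by (intro tendsto_mult tendsto_const isCont_tendsto_compose[OF clip_cont lim[OF elim]])
    qed
    show "AE x in lborel. norm (clip n (g j x) * cut n x) \<le> real n * indicator (cball 0 (real n + 1)) x" for j
    proof (rule AE_I2)
      fix x
      show "norm (clip n (g j x) * cut n x) \<le> real n * indicator (cball 0 (real n + 1)) x"
      proof (cases "x \<in> cball 0 (real n + 1)")
        case True
        then show ?thesis
          using mult_mono[OF clip_abs(2)[of n "g j x"] cut01(2)[of n x]] cut01 by (auto simp: abs_mult)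
      next
        case False
        then have "cut n x = 0" by (auto simp: cut_def)
        then show ?thesis by simp
      qed
    qed
    have "(\<integral>\<^sup>+ x. ennreal (real n * indicator (cball 0 (real n + 1)) (x::'a)) \<partial>lborel)
      = ennreal (real n) * emeasure lborel (cball (0::'a) (real n + 1))"
      by (rule trans[OF nn_integral_cong nn_integral_cmult_indicator]) (simp_all add: indicator_def)
    also have "\<dots> < \<infinity>"
      by (auto intro!: ennreal_mult_less_top[THEN iffD2] simp: emeasure_cball)
    finally show "(\<integral>\<^sup>+ x. ennreal (real n * indicator (cball 0 (real n + 1)) (x::'a)) \<partial>lborel) < \<infinity>" .
  qed measurable
  then have "eventually (\<lambda>k. (\<integral>\<^sup>+ x. ennreal (norm (clip n (f x) * cut n x - clip n (g k x) * cut n x)) \<partial>lborel) < ennreal (e/2)) sequentially"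
    using e by (auto dest: order_tendstoD(2)[where a = "ennreal (e/2)"])
  then obtain k where k: "(\<integral>\<^sup>+ x. ennreal \<bar>clip n (f x) * cut n x - clip n (g k x) * cut n x\<bar> \<partial>lborel) < ennreal (e/2)"
    by (auto dest: eventually_happens)
  show ?thesis
  proof (rule that)
    have "continuous_on UNIV (\<lambda>x. clip n (g k x))"
      unfolding clip_def by (intro continuous_intros g)
    then show "continuous_on UNIV (\<lambda>x. clip n (g k x) * cut n x)"
      by (intro continuous_on_mult cut_cont)
    have "(\<integral>\<^sup>+ x. ennreal \<bar>f x - clip n (g k x) * cut n x\<bar> \<partial>lborel)
       \<le> (\<integral>\<^sup>+ x. ennreal \<bar>f x - clip n (f x) * cut n x\<bar>
             + ennreal \<bar>clip n (f x) * cut n x - clip n (g k x) * cut n x\<bar> \<partial>lborel)"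
      by (intro nn_integral_mono) (auto simp: ennreal_plus[symmetric] simp del: ennreal_plus intro!: ennreal_leI)
    also have "\<dots> = (\<integral>\<^sup>+ x. ennreal \<bar>f x - clip n (f x) * cut n x\<bar> \<partial>lborel)
             + (\<integral>\<^sup>+ x. ennreal \<bar>clip n (f x) * cut n x - clip n (g k x) * cut n x\<bar> \<partial>lborel)"
      by (rule nn_integral_add) measurable
    also have "\<dots> < ennreal (e/2) + ennreal (e/2)"
      using n k by (rule add_strict_mono)
    also have "\<dots> = ennreal e" using e by (simp add: ennreal_plus[symmetric] del: ennreal_plus)
    finally show "(\<integral>\<^sup>+ x. ennreal \<bar>f x - clip n (g k x) * cut n x\<bar> \<partial>lborel) < ennreal e" .
  qed
qed

section \<open>A smooth kernel on an annulus\<close>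

text \<open>The kernel \<open>2 r\<^sup>-\<^sup>2 \<bar>y\<bar>\<^sup>2\<^sup>-\<^sup>N b(\<bar>y\<bar>\<^sup>2 / r\<^sup>2)\<close>, where \<open>b\<close> is \<open>annulus_bump\<close>. The exponent \<open>2 - N\<close>
  makes the differences of such kernels explicit divergences, see \<open>flux_divergence\<close>: since
  \<open>y \<bar>y\<bar>\<^sup>-\<^sup>N\<close> is divergence free away from 0, the divergence of \<open>B(\<bar>y\<bar>\<^sup>2 / r\<^sup>2) y \<bar>y\<bar>\<^sup>-\<^sup>N\<close> is
  the kernel for radius \<open>r\<close> when \<open>B\<close> is a primitive of \<open>b\<close>.\<close>

definition shell_kernel :: "real \<Rightarrow> 'a::euclidean_space \<Rightarrow> real" where
  "shell_kernel r y = 2 * annulus_bump ((y \<bullet> y) / r\<^sup>2) * (y \<bullet> y) powr (1 - real DIM('a) / 2) / r\<^sup>2"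

text \<open>By scaling every kernel has the same integral. It is not normalised to 1, so the averages below
  tend to this multiple of the function.\<close>

definition shell_mass :: "'a::euclidean_space itself \<Rightarrow> real" where
  "shell_mass _ = enn2real (\<integral>\<^sup>+ y. ennreal (shell_kernel 1 (y::'a)) \<partial>lborel)"

lemma shell_kernel_nonneg: "0 \<le> shell_kernel r y"
  by (simp add: shell_kernel_def annulus_bump_nonneg)

lemma borel_measurable_annulus_bump [measurable]: "annulus_bump \<in> borel_measurable borel"
  by (rule borel_measurable_continuous_onI[OF annulus_bump_continuous])

lemma borel_measurable_shell_kernel [measurable]: "shell_kernel r \<in> borel_measurable borel"
  unfolding shell_kernel_def[abs_def] by measurable

lemma shell_kernel_scale:
  fixes y :: "'a::euclidean_space"
  assumes "r > 0"
  shows "shell_kernel r y = r powr (- real DIM('a)) * shell_kernel 1 (y /\<^sub>R r)"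
proof -
  have "(y \<bullet> y / r\<^sup>2) powr (1 - real DIM('a) / 2) = (y \<bullet> y) powr (1 - real DIM('a) / 2) / (r powr 2) powr (1 - real DIM('a) / 2)"
    using assms by (subst powr_divide) (auto simp: powr_numeral)
  also have "(r powr 2) powr (1 - real DIM('a) / 2) = r powr (2 - real DIM('a))"
    by (simp add: powr_powr algebra_simps)
  also have "\<dots> = r\<^sup>2 * r powr (- real DIM('a))"
    using assms powr_add[of r 2 "- real DIM('a)"] by (simp add: powr_numeral)
  finally have "(y \<bullet> y) powr (1 - real DIM('a) / 2)
      = (y \<bullet> y / r\<^sup>2) powr (1 - real DIM('a) / 2) * (r\<^sup>2 * r powr (- real DIM('a)))"
    using assms by (simp add: eq_divide_eq del: mult_eq_0_iff)
  moreover have "(y /\<^sub>R r) \<bullet> (y /\<^sub>R r) = y \<bullet> y / r\<^sup>2"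
    by (simp add: power2_eq_square divide_inverse mult_ac)
  ultimately show ?thesis
    using assms unfolding shell_kernel_def by simp
qed

lemma shell_kernel_bound:
  fixes y :: "'a::euclidean_space"
  assumes "r > 0"
  shows "shell_kernel r y \<le> 2 * 2 ^ DIM('a) * r powr (- real DIM('a)) * indicator (ball 0 r) y"
proof -
  have 1: "shell_kernel 1 z \<le> 2 * 2 ^ DIM('a) * indicator (ball 0 1) z" for z :: 'a
  proof (cases "1/4 < z \<bullet> z \<and> z \<bullet> z < 1")
    case True
    then have "norm z < 1"
      by (simp add: norm_eq_sqrt_inner)
    have "(z \<bullet> z) powr (1 - real DIM('a) / 2) = (z \<bullet> z) * (z \<bullet> z) powr (- (real DIM('a) / 2))"
      using True powr_add[of "z \<bullet> z" 1 "- (real DIM('a) / 2)"] by simp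
    also have "\<dots> \<le> 1 * (1/4) powr (- (real DIM('a) / 2))"
      using True by (intro mult_mono powr_mono2') auto
    also have "(1/4::real) powr (- (real DIM('a) / 2)) = 2 ^ DIM('a)"
    proof -
      have "(1/4::real) = 2 powr (-2)" by (simp add: powr_minus powr_numeral)
      then have "(1/4::real) powr (- (real DIM('a) / 2)) = 2 powr real DIM('a)"
        by (simp only: powr_powr) simp
      then show ?thesis by (simp add: powr_realpow)
    qed
    finally have "annulus_bump (z \<bullet> z) * (z \<bullet> z) powr (1 - real DIM('a) / 2) \<le> 1 * 2 ^ DIM('a)"
      by (intro mult_mono annulus_bump_le_1) auto
    then show ?thesis using \<open>norm z < 1\<close> by (simp add: shell_kernel_def)
  next
    case False
    then have "annulus_bump (z \<bullet> z) = 0" by (intro annulus_bump_eq_0) auto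
    then show ?thesis by (simp add: shell_kernel_def)
  qed
  have "indicator (ball 0 1) (y /\<^sub>R r) = (indicator (ball 0 r) y :: real)"
    using assms by (simp add: indicator_def divide_simps)
  with mult_left_mono[OF 1[of "y /\<^sub>R r"], of "r powr (- real DIM('a))"] show ?thesis
    by (simp add: shell_kernel_scale[OF assms] mult_ac)
qed

lemma shell_kernel_integral:
  fixes x :: "'a::euclidean_space"
  assumes "r > 0"
  shows "(\<integral>\<^sup>+ y. ennreal (shell_kernel r (y - x)) \<partial>lborel) = ennreal (shell_mass TYPE('a))"
    (is "?L = _") and "shell_mass TYPE('a) > 0"
proof -
  let ?I = "\<integral>\<^sup>+ y. ennreal (shell_kernel 1 (y::'a)) \<partial>lborel"
  have "?I \<le> (\<integral>\<^sup>+ y. ennreal (2 * 2 ^ DIM('a)) * indicator (ball (0::'a) 1) y \<partial>lborel)"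
  proof (rule nn_integral_mono)
    fix y :: 'a
    show "ennreal (shell_kernel 1 y) \<le> ennreal (2 * 2 ^ DIM('a)) * indicator (ball 0 1) y"
      using shell_kernel_bound[of 1 y] by (auto simp: indicator_def ennreal_leI ennreal_neg split: if_splits)
  qed
  also have "\<dots> < \<infinity>"
    by (subst nn_integral_cmult_indicator) (auto simp: emeasure_ball ennreal_mult_less_top)
  finally have fin: "?I < \<infinity>" .
  then have I: "?I = ennreal (shell_mass TYPE('a))" by (simp add: shell_mass_def)
  have "?L = ennreal (r ^ DIM('a)) * (\<integral>\<^sup>+ y. ennreal (shell_kernel r (r *\<^sub>R y :: 'a)) \<partial>lborel)"
    using assms by (subst nn_integral_lborel_affine[where c = r and t = x]) auto
  also have "\<dots> = (\<integral>\<^sup>+ y. ennreal (r ^ DIM('a) * shell_kernel r (r *\<^sub>R y :: 'a)) \<partial>lborel)"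
    using assms by (subst nn_integral_cmult[symmetric]) (auto simp: ennreal_mult' shell_kernel_nonneg)
  also have "\<dots> = ?I"
    using assms by (intro nn_integral_cong) (simp add: shell_kernel_scale[of r] powr_minus powr_realpow mult.assoc[symmetric])
  finally show "?L = ennreal (shell_mass TYPE('a))" using I by simp
  obtain b :: 'a where b: "b \<in> Basis" using nonempty_Basis by blast
  \<comment> \<open>The ball of radius 1/4 around a point of norm 3/4 lies in the annulus where the kernel is positive.\<close>
  define z where "z = (3/4) *\<^sub>R b"
  have "?I \<noteq> 0"
  proof
    assume "?I = 0"
    then have ae: "AE y in lborel. ennreal (shell_kernel 1 (y::'a)) = 0"
      by (subst (asm) nn_integral_0_iff_AE) simp_all
    have pos: "shell_kernel 1 y > 0" if "y \<in> ball z (1/4)" for y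
    proof -
      have "norm z = 3/4" using b by (simp add: z_def)
      then have "norm y < 1" "1/2 < norm y"
        using that norm_triangle_ineq2[of y z] norm_triangle_ineq2[of z y]
        by (auto simp: dist_norm norm_minus_commute)
      then have "norm y * norm y < 1 * 1" "(1/2) * (1/2) < norm y * norm y"
        by (intro mult_strict_mono; auto simp del: norm_eq_zero)+
      then have yy: "y \<bullet> y < 1" "1/4 < y \<bullet> y"
        by (simp_all add: dot_square_norm power2_eq_square)
      then have "0 < annulus_bump (y \<bullet> y)" by (intro annulus_bump_pos)
      moreover have "0 < (y \<bullet> y) powr (1 - real DIM('a) / 2)"
        by (subst powr_gt_zero) (use yy in linarith)
      ultimately show ?thesis by (simp add: shell_kernel_def)
    qed
    from ae have "AE y in lborel. y \<notin> ball z (1/4)"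
    proof eventually_elim
      case (elim y)
      then have "\<not> shell_kernel 1 y > 0" by (simp add: ennreal_eq_0_iff)
      then show ?case using pos[of y] by blast
    qed
    then have "ball z (1/4) \<in> null_sets lborel"
      by (subst AE_iff_null_sets) simp_all
    then have "emeasure lborel (ball z (1/4)) = 0" by auto
    then show False using unit_ball_vol_pos[of "real DIM('a)"] by (simp add: emeasure_ball)
  qed
  then have "ennreal (shell_mass TYPE('a)) \<noteq> 0" using I by simp
  then show "shell_mass TYPE('a) > 0" by (simp add: ennreal_eq_0_iff not_le)
qed

section \<open>Lebesgue differentiation along annular averages\<close>

definition shell_avg :: "real \<Rightarrow> ('a::euclidean_space \<Rightarrow> real) \<Rightarrow> 'a \<Rightarrow> real" where
  "shell_avg r f x = (LINT y|lebesgue. f y * shell_kernel r (y - x))"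

lemma shell_avg_lborel:
  assumes [measurable]: "f \<in> borel_measurable borel"
  shows "shell_avg r f x = (LINT y|lborel. f y * shell_kernel r (y - x))"
  unfolding shell_avg_def by (rule integral_completion) measurable

lemma integrable_shell_kernel:
  fixes x :: "'a::euclidean_space"
  assumes "r > 0"
  shows "integrable lborel (\<lambda>y. shell_kernel r (y - x))"
  and "(LINT y|lborel. shell_kernel r (y - x)) = shell_mass TYPE('a)"
proof -
  show "integrable lborel (\<lambda>y. shell_kernel r (y - x))"
    by (rule integrableI_nonneg) (auto simp: shell_kernel_nonneg shell_kernel_integral(1)[OF assms])
  show "(LINT y|lborel. shell_kernel r (y - x)) = shell_mass TYPE('a)"
    using shell_kernel_integral(1)[OF assms, of x] shell_kernel_integral(2)[OF assms, where 'a = 'a]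
    by (subst integral_eq_nn_integral) (auto simp: shell_kernel_nonneg)
qed

lemma shell_avg_le_dyadic_avg:
  fixes f :: "'a::euclidean_space \<Rightarrow> real"
  assumes [measurable]: "f \<in> borel_measurable borel"
  shows "ennreal \<bar>shell_avg (2 powi j) f x\<bar> \<le> ennreal (2 * 2 ^ DIM('a)) * dyadic_avg j (\<lambda>y. ennreal \<bar>f y\<bar>) x"
proof -
  let ?r = "(2::real) powi j"
  have "ennreal \<bar>shell_avg ?r f x\<bar> \<le> (\<integral>\<^sup>+ y. ennreal (norm (f y * shell_kernel ?r (y - x))) \<partial>lborel)"
  proof (cases "integrable lborel (\<lambda>y. f y * shell_kernel ?r (y - x))")
    case True
    from integral_norm_bound_ennreal[OF this] show ?thesis by (simp add: shell_avg_lborel)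
  next
    case False
    then show ?thesis by (simp add: shell_avg_lborel not_integrable_integral_eq)
  qed
  also have "\<dots> \<le> (\<integral>\<^sup>+ y. ennreal (2 * 2 ^ DIM('a) * ?r powr - real DIM('a)) * (ennreal \<bar>f y\<bar> * indicator (ball x ?r) y) \<partial>lborel)"
  proof (rule nn_integral_mono)
    fix y :: 'a
    have "norm (f y * shell_kernel ?r (y - x)) = shell_kernel ?r (y - x) * \<bar>f y\<bar>"
      by (simp add: abs_mult shell_kernel_nonneg)
    also have "\<dots> \<le> (2 * 2 ^ DIM('a) * ?r powr - real DIM('a) * indicator (ball 0 ?r) (y - x)) * \<bar>f y\<bar>"
      by (intro mult_right_mono shell_kernel_bound) auto
    also have "indicator (ball 0 ?r) (y - x) = (indicator (ball x ?r) y :: real)"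
      by (auto simp: indicator_def dist_norm norm_minus_commute)
    finally show "ennreal (norm (f y * shell_kernel ?r (y - x)))
      \<le> ennreal (2 * 2 ^ DIM('a) * ?r powr - real DIM('a)) * (ennreal \<bar>f y\<bar> * indicator (ball x ?r) y)"
      by (auto simp: indicator_def ennreal_mult[symmetric] ennreal_leI split: if_splits)
  qed
  also have "\<dots> = ennreal (2 * 2 ^ DIM('a) * ?r powr - real DIM('a)) * (\<integral>\<^sup>+ y\<in>ball x ?r. ennreal \<bar>f y\<bar> \<partial>lborel)"
    by (rule nn_integral_cmult) measurable
  also have "\<dots> = ennreal (2 * 2 ^ DIM('a)) * dyadic_avg j (\<lambda>y. ennreal \<bar>f y\<bar>) x"
    by (simp only: dyadic_avg_def mult.assoc[symmetric]) (simp add: ennreal_mult')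
  finally show ?thesis .
qed

lemma integrable_mult_shell_kernel:
  fixes f :: "'a::euclidean_space \<Rightarrow> real"
  assumes "integrable lborel f" "r > 0"
  shows "integrable lborel (\<lambda>y. f y * shell_kernel r (y - x))"
proof (rule Bochner_Integration.integrable_bound)
  show "integrable lborel (\<lambda>y. (2 * 2 ^ DIM('a) * r powr - real DIM('a)) * f y)"
    using assms(1) by (rule integrable_mult_right)
  have [measurable]: "f \<in> borel_measurable borel" using assms(1) by auto
  show "(\<lambda>y. f y * shell_kernel r (y - x)) \<in> borel_measurable lborel" by measurable
  show "AE y in lborel. norm (f y * shell_kernel r (y - x)) \<le> norm (2 * 2 ^ DIM('a) * r powr - real DIM('a) * f y)"
  proof (rule AE_I2)
    fix y :: 'a
    have "shell_kernel r (y - x) \<le> 2 * 2 ^ DIM('a) * r powr - real DIM('a)"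
      by (rule order_trans[OF shell_kernel_bound[OF assms(2)]]) (auto simp: indicator_def)
    from mult_left_mono[OF this, of "\<bar>f y\<bar>"]
    show "norm (f y * shell_kernel r (y - x)) \<le> norm (2 * 2 ^ DIM('a) * r powr - real DIM('a) * f y)"
      by (simp add: abs_mult shell_kernel_nonneg mult_ac)
  qed
qed

lemma shell_kernel_outside: "r > 0 \<Longrightarrow> r \<le> dist x y \<Longrightarrow> shell_kernel r (y - x) = 0"
  using shell_kernel_bound[of r "y - x"] shell_kernel_nonneg[of r "y - x"]
  by (auto simp: indicator_def dist_norm norm_minus_commute split: if_splits)

lemma shell_avg_continuous:
  fixes g :: "'a::euclidean_space \<Rightarrow> real"
  assumes g: "continuous_on UNIV g" and "e > 0"
  shows "\<forall>\<^sub>F r in at_right 0. integrable lborel (\<lambda>y. g y * shell_kernel r (y - x))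
           \<and> \<bar>shell_avg r g x - shell_mass TYPE('a) * g x\<bar> \<le> e * shell_mass TYPE('a)"
proof -
  have [measurable]: "g \<in> borel_measurable borel" by (rule borel_measurable_continuous_onI[OF g])
  from g \<open>e > 0\<close> obtain d where d: "d > 0" "\<And>y. dist y x < d \<Longrightarrow> dist (g y) (g x) < e"
    unfolding continuous_on_iff by (metis UNIV_I)
  show ?thesis
    using eventually_at_right_real[OF d(1)]
  proof eventually_elim
    case (elim r)
    then have r: "0 < r" "r < d" by auto
    note K = integrable_shell_kernel[OF r(1), where x = x]
    have bound: "norm ((g y - g x) * shell_kernel r (y - x)) \<le> e * shell_kernel r (y - x)" for y
    proof (cases "dist x y < r")
      case True
      then have "\<bar>g y - g x\<bar> \<le> e" using d(2)[of y] r by (simp add: dist_commute dist_norm)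
      then show ?thesis by (auto simp: abs_mult shell_kernel_nonneg intro: mult_right_mono)
    qed (use r in \<open>simp add: shell_kernel_outside\<close>)
    have int: "integrable lborel (\<lambda>y. (g y - g x) * shell_kernel r (y - x))"
      by (rule Bochner_Integration.integrable_bound[OF integrable_mult_right[OF K(1), of e]])
         (use bound in \<open>auto intro!: AE_I2 order_trans[OF _ abs_ge_self]\<close>)
    have eq: "g y * shell_kernel r (y - x) = (g y - g x) * shell_kernel r (y - x) + g x * shell_kernel r (y - x)" for y
      by (simp add: algebra_simps)
    have int2: "integrable lborel (\<lambda>y. g y * shell_kernel r (y - x))"
      unfolding eq by (intro Bochner_Integration.integrable_add int integrable_mult_right K)
    have "shell_avg r g x = (LINT y|lborel. (g y - g x) * shell_kernel r (y - x)) + g x * shell_mass TYPE('a)"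
      unfolding shell_avg_lborel[OF \<open>g \<in> borel_measurable borel\<close>] eq
      by (subst Bochner_Integration.integral_add) (auto intro!: int integrable_mult_right K simp: K)
    moreover have "\<bar>LINT y|lborel. (g y - g x) * shell_kernel r (y - x)\<bar> \<le> (LINT y|lborel. e * shell_kernel r (y - x))"
      using bound by (intro integral_abs_bound_integral int integrable_mult_right K) auto
    ultimately show ?case using int2 K by (simp add: mult.commute)
  qed
qed

text \<open>For statements on limits of averages the exceptional set is only known to be contained in measurable
  sets of small measure.\<close>

lemma AE_of_small_exceptional_sets:
  assumes "\<And>n::nat. \<exists>T\<in>sets M. {x\<in>space M. \<not> P x} \<subseteq> T \<and> emeasure M T \<le> ennreal (c / (real n + 1))"
  shows "AE x in M. P x"
proof -
  from assms obtain T where T: "\<And>n. T n \<in> sets M" "\<And>n. {x\<in>space M. \<not> P x} \<subseteq> T n"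
    "\<And>n. emeasure M (T n) \<le> ennreal (c / (real n + 1))" by metis
  have "emeasure M (\<Inter>n. T n) \<le> ennreal (c / (real n + 1))" for n
    by (rule order_trans[OF emeasure_mono T(3)]) (use T in auto)
  moreover have "(\<lambda>n. ennreal (c / (real n + 1))) \<longlonglongrightarrow> ennreal 0"
  proof (rule tendsto_ennrealI)
    have "(\<lambda>n. c * inverse (real (Suc n))) \<longlonglongrightarrow> c * 0"
      by (intro tendsto_mult tendsto_const LIMSEQ_inverse_real_of_nat)
    then show "(\<lambda>n. c / (real n + 1)) \<longlonglongrightarrow> 0" by (simp add: divide_inverse add.commute)
  qed
  ultimately have "emeasure M (\<Inter>n. T n) \<le> ennreal 0"
    by (intro LIMSEQ_le_const[where X = "\<lambda>n. ennreal (c / (real n + 1))"]) auto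
  then have "(\<Inter>n. T n) \<in> null_sets M" using T by (auto intro!: null_setsI)
  then show ?thesis by (rule AE_I') (use T in auto)
qed

text \<open>Lebesgue's argument: split \<open>f\<close> into a continuous \<open>g\<close>, for which the claim is clear, and a remainder
  that is small in the mean. The averages of the remainder are small outside a small set by the
  weak type bound, and the remainder itself is by Markov's inequality.\<close>

lemma shell_avg_tendsto_integrable:
  fixes f :: "'a::euclidean_space \<Rightarrow> real"
  assumes f: "integrable lborel f"
  shows "AE x in lborel. (\<lambda>k. shell_avg (2 powi (- int k)) f x) \<longlonglongrightarrow> shell_mass TYPE('a) * f x"
proof -
  let ?m = "shell_mass TYPE('a)" and ?C = "2 * 2 ^ DIM('a) :: real"
  let ?W = "5 ^ DIM('a) * unit_ball_vol (real DIM('a))"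
  let ?r = "\<lambda>k. (2::real) powi (- int k)"
  have m: "?m > 0" using shell_kernel_integral(2)[of 1, where 'a = 'a] by simp
  have [measurable]: "f \<in> borel_measurable borel" using f by auto
  have r0: "filterlim ?r (at_right 0) sequentially"
  proof -
    have "(\<lambda>k. (1/2::real) ^ k) \<longlonglongrightarrow> 0" by (rule LIMSEQ_power_zero) simp
    moreover have "(1/2::real) ^ k = ?r k" for k
      by (simp add: power_int_minus power_one_over inverse_eq_divide)
    ultimately have "?r \<longlonglongrightarrow> 0" by simp
    then show ?thesis by (auto simp: filterlim_at intro!: always_eventually)
  qed
  have key: "AE x in lborel. \<forall>\<^sub>F k in sequentially. \<bar>shell_avg (?r k) f x - ?m * f x\<bar> \<le> 3 * \<delta>"
    if d: "\<delta> > 0" for \<delta>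
  proof (rule AE_of_small_exceptional_sets[where c = "?W * ?C / \<delta> + ?m / \<delta>"])
    fix n :: nat
    define e where "e = 1 / (real n + 1)"
    have e: "e > 0" by (simp add: e_def)
    have "(\<integral>\<^sup>+ x. ennreal \<bar>f x\<bar> \<partial>lborel) < \<infinity>" using f by (auto simp: integrable_iff_bounded)
    from continuous_dense_L1[OF _ this e] obtain g
      where g: "continuous_on UNIV g" and fg: "(\<integral>\<^sup>+ x. ennreal \<bar>f x - g x\<bar> \<partial>lborel) < ennreal e" by auto
    have [measurable]: "g \<in> borel_measurable borel" by (rule borel_measurable_continuous_onI[OF g])
    have fg_int: "integrable lborel (\<lambda>x. f x - g x)"
      using fg by (auto simp: integrable_iff_bounded intro: less_trans[OF _ ennreal_less_top])
    let ?h = "\<lambda>x. ennreal \<bar>f x - g x\<bar>"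
    \<comment> \<open>Outside T1 the averages of the remainder are at most \<open>\<delta>\<close>, outside T2 so is \<open>?m\<close> times the remainder; a third \<open>\<delta>\<close> comes from the continuous part.\<close>
    define T1 where "T1 = {x. ennreal (\<delta> / ?C) < dyadic_max ?h x}"
    define T2 where "T2 = {x. ennreal (\<delta> / ?m) \<le> ?h x}"
    have T12 [measurable]: "T1 \<in> sets lborel" "T2 \<in> sets lborel" unfolding T1_def T2_def by measurable
    have "ennreal (\<delta> / ?C) * emeasure lborel T1 \<le> ennreal ?W * (\<integral>\<^sup>+ y. ?h y \<partial>lborel)"
      unfolding T1_def by (rule dyadic_max_weak_type) (use d in auto)
    also have "\<dots> \<le> ennreal ?W * ennreal e" using fg by (intro mult_left_mono) auto
    finally have "ennreal (?C / \<delta>) * (ennreal (\<delta> / ?C) * emeasure lborel T1) \<le> ennreal (?C / \<delta>) * (ennreal ?W * ennreal e)"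
      by (rule mult_left_mono) simp
    also have "ennreal (?C / \<delta>) * (ennreal (\<delta> / ?C) * emeasure lborel T1) = emeasure lborel T1"
      using d by (simp add: mult.assoc[symmetric] ennreal_mult[symmetric])
    also have "ennreal (?C / \<delta>) * (ennreal ?W * ennreal e) = ennreal (?W * ?C / \<delta> * e)"
      using d e by (simp add: ennreal_mult[symmetric] mult_ac)
    finally have T1: "emeasure lborel T1 \<le> ennreal (?W * ?C / \<delta> * e)" .
    have "emeasure lborel T2 \<le> ennreal (?m / \<delta>) * (\<integral>\<^sup>+ x. ?h x * indicator UNIV x \<partial>lborel)"
    proof -
      have "T2 \<subseteq> {x\<in>space lborel. 1 \<le> ennreal (?m / \<delta>) * ?h x}"
      proof safe
        fix x assume "x \<in> T2"
        then have "ennreal (?m / \<delta>) * ennreal (\<delta> / ?m) \<le> ennreal (?m / \<delta>) * ?h x"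
          unfolding T2_def by (intro mult_left_mono) auto
        then show "1 \<le> ennreal (?m / \<delta>) * ?h x" using m d by (simp add: ennreal_mult[symmetric])
      qed simp
      then have "emeasure lborel T2 \<le> emeasure lborel ({x\<in>space lborel. 1 \<le> ennreal (?m / \<delta>) * ?h x})"
        by (intro emeasure_mono) auto
      also have "\<dots> \<le> ennreal (?m / \<delta>) * (\<integral>\<^sup>+ x. ?h x * indicator UNIV x \<partial>lborel)"
        using nn_integral_Markov_inequality[of ?h UNIV lborel "ennreal (?m / \<delta>)"] by simp
      finally show ?thesis .
    qed
    also have "\<dots> \<le> ennreal (?m / \<delta>) * ennreal e" using fg by (intro mult_left_mono) auto
    also have "\<dots> = ennreal (?m / \<delta> * e)" using m d e by (intro ennreal_mult[symmetric]) auto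
    finally have T2: "emeasure lborel T2 \<le> ennreal (?m / \<delta> * e)" .
    have "emeasure lborel (T1 \<union> T2) \<le> emeasure lborel T1 + emeasure lborel T2"
      by (rule emeasure_subadditive[OF T12])
    also have "\<dots> \<le> ennreal (?W * ?C / \<delta> * e) + ennreal (?m / \<delta> * e)"
      by (intro add_mono T1 T2)
    also have "\<dots> = ennreal ((?W * ?C / \<delta> + ?m / \<delta>) / (real n + 1))"
    proof -
      have "(?W * ?C / \<delta> + ?m / \<delta>) / (real n + 1) = ?W * ?C / \<delta> * e + ?m / \<delta> * e"
        by (simp add: e_def add_divide_distrib)
      moreover have "0 \<le> ?W * ?C / \<delta> * e" "0 \<le> ?m / \<delta> * e" using m d e by auto
      ultimately show ?thesis by (simp only: ennreal_plus)
    qed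
    finally have small: "emeasure lborel (T1 \<union> T2) \<le> ennreal ((?W * ?C / \<delta> + ?m / \<delta>) / (real n + 1))" .
    have "\<forall>\<^sub>F k in sequentially. \<bar>shell_avg (?r k) f x - ?m * f x\<bar> \<le> 3 * \<delta>" if x: "x \<notin> T1 \<union> T2" for x
    proof -
      have "\<not> \<delta> / ?m \<le> \<bar>f x - g x\<bar>" using x by (auto simp: T2_def)
      then have 1: "\<bar>f x - g x\<bar> * ?m \<le> \<delta>" using m d by (simp add: not_le pos_less_divide_eq)
      have 2: "\<bar>shell_avg (?r k) (\<lambda>y. f y - g y) x\<bar> \<le> \<delta>" for k
      proof -
        have "ennreal \<bar>shell_avg (?r k) (\<lambda>y. f y - g y) x\<bar> \<le> ennreal ?C * dyadic_avg (- int k) ?h x"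
          by (rule shell_avg_le_dyadic_avg) measurable
        also have "\<dots> \<le> ennreal ?C * ennreal (\<delta> / ?C)"
          using x dyadic_avg_le_max[of "- int k" ?h x] by (intro mult_left_mono) (auto simp: T1_def)
        also have "\<dots> = ennreal \<delta>" using d by (simp add: ennreal_mult[symmetric])
        finally show ?thesis using d by (simp add: ennreal_le_iff)
      qed
      have "\<forall>\<^sub>F k in sequentially. integrable lborel (\<lambda>y. g y * shell_kernel (?r k) (y - x))
           \<and> \<bar>shell_avg (?r k) g x - ?m * g x\<bar> \<le> \<delta> / ?m * ?m"
        using filterlim_iff[THEN iffD1, OF r0] shell_avg_continuous[OF g, of "\<delta> / ?m" x] m d by fastforce
      then show ?thesis
      proof eventually_elim
        case (elim k)
        have "shell_avg (?r k) f x = shell_avg (?r k) (\<lambda>y. f y - g y) x + shell_avg (?r k) g x"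
          using elim integrable_mult_shell_kernel[OF fg_int, of "?r k" x]
          by (simp add: shell_avg_lborel algebra_simps flip: Bochner_Integration.integral_add)
        moreover have "\<bar>?m * g x - ?m * f x\<bar> \<le> \<delta>"
          using 1 m by (simp add: abs_mult right_diff_distrib[symmetric] abs_minus_commute mult.commute)
        ultimately show ?case using elim 2[of k] m by (simp add: abs_le_iff)
      qed
    qed
    then show "\<exists>T\<in>sets lborel. {x\<in>space lborel. \<not> (\<forall>\<^sub>F k in sequentially. \<bar>shell_avg (?r k) f x - ?m * f x\<bar> \<le> 3 * \<delta>)} \<subseteq> T
       \<and> emeasure lborel T \<le> ennreal ((?W * ?C / \<delta> + ?m / \<delta>) / (real n + 1))"
      using small T12 by (intro bexI[of _ "T1 \<union> T2"]) auto
  qed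
  have "AE x in lborel. \<forall>i::nat. \<forall>\<^sub>F k in sequentially. \<bar>shell_avg (?r k) f x - ?m * f x\<bar> \<le> 3 * (1 / (real i + 1))"
    unfolding AE_all_countable by (intro allI key) simp
  then show ?thesis
  proof eventually_elim
    case (elim x)
    show ?case
    proof (rule tendstoI)
      fix e :: real assume "e > 0"
      then obtain i :: nat where "3 / e < real i" using reals_Archimedean2 by blast
      then have "3 * (1 / (real i + 1)) < e" using \<open>e > 0\<close> by (simp add: field_simps)
      with elim[rule_format, of i] show "\<forall>\<^sub>F k in sequentially. dist (shell_avg (?r k) f x) (?m * f x) < e"
        by (auto elim!: eventually_mono simp: dist_real_def)
    qed
  qed
qed

text \<open>The averages at scales at most 1 see only a bounded part of \<open>f\<close>.\<close>

theorem shell_avg_tendsto: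
  fixes f :: "'a::euclidean_space \<Rightarrow> real"
  assumes [measurable]: "f \<in> borel_measurable borel"
    and f: "\<And>n::nat. integrable lborel (\<lambda>x. f x * indicator (ball 0 (real n)) x)"
  shows "AE x in lborel. (\<lambda>k. shell_avg (2 powi (- int k)) f x) \<longlonglongrightarrow> shell_mass TYPE('a) * f x"
proof -
  let ?r = "\<lambda>k. (2::real) powi (- int k)"
  let ?f = "\<lambda>n x. f x * indicator (ball 0 (real n)) x"
  have "AE x in lborel. \<forall>n. (\<lambda>k. shell_avg (?r k) (?f n) x) \<longlonglongrightarrow> shell_mass TYPE('a) * ?f n x"
    unfolding AE_all_countable by (intro allI shell_avg_tendsto_integrable f)
  then show ?thesis
  proof eventually_elim
    case (elim x)
    obtain n :: nat where n: "norm x + 1 < real n" using reals_Archimedean2 by blast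
    have "shell_avg (?r k) (?f n) x = shell_avg (?r k) f x" for k
      unfolding shell_avg_def
    proof (rule Bochner_Integration.integral_cong[OF refl])
      fix y
      show "?f n y * shell_kernel (?r k) (y - x) = f y * shell_kernel (?r k) (y - x)"
      proof (cases "dist x y < ?r k")
        case True
        have "?r k \<le> 1" by (simp add: power_int_minus field_simps)
        then have "norm y < real n"
          using True n norm_triangle_ineq2[of y x] by (simp add: dist_norm norm_minus_commute)
        then show ?thesis by simp
      qed (simp add: shell_kernel_outside)
    qed
    then show ?case using elim[rule_format, of n] n by simp
  qed
qed

section \<open>Locally integrable functions\<close>

lemma locally_integrable_measurable:
  fixes f :: "'a::euclidean_space \<Rightarrow> 'b::euclidean_space"
  assumes "locally_integrable f"
  shows "f \<in> borel_measurable lebesgue"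
proof (rule borel_measurable_LIMSEQ_metric)
  fix n :: nat
  have "f absolutely_integrable_on cball 0 (real n)"
    using assms by (auto simp: locally_integrable_def)
  then show "(\<lambda>x. indicator (cball 0 (real n)) x *\<^sub>R f x) \<in> borel_measurable lebesgue"
    by (auto simp: set_integrable_def)
next
  fix x :: 'a
  have "eventually (\<lambda>n. indicator (cball 0 (real n)) x *\<^sub>R f x = f x) sequentially"
    using eventually_ge_at_top[of "nat \<lceil>norm x\<rceil>"]
    by eventually_elim (auto simp: nat_le_iff ceiling_le_iff)
  then show "(\<lambda>n. indicator (cball 0 (real n)) x *\<^sub>R f x) \<longlonglongrightarrow> f x"
    by (rule tendsto_eventually)
qed

lemma locally_integrable_mult_bounded:
  fixes f \<psi> :: "'a::euclidean_space \<Rightarrow> real"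
  assumes f: "locally_integrable f" and [measurable]: "\<psi> \<in> borel_measurable borel"
    and B: "\<And>x. \<bar>\<psi> x\<bar> \<le> B" and zero: "\<And>x. R < dist a x \<Longrightarrow> \<psi> x = 0"
  shows "integrable lebesgue (\<lambda>x. f x * \<psi> x)"
proof (rule Bochner_Integration.integrable_bound)
  have "f absolutely_integrable_on cball a R"
    using f by (auto simp: locally_integrable_def)
  then have "integrable lebesgue (\<lambda>x. indicator (cball a R) x *\<^sub>R f x)"
    by (simp add: set_integrable_def)
  then show "integrable lebesgue (\<lambda>x. B * (indicator (cball a R) x *\<^sub>R f x))"
    by (rule integrable_mult_right)
  have [measurable]: "\<psi> \<in> borel_measurable lebesgue"
    by (rule measurable_completion) simp
  show "(\<lambda>x. f x * \<psi> x) \<in> borel_measurable lebesgue"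
    by (intro borel_measurable_times locally_integrable_measurable[OF f]) simp
  show "AE x in lebesgue. norm (f x * \<psi> x) \<le> norm (B * (indicator (cball a R) x *\<^sub>R f x))"
  proof (rule AE_I2)
    fix x
    show "norm (f x * \<psi> x) \<le> norm (B * (indicator (cball a R) x *\<^sub>R f x))"
    proof (cases "R < dist a x")
      case False
      have "\<bar>f x\<bar> * \<bar>\<psi> x\<bar> \<le> \<bar>f x\<bar> * \<bar>B\<bar>" using B[of x] by (intro mult_left_mono) auto
      then show ?thesis using False by (simp add: abs_mult mult.commute)
    qed (simp add: zero)
  qed
qed

lemma bounded_continuous_compact_support:
  fixes f :: "'a::euclidean_space \<Rightarrow> real"
  assumes f: "continuous_on UNIV f" and zero: "\<And>x. R < dist a x \<Longrightarrow> f x = 0"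
  obtains B where "B \<ge> 0" "\<And>x. \<bar>f x\<bar> \<le> B"
proof -
  have "compact (f ` cball a R)"
    by (rule compact_continuous_image[OF continuous_on_subset[OF f] compact_cball]) simp
  then obtain B where B: "\<And>x. x \<in> cball a R \<Longrightarrow> \<bar>f x\<bar> \<le> B"
    using compact_imp_bounded bounded_iff[of "f ` cball a R"] by (metis image_eqI real_norm_def)
  have "\<bar>f x\<bar> \<le> max B 0" for x
    using B[of x] zero[of x] by (cases "R < dist a x") (auto simp: le_max_iff_disj)
  then show ?thesis by (intro that[of "max B 0"]) auto
qed

lemma locally_integrable_mult_continuous:
  fixes f \<psi> :: "'a::euclidean_space \<Rightarrow> real"
  assumes f: "locally_integrable f" and \<psi>: "continuous_on UNIV \<psi>"
    and zero: "\<And>x. R < dist a x \<Longrightarrow> \<psi> x = 0"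
  shows "integrable lebesgue (\<lambda>x. f x * \<psi> x)"
proof -
  obtain B where "\<And>x. \<bar>\<psi> x\<bar> \<le> B"
    using bounded_continuous_compact_support[OF \<psi> zero] by blast
  then show ?thesis
    by (rule locally_integrable_mult_bounded[OF f borel_measurable_continuous_onI[OF \<psi>] _ zero])
qed

lemma locally_integrable_component:
  fixes f :: "'a::euclidean_space \<Rightarrow> real ^ 'n"
  assumes "locally_integrable f"
  shows "locally_integrable (\<lambda>y. f y $ i)"
  unfolding locally_integrable_def
proof safe
  fix K :: "'a set" assume "compact K"
  then have "f absolutely_integrable_on K" using assms by (auto simp: locally_integrable_def)
  from absolutely_integrable_component[OF this, of "axis i 1"]
  show "(\<lambda>y. f y $ i) absolutely_integrable_on K" by (simp add: inner_axis)
qed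

section \<open>Weak gradients control the differences of averages\<close>

text \<open>The field whose divergence is the difference of two kernels is
  \<open>y * flux_profile N r (\<bar>y\<bar>\<^sup>2)\<close>. The difference of the two primitives vanishes for small and for
  large arguments, which makes the field smooth at the origin and compactly supported.\<close>

definition flux_numerator :: "real \<Rightarrow> real \<Rightarrow> real" where
  "flux_numerator r s = bump_primitive (4 * s / r\<^sup>2) - bump_primitive (s / r\<^sup>2)"

definition flux_profile :: "real \<Rightarrow> real \<Rightarrow> real \<Rightarrow> real" where
  "flux_profile N r s = flux_numerator r s * s powr (- N / 2)"

definition flux_profile' :: "real \<Rightarrow> real \<Rightarrow> real \<Rightarrow> real" where
  "flux_profile' N r s = (4 * annulus_bump (4 * s / r\<^sup>2) / r\<^sup>2 - annulus_bump (s / r\<^sup>2) / r\<^sup>2) * s powr (- N / 2)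
     + flux_numerator r s * (- N / 2 * s powr (- N / 2 - 1))"

lemma flux_numerator_zero: "r > 0 \<Longrightarrow> s < r\<^sup>2 / 16 \<Longrightarrow> flux_numerator r s = 0"
proof -
  assume "r > 0" "s < r\<^sup>2 / 16"
  then have "0 < r\<^sup>2" "16 * s < r\<^sup>2" by auto
  then have "0 < r\<^sup>2" "16 * s \<le> r\<^sup>2" "4 * s \<le> r\<^sup>2" by linarith+
  then have "4 * s / r\<^sup>2 \<le> 1 / 4" "s / r\<^sup>2 \<le> 1 / 4" by (simp_all add: divide_simps)
  then show "flux_numerator r s = 0" by (simp add: flux_numerator_def bump_primitive_zero)
qed

lemma flux_numerator_zero': "r > 0 \<Longrightarrow> r\<^sup>2 \<le> s \<Longrightarrow> flux_numerator r s = 0"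
proof -
  assume "r > 0" "r\<^sup>2 \<le> s"
  then have "0 < r\<^sup>2" "r\<^sup>2 \<le> s" by auto
  then have "0 < r\<^sup>2" "r\<^sup>2 \<le> s" "r\<^sup>2 \<le> 4 * s" by linarith+
  then have "1 \<le> s / r\<^sup>2" "1 \<le> 4 * s / r\<^sup>2" by simp_all
  then show "flux_numerator r s = 0"
    using bump_primitive_const[of "s / r\<^sup>2"] bump_primitive_const[of "4 * s / r\<^sup>2"] by (simp only: flux_numerator_def)
qed

lemma abs_flux_numerator_le: "\<bar>flux_numerator r s\<bar> \<le> bump_primitive 1"
  using bump_primitive_bounds[of "4 * s / r\<^sup>2"] bump_primitive_bounds[of "s / r\<^sup>2"] by (auto simp: flux_numerator_def)

lemma flux_numerator_deriv:
  "(flux_numerator r has_real_derivative 4 * annulus_bump (4 * s / r\<^sup>2) / r\<^sup>2 - annulus_bump (s / r\<^sup>2) / r\<^sup>2) (at s)"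
proof -
  have "((\<lambda>s. bump_primitive (c * s)) has_real_derivative annulus_bump (c * s) * c) (at s)" for c
    by (rule DERIV_chain2[of bump_primitive _ "\<lambda>s. c * s", OF bump_primitive_deriv]) (auto intro!: derivative_eq_intros)
  from DERIV_diff[OF this[of "4 / r\<^sup>2"] this[of "1 / r\<^sup>2"]]
  show ?thesis by (simp add: flux_numerator_def[abs_def] mult_ac)
qed

lemma smooth_upto_flux_numerator: "smooth_upto k (flux_numerator r)"
proof -
  have "smooth_upto k (\<lambda>s. bump_primitive ((4 / r\<^sup>2) * s + 0) + (- 1) * bump_primitive ((1 / r\<^sup>2) * s + 0))"
    by (rule smooth_upto_add[OF smooth_upto_affine[OF smooth_upto_bump_primitive] smooth_upto_mult[OF smooth_upto_const smooth_upto_affine[OF smooth_upto_bump_primitive]]])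
  then show ?thesis by (simp add: flux_numerator_def[abs_def])
qed

lemma smooth_upto_flux_profile: "r > 0 \<Longrightarrow> smooth_upto k (flux_profile N r)"
  unfolding flux_profile_def[abs_def]
  by (rule smooth_upto_mult_powr[where \<delta> = "r\<^sup>2 / 16"]) (auto intro: smooth_upto_flux_numerator flux_numerator_zero)

lemma flux_profile_deriv:
  assumes "r > 0"
  shows "(flux_profile N r has_real_derivative flux_profile' N r s) (at s)"
proof (cases "s < r\<^sup>2 / 16")
  case True
  have "(flux_profile N r has_real_derivative 0) (at s)"
    by (rule has_real_derivative_locally_zero[of "{..<r\<^sup>2 / 16}"])
       (use True assms in \<open>auto simp: flux_profile_def flux_numerator_zero\<close>)
  moreover have "annulus_bump (4 * s / r\<^sup>2) = 0" "annulus_bump (s / r\<^sup>2) = 0"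
    using True assms by (auto intro!: annulus_bump_eq_0 simp: divide_simps)
  ultimately show ?thesis using True assms by (simp add: flux_profile'_def flux_numerator_zero)
next
  case False
  then have "s > 0" using assms by (smt (verit) divide_pos_pos zero_less_power)
  from DERIV_mult[OF flux_numerator_deriv[of r s] has_real_derivative_powr[OF this, of "- N / 2"]]
  show ?thesis by (simp add: flux_profile_def[abs_def] flux_profile'_def algebra_simps)
qed

text \<open>The left-hand side is the divergence of \<open>y h(\<bar>y\<bar>\<^sup>2)\<close> for \<open>h = flux_profile N r\<close>. It vanishes for
  \<open>h(s) = s\<^sup>-\<^sup>N\<^sup>/\<^sup>2\<close>, so only the derivative of the numerator survives.\<close>

lemma flux_divergence:
  fixes z :: "'a::euclidean_space"
  assumes "r > 0"
  shows "real DIM('a) * flux_profile (real DIM('a)) r (z \<bullet> z) + 2 * (z \<bullet> z) * flux_profile' (real DIM('a)) r (z \<bullet> z)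
     = shell_kernel (r / 2) z - shell_kernel r z"
proof (cases "z = 0")
  case False
  define s where "s = z \<bullet> z"
  let ?N = "real DIM('a)"
  have s: "s > 0" using False by (simp add: s_def)
  have 1: "s * s powr (- ?N / 2 - 1) = s powr (- ?N / 2)"
    using powr_add[of s 1 "- ?N / 2 - 1"] s by simp
  have 2: "s * s powr (- ?N / 2) = s powr (1 - ?N / 2)"
    using powr_add[of s 1 "- ?N / 2"] s by simp
  have "2 * s * flux_profile' ?N r s
      = 2 * (4 * annulus_bump (4 * s / r\<^sup>2) / r\<^sup>2 - annulus_bump (s / r\<^sup>2) / r\<^sup>2) * (s * s powr (- ?N / 2))
        - ?N * flux_numerator r s * (s * s powr (- ?N / 2 - 1))"
    by (simp add: flux_profile'_def algebra_simps)
  also have "\<dots> = 2 * (4 * annulus_bump (4 * s / r\<^sup>2) / r\<^sup>2 - annulus_bump (s / r\<^sup>2) / r\<^sup>2) * s powr (1 - ?N / 2)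
        - ?N * flux_profile ?N r s"
    unfolding 1 2 by (simp add: flux_profile_def)
  finally show ?thesis
    by (simp add: shell_kernel_def s_def[symmetric] power_divide algebra_simps diff_divide_distrib)
qed (simp add: flux_profile_def shell_kernel_def annulus_bump_eq_0)

lemma flux_bound:
  fixes z :: "'a::euclidean_space"
  assumes "r > 0"
  shows "norm z * \<bar>flux_profile (real DIM('a)) r (z \<bullet> z)\<bar>
     \<le> bump_primitive 1 * 4 ^ DIM('a) * r * r powr (- real DIM('a)) * indicator (ball 0 r) z"
proof (cases "r / 4 \<le> norm z \<and> norm z < r")
  case True
  let ?N = "real DIM('a)"
  have z: "norm z > 0" using True assms by auto
  have N: "?N \<ge> 1" using DIM_positive[where 'a = 'a] by linarith
  have "(z \<bullet> z) powr (- ?N / 2) = norm z powr (- ?N)"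
    using z by (simp add: power2_norm_eq_inner[symmetric] powr_power[symmetric] powr_powr flip: powr_numeral)
  then have "norm z * \<bar>flux_profile ?N r (z \<bullet> z)\<bar> = \<bar>flux_numerator r (z \<bullet> z)\<bar> * (norm z * norm z powr (- ?N))"
    by (simp add: flux_profile_def abs_mult)
  also have "norm z * norm z powr (- ?N) = norm z powr (1 - ?N)"
    using powr_add[of "norm z" 1 "- ?N"] z by simp
  also have "\<bar>flux_numerator r (z \<bullet> z)\<bar> * norm z powr (1 - ?N) \<le> bump_primitive 1 * (r / 4) powr (1 - ?N)"
    using True assms N by (intro mult_mono abs_flux_numerator_le powr_mono2') (auto intro: bump_primitive_bounds)
  also have "(r / 4) powr (1 - ?N) = r powr (1 - ?N) * 4 powr (?N - 1)"
    using assms by (simp add: powr_divide powr_diff powr_minus divide_simps)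
  also have "\<dots> \<le> r powr (1 - ?N) * 4 powr ?N"
    by (intro mult_left_mono powr_mono) auto
  also have "r powr (1 - ?N) = r * r powr (- ?N)"
    using powr_add[of r 1 "- ?N"] assms by simp
  also have "bump_primitive 1 * (r * r powr (- ?N) * 4 powr ?N) = bump_primitive 1 * 4 ^ DIM('a) * r * r powr (- ?N)"
    by (simp add: powr_realpow)
  finally show ?thesis using True bump_primitive_bounds[of 1] by (simp add: mult_left_mono)
next
  case False
  have "flux_numerator r (z \<bullet> z) = 0"
  proof (cases "norm z < r / 4")
    case True
    have "(norm z)\<^sup>2 < (r / 4)\<^sup>2" using True by (intro power_strict_mono) auto
    then show ?thesis
      using assms by (intro flux_numerator_zero) (auto simp: power2_norm_eq_inner power_divide)
  next
    case F2: False
    then have "r\<^sup>2 \<le> (norm z)\<^sup>2" using False assms by (intro power_mono) auto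
    then show ?thesis using assms by (intro flux_numerator_zero') (auto simp: power2_norm_eq_inner)
  qed
  then show ?thesis using assms bump_primitive_bounds[of 1] by (simp add: flux_profile_def)
qed

lemma integrable_locally_integrable_shell_kernel:
  fixes f :: "'a::euclidean_space \<Rightarrow> real"
  assumes f: "locally_integrable f" and r: "r > 0"
  shows "integrable lebesgue (\<lambda>y. f y * shell_kernel r (y - x))"
proof (rule locally_integrable_mult_bounded[OF f, where R = r and a = x])
  show "\<bar>shell_kernel r (y - x)\<bar> \<le> 2 * 2 ^ DIM('a) * r powr (- real DIM('a))" for y
    using order_trans[OF shell_kernel_bound[OF r, of "y - x"]]
    by (auto simp: shell_kernel_nonneg indicator_def split: if_splits)
qed (use r in \<open>auto simp: shell_kernel_outside\<close>)

definition grad_const :: "'a::euclidean_space itself \<Rightarrow> real" where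
  "grad_const _ = bump_primitive 1 * 4 ^ DIM('a)"

text \<open>The components of the field, centred at \<open>x\<close>, are test functions, and the sum of their partial
  derivatives is the difference of the kernels.\<close>

lemma weak_gradient_shell_avg:
  fixes u :: "real ^ 'n \<Rightarrow> real"
  assumes wg: "has_weak_gradient u G" and r: "r > 0"
  shows "shell_avg (r / 2) u x - shell_avg r u x
    = - (LINT y|lebesgue. (G y \<bullet> (y - x)) * flux_profile (real CARD('n)) r ((y - x) \<bullet> (y - x)))"
    and "integrable lebesgue (\<lambda>y. (G y \<bullet> (y - x)) * flux_profile (real CARD('n)) r ((y - x) \<bullet> (y - x)))"
proof -
  let ?N = "real CARD('n)"
  let ?h = "\<lambda>y. flux_profile ?N r ((y - x) \<bullet> (y - x))"
  let ?h' = "\<lambda>y. flux_profile' ?N r ((y - x) \<bullet> (y - x))"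
  define \<phi> where "\<phi> i y = ((y - x) \<bullet> axis i 1) * ?h y" for i :: 'n and y
  define \<psi> where "\<psi> i y = ?h y + ((y - x) \<bullet> axis i 1) * (?h' y * (2 * ((y - x) \<bullet> axis i 1)))" for i :: 'n and y
  have locu: "locally_integrable u" and locG: "locally_integrable G"
    using wg by (auto simp: has_weak_gradient_def)
  have locGi: "locally_integrable (\<lambda>y. G y $ i)" for i
    by (rule locally_integrable_component[OF locG])
  have zero: "?h y = 0" if "r < dist x y" for y
  proof -
    have "r\<^sup>2 \<le> (norm (y - x))\<^sup>2" using that r by (intro power_mono) (auto simp: dist_norm norm_minus_commute)
    then show ?thesis using r by (simp add: flux_profile_def flux_numerator_zero' power2_norm_eq_inner)
  qed
  have Ck: "C_k k (\<phi> i)" for k i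
    unfolding \<phi>_def by (rule C_k_mult[OF C_k_inner C_k_radial[OF smooth_upto_flux_profile[OF r]]])
  have test: "test_function (\<phi> i)" for i
    by (rule test_function_I[where a = x and R = r, OF Ck]) (simp add: \<phi>_def zero)
  have der: "(\<phi> i has_derivative (\<lambda>v. ((y - x) \<bullet> axis i 1) * (?h' y * (2 * ((y - x) \<bullet> v))) + (v \<bullet> axis i 1) * ?h y)) (at y)" for i y
  proof -
    have "((\<lambda>y. (y - x) \<bullet> axis i 1) has_derivative (\<lambda>v. v \<bullet> axis i 1)) (at y)"
      by (auto intro!: derivative_eq_intros)
    from has_derivative_mult[OF this has_derivative_radial[OF flux_profile_deriv[OF r]]]
    show ?thesis unfolding \<phi>_def .
  qed
  have fder: "frechet_derivative (\<phi> i) (at y) (axis i 1) = \<psi> i y" for i y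
    using frechet_derivative_at[OF der[of i y], symmetric] by (simp add: \<psi>_def inner_axis_axis)
  have \<psi>cont: "continuous_on UNIV (\<psi> i)" for i
  proof -
    have "continuous_on UNIV (\<lambda>y. frechet_derivative (\<phi> i) (at y) (axis i 1))"
      using Ck[of "Suc 0" i] by simp
    then show ?thesis by (simp add: fder)
  qed
  have \<psi>zero: "\<psi> i y = 0" if "r < dist x y" for i y
  proof -
    have "(\<phi> i has_derivative (\<lambda>_. 0)) (at y)"
    proof (rule has_derivative_transform_within_open[where f = "\<lambda>_. 0" and s = "- cball x r"])
      show "y \<in> - cball x r" using that by simp
    qed (auto simp: \<phi>_def zero not_le)
    then show ?thesis using fder[of i y] frechet_derivative_at by metis
  qed
  have iu: "integrable lebesgue (\<lambda>y. u y * \<psi> i y)" for i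
    by (rule locally_integrable_mult_continuous[OF locu \<psi>cont \<psi>zero])
  have \<phi>cont: "continuous_on UNIV (\<phi> i)" for i using Ck[of 0 i] by simp
  have iG: "integrable lebesgue (\<lambda>y. G y $ i * \<phi> i y)" for i
    by (rule locally_integrable_mult_continuous[OF locGi \<phi>cont, of r x]) (simp add: \<phi>_def zero)
  have eq: "(LINT y|lebesgue. u y * \<psi> i y) = - (LINT y|lebesgue. G y $ i * \<phi> i y)" for i
  proof -
    have "(LINT y|lebesgue. u y * frechet_derivative (\<phi> i) (at y) (axis i 1)) = - (LINT y|lebesgue. G y $ i * \<phi> i y)"
      using wg test[of i] unfolding has_weak_gradient_def by blast
    then show ?thesis by (simp only: fder)
  qed
  \<comment> \<open>Only the sum over all directions is a difference of kernels.\<close>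
  have sum\<psi>: "(\<Sum>i\<in>UNIV. \<psi> i y) = shell_kernel (r / 2) (y - x) - shell_kernel r (y - x)" for y
  proof -
    have "(\<Sum>i\<in>UNIV. \<psi> i y) = ?N * ?h y + 2 * ?h' y * (\<Sum>i\<in>UNIV. (y - x) $ i * (y - x) $ i)"
    proof -
      have "\<psi> i y = ?h y + 2 * ?h' y * ((y - x) $ i * (y - x) $ i)" for i
        by (simp add: \<psi>_def inner_axis del: vector_minus_component)
      then show ?thesis by (simp add: sum.distrib sum_distrib_left del: vector_minus_component)
    qed
    also have "(\<Sum>i\<in>UNIV. (y - x) $ i * (y - x) $ i) = (y - x) \<bullet> (y - x)"
      by (simp add: inner_vec_def)
    finally show ?thesis using flux_divergence[OF r, of "y - x"] by (simp add: mult_ac)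
  qed
  have sum\<phi>: "(\<Sum>i\<in>UNIV. G y $ i * \<phi> i y) = (G y \<bullet> (y - x)) * ?h y" for y
    by (simp add: \<phi>_def inner_axis inner_vec_def[of "G y"] sum_distrib_right mult.assoc del: vector_minus_component)
  show int: "integrable lebesgue (\<lambda>y. (G y \<bullet> (y - x)) * ?h y)"
    unfolding sum\<phi>[symmetric] by (intro Bochner_Integration.integrable_sum iG)
  note bor = integrable_locally_integrable_shell_kernel[OF locu]
  have "shell_avg (r / 2) u x - shell_avg r u x = (LINT y|lebesgue. u y * (\<Sum>i\<in>UNIV. \<psi> i y))"
    unfolding shell_avg_def sum\<psi> right_diff_distrib
    by (rule Bochner_Integration.integral_diff[symmetric]) (use r bor in auto)
  also have "\<dots> = (\<Sum>i\<in>UNIV. (LINT y|lebesgue. u y * \<psi> i y))"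
    unfolding sum_distrib_left by (rule Bochner_Integration.integral_sum) (rule iu)
  also have "\<dots> = - (\<Sum>i\<in>UNIV. (LINT y|lebesgue. G y $ i * \<phi> i y))"
    by (simp add: eq sum_negf)
  also have "(\<Sum>i\<in>UNIV. (LINT y|lebesgue. G y $ i * \<phi> i y)) = (LINT y|lebesgue. (G y \<bullet> (y - x)) * ?h y)"
    unfolding sum\<phi>[symmetric] by (rule Bochner_Integration.integral_sum[symmetric]) (rule iG)
  finally show "shell_avg (r / 2) u x - shell_avg r u x = - (LINT y|lebesgue. (G y \<bullet> (y - x)) * ?h y)" .
qed

text \<open>A Poincare type inequality: the field is of size \<open>r\<^sup>1\<^sup>-\<^sup>N\<close> on the ball of radius \<open>r\<close>.\<close>

lemma shell_avg_difference:
  fixes u :: "real ^ 'n \<Rightarrow> real"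
  assumes wg: "has_weak_gradient u G"
  shows "ennreal \<bar>shell_avg (2 powi (j - 1)) u x - shell_avg (2 powi j) u x\<bar>
    \<le> ennreal (grad_const TYPE(real ^ 'n) * 2 powi j) * dyadic_avg j (\<lambda>y. ennreal (norm (G y))) x"
proof -
  let ?r = "(2::real) powi j" and ?N = "real CARD('n)"
  let ?h = "\<lambda>y. flux_profile ?N ?r ((y - x) \<bullet> (y - x))"
  have r: "?r > 0" and half: "(2::real) powi (j - 1) = ?r / 2" by (auto simp: power_int_diff)
  note W = weak_gradient_shell_avg[OF wg r, of x]
  have "ennreal \<bar>shell_avg (2 powi (j - 1)) u x - shell_avg (2 powi j) u x\<bar>
      \<le> (\<integral>\<^sup>+ y. ennreal (norm ((G y \<bullet> (y - x)) * ?h y)) \<partial>lebesgue)"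
    unfolding half W(1) using integral_norm_bound_ennreal[OF W(2)] by simp
  also have "\<dots> = (\<integral>\<^sup>+ y. ennreal (norm ((G y \<bullet> (y - x)) * ?h y)) \<partial>lborel)"
    by (rule nn_integral_completion)
  also have "\<dots> \<le> (\<integral>\<^sup>+ y. ennreal (grad_const TYPE(real ^ 'n) * ?r * ?r powr (- ?N)) * (ennreal (norm (G y)) * indicator (ball x ?r) y) \<partial>lborel)"
  proof (rule nn_integral_mono)
    fix y
    have "norm ((G y \<bullet> (y - x)) * ?h y) \<le> norm (G y) * (norm (y - x) * \<bar>?h y\<bar>)"
      using mult_right_mono[OF Cauchy_Schwarz_ineq2[of "G y" "y - x"], of "\<bar>?h y\<bar>"] by (simp add: abs_mult mult_ac)
    also have "\<dots> \<le> norm (G y) * (grad_const TYPE(real ^ 'n) * ?r * ?r powr (- ?N) * indicator (ball 0 ?r) (y - x))"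
      using flux_bound[OF r, of "y - x"] by (intro mult_left_mono) (auto simp: grad_const_def)
    also have "indicator (ball 0 ?r) (y - x) = (indicator (ball x ?r) y :: real)"
      by (auto simp: indicator_def dist_norm norm_minus_commute)
    finally show "ennreal (norm ((G y \<bullet> (y - x)) * ?h y))
      \<le> ennreal (grad_const TYPE(real ^ 'n) * ?r * ?r powr (- ?N)) * (ennreal (norm (G y)) * indicator (ball x ?r) y)"
      using bump_primitive_bounds[of 1]
      by (auto simp: indicator_def ennreal_mult[symmetric] ennreal_leI mult_ac grad_const_def split: if_splits)
  qed
  also have "\<dots> = (\<integral>\<^sup>+ y. ennreal (grad_const TYPE(real ^ 'n) * ?r * ?r powr (- ?N)) * (ennreal (norm (G y)) * indicator (ball x ?r) y) \<partial>lebesgue)"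
    by (rule nn_integral_completion[symmetric])
  also have "\<dots> = ennreal (grad_const TYPE(real ^ 'n) * ?r * ?r powr (- ?N)) * (\<integral>\<^sup>+ y. ennreal (norm (G y)) * indicator (ball x ?r) y \<partial>lebesgue)"
  proof (rule nn_integral_cmult)
    have [measurable]: "G \<in> borel_measurable lebesgue"
      using wg by (intro locally_integrable_measurable) (auto simp: has_weak_gradient_def)
    have [measurable]: "ball x ?r \<in> sets lebesgue" by auto
    show "(\<lambda>y. ennreal (norm (G y)) * indicator (ball x ?r) y) \<in> borel_measurable lebesgue" by measurable
  qed
  also have "\<dots> = ennreal (grad_const TYPE(real ^ 'n) * ?r) * dyadic_avg j (\<lambda>y. ennreal (norm (G y))) x"
    using bump_primitive_bounds[of 1]
    by (simp add: dyadic_avg_def nn_integral_completion grad_const_def ennreal_mult mult.assoc)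
  finally show ?thesis .
qed

section \<open>Uniqueness of the weak gradient\<close>

text \<open>Maximal functions and Riesz potentials involve joint measurability in two variables, for which Borel
  functions are needed; elements of the function spaces are only Lebesgue measurable.\<close>

lemma borel_representative:
  fixes f :: "'a::euclidean_space \<Rightarrow> real"
  assumes "f \<in> borel_measurable lebesgue"
  obtains g where "g \<in> borel_measurable borel" "AE x in lborel. f x = g x"
  using completion_ex_borel_measurable_real[OF assms] by auto

lemma shell_avg_cong_AE:
  fixes f :: "'a::euclidean_space \<Rightarrow> real"
  assumes [measurable]: "f \<in> borel_measurable lebesgue" "g \<in> borel_measurable borel"
    and fg: "AE y in lborel. f y = g y"
  shows "shell_avg r f x = shell_avg r g x"
  unfolding shell_avg_def
proof (rule integral_cong_AE)
  have [measurable]: "(\<lambda>y. shell_kernel r (y - x)) \<in> borel_measurable lebesgue" "g \<in> borel_measurable lebesgue"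
    by (auto intro: measurable_completion)
  show "(\<lambda>y. f y * shell_kernel r (y - x)) \<in> borel_measurable lebesgue"
    "(\<lambda>y. g y * shell_kernel r (y - x)) \<in> borel_measurable lebesgue" by measurable
  show "AE y in lebesgue. f y * shell_kernel r (y - x) = g y * shell_kernel r (y - x)"
    using AE_completion[OF fg] by eventually_elim simp
qed

lemma shell_avg_tendsto_lebesgue:
  fixes f :: "'a::euclidean_space \<Rightarrow> real"
  assumes "locally_integrable f"
  shows "AE x in lborel. (\<lambda>k. shell_avg (2 powi (- int k)) f x) \<longlonglongrightarrow> shell_mass TYPE('a) * f x"
proof -
  have m: "f \<in> borel_measurable lebesgue" using assms by (rule locally_integrable_measurable)
  obtain g where g [measurable]: "g \<in> borel_measurable borel" and fg: "AE x in lborel. f x = g x"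
    using borel_representative[OF m] by auto
  have [measurable]: "g \<in> borel_measurable lebesgue" by (rule measurable_completion) simp
  have fg': "AE x in lebesgue. f x = g x" using fg by (rule AE_completion)
  have eq: "shell_avg r f x = shell_avg r g x" for r x
    by (rule shell_avg_cong_AE[OF m g fg])
  have "AE x in lborel. (\<lambda>k. shell_avg (2 powi (- int k)) g x) \<longlonglongrightarrow> shell_mass TYPE('a) * g x"
  proof (rule shell_avg_tendsto[OF g])
    fix n :: nat
    have "integrable lebesgue (\<lambda>x. f x * indicator (ball 0 (real n)) x)"
      by (rule locally_integrable_mult_bounded[OF assms, where B = 1 and R = "real n" and a = 0])
         (auto simp: indicator_def)
    then have "integrable lebesgue (\<lambda>x. g x * indicator (ball 0 (real n)) x)"
    proof (rule integrable_cong_AE_imp)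
      have [measurable]: "ball (0::'a) (real n) \<in> sets lebesgue" by auto
      show "(\<lambda>x. g x * indicator (ball 0 (real n)) x) \<in> borel_measurable lebesgue" by measurable
      show "AE x in lebesgue. f x * indicator (ball 0 (real n)) x = g x * indicator (ball 0 (real n)) x"
        using fg' by eventually_elim simp
    qed
    then show "integrable lborel (\<lambda>x. g x * indicator (ball 0 (real n)) x)"
      by (subst (asm) integrable_completion) auto
  qed
  with fg show ?thesis by eventually_elim (simp add: eq)
qed

lemma test_function_shell_kernel:
  fixes x :: "'a::euclidean_space"
  assumes r: "r > 0"
  shows "test_function (\<lambda>y. shell_kernel r (y - x))"
proof (rule test_function_I[where a = x and R = r])
  fix k
  let ?\<kappa> = "\<lambda>s. (2 / r\<^sup>2) * (annulus_bump ((1 / r\<^sup>2) * s + 0) * s powr (1 - real DIM('a) / 2))"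
  have "smooth_upto k ?\<kappa>"
  proof (rule smooth_upto_mult[OF smooth_upto_const], rule smooth_upto_mult_powr[where \<delta> = "r\<^sup>2 / 4"])
    show "smooth_upto k (\<lambda>s. annulus_bump ((1 / r\<^sup>2) * s + 0))" by (rule smooth_upto_affine[OF smooth_upto_annulus_bump])
    show "annulus_bump ((1 / r\<^sup>2) * s + 0) = 0" if "s < r\<^sup>2 / 4" for s
      using that r by (intro annulus_bump_eq_0) (simp add: divide_simps)
  qed (use r in auto)
  from C_k_radial[OF this, of x] show "C_k k (\<lambda>y. shell_kernel r (y - x))"
    by (simp add: shell_kernel_def mult_ac)
next
  show "shell_kernel r (y - x) = 0" if "r < dist x y" for y
    using that r by (intro shell_kernel_outside) auto
qed

lemma has_weak_gradient_weak_gradient: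
  "weakly_differentiable u \<Longrightarrow> has_weak_gradient u (weak_gradient u)"
  unfolding weakly_differentiable_def weak_gradient_def using someI_ex[of "has_weak_gradient u"] by blast

text \<open>The averaging kernel is itself a test function, so two weak gradients have the same averages, and
  almost everywhere they are determined by these.\<close>

theorem weak_gradient_unique:
  fixes u :: "real ^ 'n \<Rightarrow> real"
  assumes G: "has_weak_gradient u G" and H: "has_weak_gradient u H"
  shows "AE x in lebesgue. G x = H x"
proof -
  have comp: "AE x in lborel. G x $ i = H x $ i" for i
  proof -
    have loc: "locally_integrable (\<lambda>y. G y $ i)" "locally_integrable (\<lambda>y. H y $ i)"
      using G H by (auto simp: has_weak_gradient_def intro: locally_integrable_component)
    have eq: "shell_avg r (\<lambda>y. G y $ i) x = shell_avg r (\<lambda>y. H y $ i) x" if "r > 0" for r x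
    proof -
      have "- (LINT y|lebesgue. G y $ i * shell_kernel r (y - x)) = - (LINT y|lebesgue. H y $ i * shell_kernel r (y - x))"
        using conjunct2[OF conjunct2[OF G[unfolded has_weak_gradient_def]], rule_format, OF test_function_shell_kernel[OF that, of x], of i]
          conjunct2[OF conjunct2[OF H[unfolded has_weak_gradient_def]], rule_format, OF test_function_shell_kernel[OF that, of x], of i]
        by (rule trans[OF sym])
      then show ?thesis by (simp only: shell_avg_def neg_equal_iff_equal)
    qed
    from shell_avg_tendsto_lebesgue[OF loc(1)] shell_avg_tendsto_lebesgue[OF loc(2)]
    show ?thesis
    proof eventually_elim
      case (elim x)
      have "shell_mass TYPE(real ^ 'n) * G x $ i = shell_mass TYPE(real ^ 'n) * H x $ i"
        by (rule LIMSEQ_unique[OF _ elim(2)]) (use elim(1) in \<open>simp add: eq\<close>)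
      then show ?case using shell_kernel_integral(2)[of 1, where 'a = "real ^ 'n"] by simp
    qed
  qed
  have "AE x in lborel. \<forall>i\<in>UNIV. G x $ i = H x $ i"
    by (rule AE_finite_allI) (use comp in auto)
  then have "AE x in lborel. G x = H x" by eventually_elim (simp add: vec_eq_iff)
  then show ?thesis by (rule AE_completion)
qed

section \<open>Averages bounded by Riesz potentials\<close>

definition riesz_const :: "'n::finite itself \<Rightarrow> real \<Rightarrow> real" where
  "riesz_const _ \<alpha> = Gamma ((real CARD('n) - \<alpha>) / 2) / (Gamma (\<alpha> / 2) * pi powr (real CARD('n) / 2) * 2 powr \<alpha>)"

lemma riesz_kernel_eq:
  "riesz_kernel \<alpha> (x :: real ^ 'n) = riesz_const TYPE('n) \<alpha> * norm x powr (- (real CARD('n) - \<alpha>))"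
  by (simp add: riesz_kernel_def riesz_const_def)

lemma riesz_const_pos: "0 < \<alpha> \<Longrightarrow> \<alpha> < real CARD('n::finite) \<Longrightarrow> 0 < riesz_const TYPE('n) \<alpha>"
  by (simp add: riesz_const_def Gamma_real_pos)

lemma borel_measurable_riesz_kernel [measurable]: "riesz_kernel \<alpha> \<in> borel_measurable borel"
  unfolding riesz_kernel_def[abs_def] by measurable

lemma riesz_potential_lborel:
  "riesz_potential \<alpha> f x = (\<integral>\<^sup>+ y. ennreal (riesz_kernel \<alpha> (x - y) * f y) \<partial>lborel)"
  unfolding riesz_potential_def by (rule nn_integral_completion)

lemma riesz_potential_cong_AE:
  assumes "AE y in lborel. f y = g y"
  shows "riesz_potential \<alpha> f = riesz_potential \<alpha> g"
  unfolding riesz_potential_lborel fun_eq_iff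
  using assms by (intro allI nn_integral_cong_AE) (auto elim: eventually_mono)

lemma borel_measurable_riesz_potential [measurable]:
  assumes [measurable]: "f \<in> borel_measurable borel"
  shows "riesz_potential \<alpha> f \<in> borel_measurable borel"
  unfolding riesz_potential_lborel[abs_def] by measurable

lemma coulomb_energy_lborel:
  "ennreal_coulomb_energy \<alpha> p u = (\<integral>\<^sup>+ x. (riesz_potential (\<alpha> / 2) (\<lambda>y. \<bar>u y\<bar> powr p) x)\<^sup>2 \<partial>lborel)"
  unfolding ennreal_coulomb_energy_def by (rule nn_integral_completion)

text \<open>In a ball around \<open>x\<close> the kernel is smallest at the boundary.\<close>

lemma riesz_potential_ge:
  fixes f :: "real ^ 'n \<Rightarrow> real"
  assumes [measurable]: "f \<in> borel_measurable borel" and f: "\<And>y. 0 \<le> f y"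
    and a: "0 < \<alpha>" "\<alpha> < real CARD('n)" and r: "r > 0"
  shows "ennreal (riesz_const TYPE('n) \<alpha> * r powr (- (real CARD('n) - \<alpha>))) * (\<integral>\<^sup>+ y\<in>ball x r. ennreal (f y) \<partial>lborel)
     \<le> riesz_potential \<alpha> f x"
proof -
  let ?c = "riesz_const TYPE('n) \<alpha>"
  have c: "?c > 0" by (rule riesz_const_pos[OF a])
  have "ennreal (?c * r powr (- (real CARD('n) - \<alpha>))) * (\<integral>\<^sup>+ y\<in>ball x r. ennreal (f y) \<partial>lborel)
      = (\<integral>\<^sup>+ y. ennreal (?c * r powr (- (real CARD('n) - \<alpha>))) * (ennreal (f y) * indicator (ball x r) y) \<partial>lborel)"
    by (rule nn_integral_cmult[symmetric]) measurable
  also have "\<dots> \<le> (\<integral>\<^sup>+ y. ennreal (riesz_kernel \<alpha> (x - y) * f y) \<partial>lborel)"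
  proof (rule nn_integral_mono_AE)
    show "AE y in lborel. ennreal (?c * r powr (- (real CARD('n) - \<alpha>))) * (ennreal (f y) * indicator (ball x r) y)
      \<le> ennreal (riesz_kernel \<alpha> (x - y) * f y)"
      using AE_lborel_singleton[of x]
    proof eventually_elim
      case (elim y)
      show ?case
      proof (cases "y \<in> ball x r")
        case True
        have "r powr (- (real CARD('n) - \<alpha>)) \<le> norm (x - y) powr (- (real CARD('n) - \<alpha>))"
          using True elim a by (intro powr_mono2') (auto simp: dist_norm)
        then have "?c * r powr (- (real CARD('n) - \<alpha>)) * f y \<le> riesz_kernel \<alpha> (x - y) * f y"
          unfolding riesz_kernel_eq using c f by (intro mult_right_mono mult_left_mono) auto
        then show ?thesis using True c f by (simp add: ennreal_mult[symmetric] ennreal_leI)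
      qed simp
    qed
  qed
  finally show ?thesis by (simp add: riesz_potential_lborel)
qed

lemma riesz_potential_ge_dyadic_avg:
  fixes f :: "real ^ 'n \<Rightarrow> real"
  assumes "f \<in> borel_measurable borel" and f: "\<And>y. 0 \<le> f y"
    and a: "0 < \<alpha>" "\<alpha> < real CARD('n)"
  shows "ennreal (riesz_const TYPE('n) \<alpha> * (2 powi j) powr \<alpha>) * dyadic_avg j (\<lambda>y. ennreal (f y)) x
     \<le> riesz_potential \<alpha> f x"
proof -
  let ?r = "(2::real) powi j"
  have "?r powr \<alpha> * ?r powr (- real CARD('n)) = ?r powr (- (real CARD('n) - \<alpha>))"
    by (simp flip: powr_add)
  then have "ennreal (riesz_const TYPE('n) \<alpha> * ?r powr \<alpha>) * dyadic_avg j (\<lambda>y. ennreal (f y)) x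
      = ennreal (riesz_const TYPE('n) \<alpha> * ?r powr (- (real CARD('n) - \<alpha>))) * (\<integral>\<^sup>+ y\<in>ball x ?r. ennreal (f y) \<partial>lborel)"
    using riesz_const_pos[OF a]
    by (simp add: dyadic_avg_def mult.assoc[symmetric] ennreal_mult[symmetric]) (simp add: mult.assoc)
  then show ?thesis using riesz_potential_ge[OF assms, of ?r x] by simp
qed

text \<open>Each point of a ball of radius \<open>r\<close> is at distance less than \<open>2 r\<close> from all of the ball, so the
  potential of the mass in the ball is bounded below on the whole ball. Unlike the previous bound this
  one does not depend on the point \<open>x\<close>.\<close>

lemma riesz_energy_ge_dyadic_avg:
  fixes f :: "real ^ 'n \<Rightarrow> real"
  assumes [measurable]: "f \<in> borel_measurable borel" and f: "\<And>y. 0 \<le> f y"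
    and a: "0 < \<alpha>" "\<alpha> < real CARD('n)"
  shows "ennreal (unit_ball_vol (real CARD('n)) * (riesz_const TYPE('n) \<alpha>)\<^sup>2 * 4 powr (\<alpha> - real CARD('n)) * (2 powi j) powr (real CARD('n) + 2 * \<alpha>))
      * (dyadic_avg j (\<lambda>y. ennreal (f y)) x)\<^sup>2
     \<le> (\<integral>\<^sup>+ z. (riesz_potential \<alpha> f z)\<^sup>2 \<partial>lborel)"
proof -
  let ?r = "(2::real) powi j" and ?N = "real CARD('n)"
  let ?c = "riesz_const TYPE('n) \<alpha>" and ?b = "dyadic_avg j (\<lambda>y. ennreal (f y)) x"
  have c: "?c > 0" by (rule riesz_const_pos[OF a])
  have r: "?r > 0" by simp
  have low: "ennreal (?c * 2 powr (\<alpha> - ?N) * ?r powr \<alpha>) * ?b \<le> riesz_potential \<alpha> f z" if z: "z \<in> ball x ?r" for z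
  proof -
    have "?r powr \<alpha> * ?r powr (- ?N) = ?r powr (- (?N - \<alpha>))"
      by (simp flip: powr_add)
    then have "ennreal (?c * 2 powr (\<alpha> - ?N) * ?r powr \<alpha>) * ?b
       = ennreal (?c * (2 * ?r) powr (- (?N - \<alpha>))) * (\<integral>\<^sup>+ y\<in>ball x ?r. ennreal (f y) \<partial>lborel)"
      using c by (simp add: dyadic_avg_def mult.assoc[symmetric] ennreal_mult[symmetric] powr_mult)
        (simp add: mult.assoc)
    also have "\<dots> \<le> ennreal (?c * (2 * ?r) powr (- (?N - \<alpha>))) * (\<integral>\<^sup>+ y\<in>ball z (2 * ?r). ennreal (f y) \<partial>lborel)"
    proof (rule mult_left_mono[OF nn_integral_mono])
      fix y :: "real ^ 'n"
      have "dist z y < 2 * ?r" if "dist x y < ?r"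
        using dist_triangle[of z y x] z that by (simp add: dist_commute)
      then show "ennreal (f y) * indicator (ball x ?r) y \<le> ennreal (f y) * indicator (ball z (2 * ?r)) y"
        by (auto simp: indicator_def)
    qed simp
    also have "\<dots> \<le> riesz_potential \<alpha> f z" by (rule riesz_potential_ge[OF assms(1) f a]) simp
    finally show ?thesis .
  qed
  have e: "emeasure lborel (ball x ?r) = ennreal (unit_ball_vol ?N * ?r powr ?N)"
    using emeasure_ball_powr[OF r, of x] by simp
  have sq: "(?c * 2 powr (\<alpha> - ?N) * ?r powr \<alpha>)\<^sup>2 * (unit_ball_vol ?N * ?r powr ?N)
      = unit_ball_vol ?N * ?c\<^sup>2 * 4 powr (\<alpha> - ?N) * ?r powr (?N + 2 * \<alpha>)"
  proof -
    have "(2 powr (\<alpha> - ?N))\<^sup>2 = 4 powr (\<alpha> - ?N)"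
      using powr_mult[of 2 2 "\<alpha> - ?N"] by (simp add: power2_eq_square)
    moreover have "(?r powr \<alpha>)\<^sup>2 * ?r powr ?N = ?r powr (?N + 2 * \<alpha>)"
      by (simp add: power2_eq_square add_ac flip: powr_add)
    ultimately show ?thesis by (simp add: power_mult_distrib mult_ac)
  qed
  have "ennreal (unit_ball_vol ?N * ?c\<^sup>2 * 4 powr (\<alpha> - ?N) * ?r powr (?N + 2 * \<alpha>)) * ?b\<^sup>2
      = (ennreal (?c * 2 powr (\<alpha> - ?N) * ?r powr \<alpha>) * ?b)\<^sup>2 * emeasure lborel (ball x ?r)"
    unfolding sq[symmetric] e
  proof -
    have *: "ennreal (k\<^sup>2 * m) * b\<^sup>2 = (ennreal k * b)\<^sup>2 * ennreal m" if "0 \<le> k" "0 \<le> m" for k m b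
      using that by (simp add: ennreal_mult power_mult_distrib ennreal_power mult_ac)
    show "ennreal ((?c * 2 powr (\<alpha> - ?N) * ?r powr \<alpha>)\<^sup>2 * (unit_ball_vol ?N * ?r powr ?N)) * ?b\<^sup>2
      = (ennreal (?c * 2 powr (\<alpha> - ?N) * ?r powr \<alpha>) * ?b)\<^sup>2 * ennreal (unit_ball_vol ?N * ?r powr ?N)"
      using c by (intro *) auto
  qed
  also have "\<dots> = (\<integral>\<^sup>+ z. (ennreal (?c * 2 powr (\<alpha> - ?N) * ?r powr \<alpha>) * ?b)\<^sup>2 * indicator (ball x ?r) z \<partial>lborel)"
    by (rule nn_integral_cmult_indicator[symmetric]) simp
  also have "\<dots> \<le> (\<integral>\<^sup>+ z. (riesz_potential \<alpha> f z)\<^sup>2 \<partial>lborel)"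
  proof (rule nn_integral_mono)
    fix z
    show "(ennreal (?c * 2 powr (\<alpha> - ?N) * ?r powr \<alpha>) * ?b)\<^sup>2 * indicator (ball x ?r) z \<le> (riesz_potential \<alpha> f z)\<^sup>2"
      using power_mono[OF low[of z], of 2] by (auto simp: indicator_def)
  qed
  finally show ?thesis .
qed

lemma dyadic_avg_square_le:
  fixes f :: "'a::euclidean_space \<Rightarrow> ennreal"
  assumes [measurable]: "f \<in> borel_measurable borel"
  shows "(dyadic_avg j f x)\<^sup>2
    \<le> ennreal (unit_ball_vol (real DIM('a)) * (2 powi j) powr (- real DIM('a))) * (\<integral>\<^sup>+ y. (f y)\<^sup>2 \<partial>lborel)"
proof -
  let ?r = "(2::real) powi j" and ?N = "real DIM('a)"
  have r: "?r > 0" by simp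
  have "(\<integral>\<^sup>+ y\<in>ball x ?r. f y \<partial>lborel)\<^sup>2 \<le> (\<integral>\<^sup>+ y. (f y)\<^sup>2 \<partial>lborel) * (\<integral>\<^sup>+ y. (indicator (ball x ?r) y)\<^sup>2 \<partial>lborel)"
    by (rule Cauchy_Schwarz_nn_integral) measurable
  also have "(\<integral>\<^sup>+ y. (indicator (ball x ?r) y :: ennreal)\<^sup>2 \<partial>lborel) = (\<integral>\<^sup>+ y. indicator (ball x ?r) y \<partial>lborel)"
    by (intro nn_integral_cong) (auto simp: indicator_def)
  also have "\<dots> = ennreal (unit_ball_vol ?N * ?r powr ?N)"
    using emeasure_ball_powr[OF r, of x] by simp
  finally have *: "(\<integral>\<^sup>+ y\<in>ball x ?r. f y \<partial>lborel)\<^sup>2 \<le> (\<integral>\<^sup>+ y. (f y)\<^sup>2 \<partial>lborel) * ennreal (unit_ball_vol ?N * ?r powr ?N)" .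
  have "(dyadic_avg j f x)\<^sup>2 = ennreal ((?r powr (- ?N))\<^sup>2) * (\<integral>\<^sup>+ y\<in>ball x ?r. f y \<partial>lborel)\<^sup>2"
    by (simp add: dyadic_avg_def power_mult_distrib ennreal_power)
  also have "\<dots> \<le> ennreal ((?r powr (- ?N))\<^sup>2) * ((\<integral>\<^sup>+ y. (f y)\<^sup>2 \<partial>lborel) * ennreal (unit_ball_vol ?N * ?r powr ?N))"
    by (intro mult_left_mono *) simp
  also have "\<dots> = ennreal ((?r powr (- ?N))\<^sup>2 * (unit_ball_vol ?N * ?r powr ?N)) * (\<integral>\<^sup>+ y. (f y)\<^sup>2 \<partial>lborel)"
    by (simp add: ennreal_mult mult_ac)
  also have "(?r powr (- ?N))\<^sup>2 * (unit_ball_vol ?N * ?r powr ?N) = unit_ball_vol ?N * ?r powr (- ?N)"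
    by (simp add: power2_eq_square powr_minus)
  finally show ?thesis .
qed

text \<open>Jensen's inequality up to a constant. It follows by averaging
  \<open>\<bar>v\<bar> \<le> t powr (1 - p) * \<bar>v\<bar> powr p + t\<close> and taking \<open>t = b powr (1 / p)\<close>, or \<open>t\<close> close to 0 when
  \<open>b = 0\<close>.\<close>

lemma dyadic_avg_le_powr:
  fixes u :: "'a::euclidean_space \<Rightarrow> real"
  assumes [measurable]: "u \<in> borel_measurable borel" and p: "p \<ge> 1"
    and fin: "dyadic_avg j (\<lambda>y. ennreal (\<bar>u y\<bar> powr p)) x \<le> ennreal b" and b: "b \<ge> 0"
  shows "dyadic_avg j (\<lambda>y. ennreal \<bar>u y\<bar>) x \<le> ennreal ((1 + unit_ball_vol (real DIM('a))) * b powr (1 / p))"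
proof -
  let ?w = "unit_ball_vol (real DIM('a))" and ?A = "dyadic_avg j (\<lambda>y. ennreal \<bar>u y\<bar>) x"
  have pt: "\<bar>v\<bar> \<le> t powr (1 - p) * \<bar>v\<bar> powr p + t" if t: "t > 0" for t v :: real
  proof (cases "\<bar>v\<bar> \<le> t")
    case False
    then have v: "\<bar>v\<bar> > 0" using t by auto
    have "\<bar>v\<bar> = \<bar>v\<bar> powr (1 - p) * \<bar>v\<bar> powr p" using v by (simp flip: powr_add)
    also have "\<dots> \<le> t powr (1 - p) * \<bar>v\<bar> powr p"
      using False t p by (intro mult_right_mono powr_mono2') auto
    finally show ?thesis using t by simp
  qed (auto intro: add_increasing)
  have bound: "?A \<le> ennreal (t powr (1 - p) * b + t * ?w)" if t: "t > 0" for t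
  proof -
    have "?A \<le> dyadic_avg j (\<lambda>y. ennreal (t powr (1 - p)) * ennreal (\<bar>u y\<bar> powr p) + ennreal t) x"
      using pt[OF t] t by (intro dyadic_avg_mono) (auto simp: ennreal_mult[symmetric] ennreal_plus[symmetric] simp del: ennreal_plus intro!: ennreal_leI)
    also have "\<dots> = dyadic_avg j (\<lambda>y. ennreal (t powr (1 - p)) * ennreal (\<bar>u y\<bar> powr p)) x + ennreal ?w * ennreal t"
      by (simp add: dyadic_avg_add dyadic_avg_const)
    also have "dyadic_avg j (\<lambda>y. ennreal (t powr (1 - p)) * ennreal (\<bar>u y\<bar> powr p)) x
        = ennreal (t powr (1 - p)) * dyadic_avg j (\<lambda>y. ennreal (\<bar>u y\<bar> powr p)) x"
    proof -
      have "(\<integral>\<^sup>+ y. ennreal (t powr (1 - p)) * (ennreal (\<bar>u y\<bar> powr p) * indicator (ball x (2 powi j)) y) \<partial>lborel)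
        = ennreal (t powr (1 - p)) * (\<integral>\<^sup>+ y\<in>ball x (2 powi j). ennreal (\<bar>u y\<bar> powr p) \<partial>lborel)"
        by (rule nn_integral_cmult) measurable
      then show ?thesis unfolding dyadic_avg_def by (simp only: mult_ac)
    qed
    also have "\<dots> + ennreal ?w * ennreal t \<le> ennreal (t powr (1 - p)) * ennreal b + ennreal ?w * ennreal t"
      by (intro add_mono mult_left_mono fin) auto
    also have "\<dots> = ennreal (t powr (1 - p) * b + t * ?w)"
      using t b by (simp add: ennreal_mult[symmetric] ennreal_plus[symmetric] mult.commute del: ennreal_plus)
    finally show ?thesis .
  qed
  show ?thesis
  proof (cases "b = 0")
    case True
    have "?A \<le> ennreal e" if "e > 0" for e
      using bound[of "e / ?w"] True that less_imp_neq[OF unit_ball_vol_pos[of "real DIM('a)"]] by simp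
    then have "?A \<le> 0 + ennreal e" if "e > 0" for e using that by simp
    then have "?A \<le> 0" by (rule ennreal_le_epsilon) 
    then show ?thesis using True by simp
  next
    case False
    then have b: "b > 0" using b by simp
    have "(b powr (1 / p)) powr (1 - p) * b = b powr (1 / p)"
    proof -
      have "(b powr (1 / p)) powr (1 - p) * b = b powr ((1 / p) * (1 - p)) * b powr 1"
        using b by (simp add: powr_powr)
      also have "\<dots> = b powr ((1 / p) * (1 - p) + 1)" by (rule powr_add[symmetric])
      also have "(1 / p) * (1 - p) + 1 = 1 / p" using p by (simp add: field_simps)
      finally show ?thesis .
    qed
    then show ?thesis using bound[of "b powr (1 / p)"] b by (simp add: algebra_simps)
  qed
qed

section \<open>Four bounds for the averages of a function of finite energy\<close>

lemma ennreal_mult_le_imp_le_divide: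
  assumes "ennreal k * b \<le> ennreal w" "k > 0" "w \<ge> 0"
  shows "b \<le> ennreal (w / k)"
proof -
  have "ennreal (1 / k) * (ennreal k * b) \<le> ennreal (1 / k) * ennreal w"
    by (rule mult_left_mono[OF assms(1)]) simp
  then show ?thesis using assms(2,3) by (simp add: mult.assoc[symmetric] ennreal_mult[symmetric])
qed

lemma ennreal_square_le_imp_le_sqrt:
  assumes "b\<^sup>2 \<le> ennreal w" "w \<ge> 0"
  shows "b \<le> ennreal (sqrt w)"
proof (cases b)
  case (real a)
  then have "ennreal (a\<^sup>2) \<le> ennreal w" using assms(1) by (simp add: ennreal_power)
  then have "a\<^sup>2 \<le> w" using assms(2) by simp
  then show ?thesis using real by (auto intro!: ennreal_leI real_le_rsqrt)
next
  case top
  then show ?thesis using assms(1) by (simp add: top_unique)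
qed

lemma ennreal_enn2real_square_le: "ennreal ((enn2real y)\<^sup>2) \<le> y\<^sup>2"
  by (cases y) (auto simp: ennreal_power)

lemma dyadic_avg_cong_AE:
  assumes "AE y in lborel. f y = g y"
  shows "dyadic_avg j f x = dyadic_avg j g x"
  unfolding dyadic_avg_def
  by (rule arg_cong[where f = "\<lambda>t. _ * t"], rule nn_integral_cong_AE) (use assms in \<open>auto elim: eventually_mono\<close>)

text \<open>Here \<open>A j\<close> stands for the average of a function at scale \<open>2\<^sup>j\<close> around a point, divided by
  \<open>shell_mass\<close>, and \<open>L\<close> for the value of the function there. \<open>D\<close> and \<open>V\<close> are the two energies; \<open>M\<close>
  and \<open>W\<close> are the values at the point of the maximal function of the gradient and of the Riesz
  potential.\<close>

definition controlled_averages ::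
    "real \<Rightarrow> real \<Rightarrow> real \<Rightarrow> real \<Rightarrow> real \<Rightarrow> real \<Rightarrow> real \<Rightarrow> real \<Rightarrow> real \<Rightarrow> bool" where
  "controlled_averages K N \<alpha> p D V M W L \<longleftrightarrow> (\<exists>A::int \<Rightarrow> real. (\<lambda>k. A (- int k)) \<longlonglongrightarrow> L \<and>
     (\<forall>j. \<bar>A (j - 1) - A j\<bar> \<le> K * (2 powi j * M) \<and>
          \<bar>A (j - 1) - A j\<bar> \<le> K * ((2 powi j) powr (1 - N / 2) * sqrt D) \<and>
          \<bar>A j\<bar> \<le> K * ((2 powi j) powr (- (\<alpha> / 2)) * W) powr (1 / p) \<and>
          \<bar>A j\<bar> \<le> K * ((2 powi j) powr (- ((N + \<alpha>) / 2)) * sqrt V) powr (1 / p)))"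

text \<open>This collects all that is used about the function spaces in the proof of the inequalities.\<close>

theorem pointwise_averages:
  fixes \<alpha> p :: real
  assumes a: "0 < \<alpha>" "\<alpha> < real CARD('n::finite)" and p: "1 \<le> p"
  obtains K where "K > 0"
    "\<And>u :: real ^ 'n \<Rightarrow> real. u \<in> coulomb_sobolev \<alpha> p \<Longrightarrow>
      \<exists>M W. M \<in> borel_measurable borel \<and> W \<in> borel_measurable borel \<and> (\<forall>x. 0 \<le> M x \<and> 0 \<le> W x) \<and>
        (\<integral>\<^sup>+ x. ennreal ((M x)\<^sup>2) \<partial>lborel) \<le> ennreal (K * dirichlet_energy u) \<and>
        (\<integral>\<^sup>+ x. ennreal ((W x)\<^sup>2) \<partial>lborel) \<le> ennreal (coulomb_energy \<alpha> p u) \<and>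
        (AE x in lborel. controlled_averages K (real CARD('n)) \<alpha> p
           (dirichlet_energy u) (coulomb_energy \<alpha> p u) (M x) (W x) (u x))"
proof -
  let ?N = "real CARD('n)" and ?T = "TYPE(real ^ 'n)"
  define m where "m = shell_mass ?T"
  define w where "w = unit_ball_vol ?N"
  define c where "c = riesz_const TYPE('n) (\<alpha> / 2)"
  define g where "g = grad_const ?T"
  define kc where "kc = (2 * 2 ^ CARD('n) :: real)"
  define K0 where "K0 = w * c\<^sup>2 * 4 powr (\<alpha> / 2 - ?N)"
  have a2: "0 < \<alpha> / 2" "\<alpha> / 2 < ?N" using a by auto
  have m: "m > 0" unfolding m_def using shell_kernel_integral(2)[of 1, where 'a = "real ^ 'n"] by simp
  have w: "w > 0" by (simp add: w_def)
  have c: "c > 0" unfolding c_def by (rule riesz_const_pos[OF a2])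
  have g: "g \<ge> 0" unfolding g_def grad_const_def using bump_primitive_bounds[of 1] by simp
  have K0: "K0 > 0" using w c by (simp add: K0_def)
  define K1 where "K1 = g / m"
  define K2 where "K2 = g / m * sqrt w"
  define K3 where "K3 = kc * (1 + w) / m * (1 / c) powr (1 / p)"
  define K4 where "K4 = kc * (1 + w) / m * (1 / sqrt K0) powr (1 / p)"
  define Km where "Km = maximal_const ?T"
  define K where "K = 1 + Km + K1 + K2 + K3 + K4"
  have nn: "0 \<le> Km" "0 \<le> K1" "0 \<le> K2" "0 \<le> K3" "0 \<le> K4"
    using m w g by (auto simp: Km_def maximal_const_def K1_def K2_def K3_def K4_def kc_def)
  have Kge: "Km \<le> K" "K1 \<le> K" "K2 \<le> K" "K3 \<le> K" "K4 \<le> K" using nn by (auto simp: K_def)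
  have scale: "x \<le> K * t" if "x \<le> k * t" "k \<le> K" "0 \<le> t" for x k t
    using that mult_right_mono[of k K t] by linarith
  show ?thesis
  proof (rule that[of K])
    show "K > 0" using nn by (simp add: K_def)
  next
    fix u :: "real ^ 'n \<Rightarrow> real" assume u: "u \<in> coulomb_sobolev \<alpha> p"
    define G where "G = weak_gradient u"
    have um: "u \<in> borel_measurable lebesgue" and fin: "ennreal_coulomb_energy \<alpha> p u < \<infinity>"
      and wg: "has_weak_gradient u G" and G2: "integrable lebesgue (\<lambda>x. (norm (G x))\<^sup>2)"
      using u by (auto simp: coulomb_sobolev_def G_def intro: has_weak_gradient_weak_gradient)
    define D where "D = dirichlet_energy u"
    define V where "V = coulomb_energy \<alpha> p u"
    have D_eq: "D = (LINT x|lebesgue. (norm (G x))\<^sup>2)" by (simp add: D_def G_def dirichlet_energy_def)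
    have D: "D \<ge> 0" by (simp add: D_eq)
    have V: "V \<ge> 0" by (simp add: V_def coulomb_energy_def)
    have locu: "locally_integrable u" and locG: "locally_integrable G"
      using wg by (auto simp: has_weak_gradient_def)
    have "(\<lambda>x. norm (G x)) \<in> borel_measurable lebesgue"
      using locally_integrable_measurable[OF locG] by simp
    then obtain f where f [measurable]: "f \<in> borel_measurable borel" and Gf: "AE x in lborel. norm (G x) = f x"
      by (rule borel_representative)
    obtain v where v [measurable]: "v \<in> borel_measurable borel" and uv: "AE x in lborel. u x = v x"
      using borel_representative[OF um] by auto
    have Gf': "AE x in lborel. norm (G x) = \<bar>f x\<bar>"
      using Gf by eventually_elim (metis abs_norm_cancel)
    let ?f = "\<lambda>y. ennreal \<bar>f y\<bar>"
    let ?vp = "\<lambda>y. \<bar>v y\<bar> powr p"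
    let ?R = "riesz_potential (\<alpha> / 2) ?vp"
    have avgG: "dyadic_avg j (\<lambda>y. ennreal (norm (G y))) x = dyadic_avg j ?f x" for j x
      by (rule dyadic_avg_cong_AE) (use Gf' in \<open>auto elim!: eventually_mono\<close>)
    have f2: "(\<integral>\<^sup>+ y. (?f y)\<^sup>2 \<partial>lborel) = ennreal D"
    proof -
      have "ennreal D = (\<integral>\<^sup>+ x. ennreal ((norm (G x))\<^sup>2) \<partial>lebesgue)"
        unfolding D_eq by (rule nn_integral_eq_integral[OF G2, symmetric]) simp
      also have "\<dots> = (\<integral>\<^sup>+ x. ennreal ((norm (G x))\<^sup>2) \<partial>lborel)" by (rule nn_integral_completion)
      also have "\<dots> = (\<integral>\<^sup>+ x. (?f x)\<^sup>2 \<partial>lborel)"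
        by (rule nn_integral_cong_AE) (use Gf' in \<open>auto elim!: eventually_mono simp: ennreal_power\<close>)
      finally show ?thesis by simp
    qed
    have R: "riesz_potential (\<alpha> / 2) (\<lambda>y. \<bar>u y\<bar> powr p) = ?R"
      by (rule riesz_potential_cong_AE) (use uv in \<open>auto elim!: eventually_mono\<close>)
    have R2: "(\<integral>\<^sup>+ z. (?R z)\<^sup>2 \<partial>lborel) = ennreal V"
      using fin by (simp add: V_def coulomb_energy_def coulomb_energy_lborel R)
    have [measurable]: "?R \<in> borel_measurable borel" by (rule borel_measurable_riesz_potential) measurable
    define M where "M x = enn2real (dyadic_max ?f x)" for x
    define W where "W x = enn2real (?R x)" for x
    have max2: "(\<integral>\<^sup>+ x. (dyadic_max ?f x)\<^sup>2 \<partial>lborel) \<le> ennreal (Km * D)"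
      using dyadic_max_L2[of ?f] nn D by (simp add: f2 Km_def ennreal_mult)
    have finM: "AE x in lborel. dyadic_max ?f x \<noteq> \<infinity>"
    proof -
      have "AE x in lborel. (dyadic_max ?f x)\<^sup>2 \<noteq> \<infinity>"
        by (rule nn_integral_noteq_infinite) (use max2 in \<open>auto simp: top_unique\<close>)
      then show ?thesis by eventually_elim auto
    qed
    have finW: "AE x in lborel. ?R x \<noteq> \<infinity>"
    proof -
      have "AE x in lborel. (?R x)\<^sup>2 \<noteq> \<infinity>"
        by (rule nn_integral_noteq_infinite) (use R2 in auto)
      then show ?thesis by eventually_elim auto
    qed
    have "AE x in lborel. controlled_averages K ?N \<alpha> p D V (M x) (W x) (u x)"
      using finM finW shell_avg_tendsto_lebesgue[OF locu]
    proof eventually_elim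
      case (elim x)
      define A where "A j = shell_avg (2 powi j) u x / m" for j
      have "(\<lambda>k. shell_avg (2 powi - int k) u x / m) \<longlonglongrightarrow> m * u x / m"
        by (intro tendsto_divide tendsto_const) (use elim m in \<open>auto simp: m_def\<close>)
      then have lim: "(\<lambda>k. A (- int k)) \<longlonglongrightarrow> u x" using m by (simp add: A_def)
      have eM: "dyadic_max ?f x = ennreal (M x)" using elim by (simp add: M_def ennreal_enn2real_if)
      have eW: "?R x = ennreal (W x)" using elim by (simp add: W_def ennreal_enn2real_if)
      have MW0: "0 \<le> M x" "0 \<le> W x" by (auto simp: M_def W_def)
      have "\<bar>A (j - 1) - A j\<bar> \<le> K * (2 powi j * M x) \<and>
                \<bar>A (j - 1) - A j\<bar> \<le> K * ((2 powi j) powr (1 - ?N / 2) * sqrt D) \<and>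
                \<bar>A j\<bar> \<le> K * ((2 powi j) powr (- (\<alpha> / 2)) * W x) powr (1 / p) \<and>
                \<bar>A j\<bar> \<le> K * ((2 powi j) powr (- ((?N + \<alpha>) / 2)) * sqrt V) powr (1 / p)" for j
      proof -
        define r where "r = (2::real) powi j"
        have r: "r > 0" by (simp add: r_def)
        have diff: "\<bar>A (j - 1) - A j\<bar> \<le> g / m * (r * t)" if t: "dyadic_avg j ?f x \<le> ennreal t" "t \<ge> 0" for t
        proof -
          have "ennreal \<bar>shell_avg (2 powi (j - 1)) u x - shell_avg (2 powi j) u x\<bar>
             \<le> ennreal (g * r) * dyadic_avg j ?f x"
            using shell_avg_difference[OF wg, of j x] by (simp add: avgG g_def r_def)
          also have "\<dots> \<le> ennreal (g * r) * ennreal t" by (intro mult_left_mono t) simp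
          also have "\<dots> = ennreal (g * r * t)" using g r t by (simp add: ennreal_mult)
          finally have "\<bar>shell_avg (2 powi (j - 1)) u x - shell_avg (2 powi j) u x\<bar> \<le> g * r * t"
            using g r t by simp
          from divide_right_mono[OF this, of m] m show ?thesis
            by (simp add: A_def diff_divide_distrib[symmetric] mult_ac)
        qed
        have 1: "\<bar>A (j - 1) - A j\<bar> \<le> K1 * (r * M x)"
          unfolding K1_def by (rule diff) (use dyadic_avg_le_max[of j ?f x] eM MW0 in auto)
        have 2: "\<bar>A (j - 1) - A j\<bar> \<le> K2 * (r powr (1 - ?N / 2) * sqrt D)"
        proof -
          have "(dyadic_avg j ?f x)\<^sup>2 \<le> ennreal (w * r powr (- ?N) * D)"
            using dyadic_avg_square_le[of ?f j x] w D by (simp add: f2 w_def r_def ennreal_mult)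
          then have "dyadic_avg j ?f x \<le> ennreal (sqrt (w * r powr (- ?N) * D))"
            using w D by (intro ennreal_square_le_imp_le_sqrt) auto
          from diff[OF this] have "\<bar>A (j - 1) - A j\<bar> \<le> g / m * (r * sqrt (w * r powr (- ?N) * D))"
            using w D by simp
          also have "sqrt (w * r powr (- ?N) * D) = sqrt w * r powr (- ?N / 2) * sqrt D"
            by (simp add: real_sqrt_mult powr_half_sqrt[symmetric] powr_powr)
          also have "r * (sqrt w * r powr (- ?N / 2) * sqrt D) = sqrt w * (r powr 1 * r powr (- ?N / 2)) * sqrt D"
            using r by simp
          also have "r powr 1 * r powr (- ?N / 2) = r powr (1 - ?N / 2)"
            using powr_add[of r 1 "- ?N / 2"] by simp
          finally show ?thesis by (simp add: K2_def mult_ac)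
        qed
        have avg: "\<bar>A j\<bar> \<le> kc * (1 + w) / m * b powr (1 / p)"
          if b: "dyadic_avg j (\<lambda>y. ennreal (?vp y)) x \<le> ennreal b" "b \<ge> 0" for b
        proof -
          have "ennreal \<bar>shell_avg (2 powi j) u x\<bar> = ennreal \<bar>shell_avg (2 powi j) v x\<bar>"
            using shell_avg_cong_AE[OF um v uv] by simp
          also have "\<dots> \<le> ennreal kc * dyadic_avg j (\<lambda>y. ennreal \<bar>v y\<bar>) x"
            using shell_avg_le_dyadic_avg[OF v, of j x] by (simp add: kc_def)
          also have "\<dots> \<le> ennreal kc * ennreal ((1 + w) * b powr (1 / p))"
            using dyadic_avg_le_powr[OF v p b] by (intro mult_left_mono) (auto simp: w_def)
          also have "\<dots> = ennreal (kc * ((1 + w) * b powr (1 / p)))"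
            using w by (intro ennreal_mult[symmetric]) (auto simp: kc_def)
          finally have "\<bar>shell_avg (2 powi j) u x\<bar> \<le> kc * ((1 + w) * b powr (1 / p))"
            using w by (simp add: kc_def)
          from divide_right_mono[OF this, of m] m show ?thesis by (simp add: A_def mult_ac)
        qed
        have 3: "\<bar>A j\<bar> \<le> K3 * (r powr (- (\<alpha> / 2)) * W x) powr (1 / p)"
        proof -
          have "ennreal (c * r powr (\<alpha> / 2)) * dyadic_avg j (\<lambda>y. ennreal (?vp y)) x \<le> ennreal (W x)"
            using riesz_potential_ge_dyadic_avg[of ?vp "\<alpha> / 2" j x] a2 by (simp add: c_def r_def eW)
          then have "dyadic_avg j (\<lambda>y. ennreal (?vp y)) x \<le> ennreal (W x / (c * r powr (\<alpha> / 2)))"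
            by (rule ennreal_mult_le_imp_le_divide) (use c r MW0 in auto)
          from avg[OF this] have "\<bar>A j\<bar> \<le> kc * (1 + w) / m * (W x / (c * r powr (\<alpha> / 2))) powr (1 / p)"
            using c MW0 by simp
          also have "W x / (c * r powr (\<alpha> / 2)) = 1 / c * (r powr (- (\<alpha> / 2)) * W x)"
            by (simp add: powr_minus_divide)
          also have "\<dots> powr (1 / p) = (1 / c) powr (1 / p) * (r powr (- (\<alpha> / 2)) * W x) powr (1 / p)"
            by (rule powr_mult)
          finally show ?thesis by (simp add: K3_def mult_ac)
        qed
        have 4: "\<bar>A j\<bar> \<le> K4 * (r powr (- ((?N + \<alpha>) / 2)) * sqrt V) powr (1 / p)"
        proof -
          have "ennreal (K0 * r powr (?N + \<alpha>)) * (dyadic_avg j (\<lambda>y. ennreal (?vp y)) x)\<^sup>2 \<le> ennreal V"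
            using riesz_energy_ge_dyadic_avg[of ?vp "\<alpha> / 2" j x] a2 by (simp add: c_def r_def K0_def w_def R2)
          then have "(dyadic_avg j (\<lambda>y. ennreal (?vp y)) x)\<^sup>2 \<le> ennreal (V / (K0 * r powr (?N + \<alpha>)))"
            by (rule ennreal_mult_le_imp_le_divide) (use K0 r V in auto)
          then have "dyadic_avg j (\<lambda>y. ennreal (?vp y)) x \<le> ennreal (sqrt (V / (K0 * r powr (?N + \<alpha>))))"
            by (rule ennreal_square_le_imp_le_sqrt) (use K0 V in auto)
          from avg[OF this] have "\<bar>A j\<bar> \<le> kc * (1 + w) / m * sqrt (V / (K0 * r powr (?N + \<alpha>))) powr (1 / p)"
            using K0 V by simp
          also have "sqrt (V / (K0 * r powr (?N + \<alpha>))) = 1 / sqrt K0 * (r powr (- ((?N + \<alpha>) / 2)) * sqrt V)"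
          proof -
            have "sqrt (r powr (?N + \<alpha>)) = r powr ((?N + \<alpha>) / 2)"
              by (simp add: powr_half_sqrt[symmetric] powr_powr)
            then show ?thesis by (simp add: real_sqrt_divide real_sqrt_mult powr_minus_divide del: minus_divide_left)
          qed
          also have "\<dots> powr (1 / p) = (1 / sqrt K0) powr (1 / p) * (r powr (- ((?N + \<alpha>) / 2)) * sqrt V) powr (1 / p)"
            by (rule powr_mult)
          finally show ?thesis by (simp add: K4_def mult_ac)
        qed
        show ?thesis
          unfolding r_def[symmetric]
          using scale[OF 1 Kge(2)] scale[OF 2 Kge(3)] scale[OF 3 Kge(4)] scale[OF 4 Kge(5)] r MW0 D
          by simp
      qed
      with lim show ?case unfolding controlled_averages_def by blast
    qed
    moreover have "(\<integral>\<^sup>+ x. ennreal ((M x)\<^sup>2) \<partial>lborel) \<le> ennreal (K * D)"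
    proof -
      have "(\<integral>\<^sup>+ x. ennreal ((M x)\<^sup>2) \<partial>lborel) \<le> (\<integral>\<^sup>+ x. (dyadic_max ?f x)\<^sup>2 \<partial>lborel)"
        unfolding M_def by (intro nn_integral_mono ennreal_enn2real_square_le)
      also note max2
      also have "ennreal (Km * D) \<le> ennreal (K * D)"
        using Kge D by (intro ennreal_leI mult_right_mono) auto
      finally show ?thesis .
    qed
    moreover have "(\<integral>\<^sup>+ x. ennreal ((W x)\<^sup>2) \<partial>lborel) \<le> ennreal V"
      unfolding R2[symmetric] W_def by (intro nn_integral_mono ennreal_enn2real_square_le)
    moreover have "M \<in> borel_measurable borel" "W \<in> borel_measurable borel"
      unfolding M_def W_def by measurable
    moreover have "\<forall>x. 0 \<le> M x \<and> 0 \<le> W x" by (simp add: M_def W_def)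
    ultimately show "\<exists>M W. M \<in> borel_measurable borel \<and> W \<in> borel_measurable borel \<and> (\<forall>x. 0 \<le> M x \<and> 0 \<le> W x) \<and>
        (\<integral>\<^sup>+ x. ennreal ((M x)\<^sup>2) \<partial>lborel) \<le> ennreal (K * dirichlet_energy u) \<and>
        (\<integral>\<^sup>+ x. ennreal ((W x)\<^sup>2) \<partial>lborel) \<le> ennreal (coulomb_energy \<alpha> p u) \<and>
        (AE x in lborel. controlled_averages K (real CARD('n)) \<alpha> p
           (dirichlet_energy u) (coulomb_energy \<alpha> p u) (M x) (W x) (u x))"
      unfolding D_def[symmetric] V_def[symmetric] by blast
  qed
qed

section \<open>Sums over dyadic scales\<close>

lemma dyadic_powr: "((2::real) powi j) powr b = 2 powr (of_int j * b)"
  by (simp add: powr_real_of_int'[symmetric] powr_powr)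

lemma two_powr_neg_less_1: "b > 0 \<Longrightarrow> 2 powr (- b) < (1::real)"
  using powr_less_mono[of "- b" 0 2] by simp

lemma le_weighted_geometric_mean:
  fixes t :: real
  assumes "0 \<le> t" "t \<le> x" "t \<le> y" "0 \<le> s" "s \<le> 1"
  shows "t \<le> x powr s * y powr (1 - s)"
proof (cases "t = 0")
  case False
  then have "t = t powr s * t powr (1 - s)" using assms by (simp flip: powr_add)
  also have "\<dots> \<le> x powr s * y powr (1 - s)"
    using assms by (intro mult_mono powr_mono2) auto
  finally show ?thesis .
qed simp

lemma weighted_geometric_mean_le_sum:
  fixes x y :: real
  assumes "0 \<le> x" "0 \<le> y" "0 \<le> s" "s \<le> 1"
  shows "x powr s * y powr (1 - s) \<le> x + y"
proof (cases "x = 0 \<or> y = 0")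
  case False
  define t where "t = max x y"
  have "t > 0" using False assms by (auto simp: t_def)
  have "x powr s * y powr (1 - s) \<le> t powr s * t powr (1 - s)"
    using assms by (intro mult_mono powr_mono2) (auto simp: t_def)
  also have "\<dots> = t" using \<open>t > 0\<close> by (simp flip: powr_add)
  finally show ?thesis using assms by (simp add: t_def max_def split: if_splits)
qed (use assms in auto)

lemma geometric_sum_le:
  fixes q :: real
  assumes "0 \<le> q" "q < 1"
  shows "(\<Sum>i<n. q ^ i) \<le> 1 / (1 - q)"
proof -
  have "(\<Sum>i<n. q ^ i) \<le> (\<Sum>i. q ^ i)"
    using assms by (intro sum_le_suminf) (auto intro: summable_geometric)
  also have "\<dots> = 1 / (1 - q)" using assms by (intro suminf_geometric) auto
  finally show ?thesis .
qed

lemma dyadic_sum_down: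
  assumes "b > 0"
  shows "(\<Sum>i<n. ((2::real) powi (j - int i)) powr b) \<le> (2 powi j) powr b * (1 / (1 - 2 powr (- b)))"
proof -
  have "((2::real) powi (j - int i)) powr b = (2 powi j) powr b * (2 powr (- b)) ^ i" for i
    by (simp add: dyadic_powr powr_power algebra_simps flip: powr_add)
  then have "(\<Sum>i<n. ((2::real) powi (j - int i)) powr b) = (2 powi j) powr b * (\<Sum>i<n. (2 powr (- b)) ^ i)"
    by (simp add: sum_distrib_left)
  also have "\<dots> \<le> (2 powi j) powr b * (1 / (1 - 2 powr (- b)))"
    using assms by (intro mult_left_mono geometric_sum_le) (auto simp: two_powr_neg_less_1)
  finally show ?thesis .
qed

lemma dyadic_sum_up:
  assumes "b > 0"
  shows "(\<Sum>i<n. ((2::real) powi (j + 1 + int i)) powr (- b)) \<le> (2 powi j) powr (- b) * (1 / (1 - 2 powr (- b)))"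
proof -
  have "((2::real) powi (j + 1 + int i)) powr (- b) \<le> (2 powi j) powr (- b) * (2 powr (- b)) ^ i" for i
  proof -
    have "((2::real) powi (j + 1 + int i)) powr (- b) = 2 powr (- b) * ((2 powi j) powr (- b) * (2 powr (- b)) ^ i)"
      by (simp add: dyadic_powr powr_power algebra_simps flip: powr_add)
    also have "\<dots> \<le> 1 * ((2 powi j) powr (- b) * (2 powr (- b)) ^ i)"
      using two_powr_neg_less_1[OF assms] by (intro mult_right_mono) auto
    finally show ?thesis by simp
  qed
  then have "(\<Sum>i<n. ((2::real) powi (j + 1 + int i)) powr (- b)) \<le> (2 powi j) powr (- b) * (\<Sum>i<n. (2 powr (- b)) ^ i)"
    unfolding sum_distrib_left by (intro sum_mono)
  also have "\<dots> \<le> (2 powi j) powr (- b) * (1 / (1 - 2 powr (- b)))"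
    using assms by (intro mult_left_mono geometric_sum_le) (auto simp: two_powr_neg_less_1)
  finally show ?thesis .
qed

lemma dyadic_decay: "b > 0 \<Longrightarrow> (\<lambda>n. ((2::real) powi (j + int n)) powr (- b) * Q) \<longlonglongrightarrow> 0"
proof -
  assume "b > 0"
  then have "(\<lambda>n. (2 powr (- b)) ^ n) \<longlonglongrightarrow> (0::real)" by (intro LIMSEQ_power_zero) (auto simp: two_powr_neg_less_1)
  then have "(\<lambda>n. (2 powi j) powr (- b) * (2 powr (- b)) ^ n * Q) \<longlonglongrightarrow> (2 powi j) powr (- b) * 0 * Q"
    by (intro tendsto_mult tendsto_const)
  moreover have "(2 powi j) powr (- b) * (2 powr (- b)) ^ n = (2 powi (j + int n)) powr (- b)" for n
    by (simp add: dyadic_powr powr_power algebra_simps flip: powr_add)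
  ultimately show ?thesis by simp
qed

text \<open>A bound for the limit at scale 0 in terms of one coarse scale.\<close>

lemma telescoping_down:
  fixes A :: "int \<Rightarrow> real"
  assumes "(\<lambda>k. A (- int k)) \<longlonglongrightarrow> L" "\<And>i. \<bar>A (i - 1) - A i\<bar> \<le> c i"
    and S: "\<And>n::nat. (\<Sum>i<n. c (j - int i)) \<le> S"
  shows "\<bar>L\<bar> \<le> \<bar>A j\<bar> + S"
proof -
  have *: "\<bar>A (j - int n)\<bar> \<le> \<bar>A j\<bar> + (\<Sum>i<n. c (j - int i))" for n
  proof (induction n)
    case (Suc n)
    have "A (j - int (Suc n)) = A (j - int n - 1)" by (simp add: algebra_simps)
    then show ?case using Suc assms(2)[of "j - int n"] by simp
  qed simp
  have "filterlim (\<lambda>n. nat (int n - j)) at_top sequentially"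
    unfolding filterlim_at_top
  proof
    fix Z
    show "\<forall>\<^sub>F n in sequentially. Z \<le> nat (int n - j)"
      using eventually_ge_at_top[of "nat (int Z + j)"] by eventually_elim linarith
  qed
  from filterlim_compose[OF assms(1) this]
  have "(\<lambda>n. A (- int (nat (int n - j)))) \<longlonglongrightarrow> L" .
  moreover have "\<forall>\<^sub>F n in sequentially. A (- int (nat (int n - j))) = A (j - int n)"
    using eventually_ge_at_top[of "nat j"]
  proof eventually_elim
    case (elim n)
    then have "j \<le> int n" by linarith
    then show ?case by simp
  qed
  ultimately have "(\<lambda>n. A (j - int n)) \<longlonglongrightarrow> L" by (rule Lim_transform_eventually)
  then have "(\<lambda>n. \<bar>A (j - int n)\<bar>) \<longlonglongrightarrow> \<bar>L\<bar>" by (rule tendsto_rabs)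
  then show ?thesis
    by (rule LIMSEQ_le_const2) (meson * S add_left_mono order_trans)
qed

lemma telescoping_up:
  fixes A :: "int \<Rightarrow> real"
  assumes "\<And>i. \<bar>A (i - 1) - A i\<bar> \<le> c i"
  shows "\<bar>A j\<bar> \<le> \<bar>A (j + int n)\<bar> + (\<Sum>i<n. c (j + 1 + int i))"
proof (induction n)
  case (Suc n)
  have "j + int (Suc n) - 1 = j + int n" "j + int (Suc n) = j + 1 + int n" by auto
  then have "\<bar>A (j + int n) - A (j + int (Suc n))\<bar> \<le> c (j + 1 + int n)"
    using assms[of "j + int (Suc n)"] by metis
  then show ?case using Suc by (simp del: of_nat_Suc)
qed simp

lemma dyadic_bracket:
  assumes "0 < t"
  shows "2 powi \<lfloor>log 2 t\<rfloor> \<le> t" "t < 2 powi (\<lfloor>log 2 t\<rfloor> + 1)"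
proof -
  have "2 powr real_of_int \<lfloor>log 2 t\<rfloor> \<le> t"
    using assms by (subst le_log_iff[symmetric]) auto
  then show "2 powi \<lfloor>log 2 t\<rfloor> \<le> t" by (simp add: powr_real_of_int'[symmetric])
  have "t < 2 powr (real_of_int (\<lfloor>log 2 t\<rfloor> + 1))"
    using assms by (subst log_less_iff[symmetric]) (simp, simp, linarith)
  then show "t < 2 powi (\<lfloor>log 2 t\<rfloor> + 1)" by (subst powr_real_of_int'[symmetric]) auto
qed

text \<open>The scale \<open>R = (Q / P) powr (1 / (\<beta> + \<gamma>))\<close> makes both terms equal; rounding it down to a power of 2
  costs the factor \<open>2 powr \<gamma>\<close>. If \<open>P\<close> or \<open>Q\<close> is 0, the scale is sent to infinity or to 0.\<close>

lemma dyadic_balance: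
  fixes P Q :: real
  assumes bg: "\<beta> > 0" "\<gamma> > 0" and PQ: "P \<ge> 0" "Q \<ge> 0"
    and L: "\<And>j. L \<le> (2 powi j) powr \<beta> * P + (2 powi j) powr (- \<gamma>) * Q"
  shows "L \<le> (1 + 2 powr \<gamma>) * (P powr (\<gamma> / (\<beta> + \<gamma>)) * Q powr (\<beta> / (\<beta> + \<gamma>)))"
proof -
  consider "P = 0" | "Q = 0" | "P > 0" "Q > 0" using PQ by linarith
  then show ?thesis
  proof cases
    case 1
    have "L \<le> 0"
    proof (rule LIMSEQ_le_const[OF dyadic_decay[OF bg(2), of 0 Q]], intro exI allI impI)
      fix n :: nat
      show "L \<le> (2 powi (0 + int n)) powr (- \<gamma>) * Q" using L[of "0 + int n"] 1 by simp
    qed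
    then show ?thesis using 1 by simp
  next
    case 2
    have "L \<le> 0"
    proof (rule LIMSEQ_le_const[OF dyadic_decay[OF bg(1), of 0 P]], intro exI allI impI)
      fix n :: nat
      show "L \<le> (2 powi (0 + int n)) powr (- \<beta>) * P" 
        using L[of "- int n"] 2 by (simp only: dyadic_powr) simp
    qed
    then show ?thesis using 2 by simp
  next
    case 3
    define j where "j = \<lfloor>log 2 ((Q / P) powr (1 / (\<beta> + \<gamma>)))\<rfloor>"
    define R where "R = (Q / P) powr (1 / (\<beta> + \<gamma>))"
    have R: "R > 0" using 3 by (simp add: R_def)
    have j: "2 powi j \<le> R" "R \<le> 2 * 2 powi j"
      using dyadic_bracket[OF R] by (simp_all add: j_def R_def[symmetric] power_int_add)
    have up: "(2 powi j) powr \<beta> * P \<le> P powr (\<gamma> / (\<beta> + \<gamma>)) * Q powr (\<beta> / (\<beta> + \<gamma>))"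
    proof -
      have "(2 powi j) powr \<beta> * P \<le> R powr \<beta> * P"
        using j bg 3 by (intro mult_right_mono powr_mono2) auto
      also have "\<dots> = Q powr (\<beta> / (\<beta> + \<gamma>)) * (P powr 1 / P powr (\<beta> / (\<beta> + \<gamma>)))"
        using 3 by (simp add: R_def powr_powr powr_divide)
      also have "P powr 1 / P powr (\<beta> / (\<beta> + \<gamma>)) = P powr (1 - \<beta> / (\<beta> + \<gamma>))"
        by (rule powr_diff[symmetric])
      also have "1 - \<beta> / (\<beta> + \<gamma>) = \<gamma> / (\<beta> + \<gamma>)" using bg by (simp add: field_simps)
      finally show ?thesis by (simp add: mult.commute)
    qed
    have down: "(2 powi j) powr (- \<gamma>) * Q \<le> 2 powr \<gamma> * (P powr (\<gamma> / (\<beta> + \<gamma>)) * Q powr (\<beta> / (\<beta> + \<gamma>)))"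
    proof -
      have "(2 powi j) powr (- \<gamma>) * Q \<le> (R / 2) powr (- \<gamma>) * Q"
        using j bg 3 R by (intro mult_right_mono powr_mono2') auto
      also have "(R / 2) powr (- \<gamma>) * Q = 2 powr \<gamma> * (P powr (\<gamma> / (\<beta> + \<gamma>)) * (Q powr 1 / Q powr (\<gamma> / (\<beta> + \<gamma>))))"
        using 3 R by (simp add: R_def powr_powr powr_divide powr_mult powr_minus_divide)
      also have "Q powr 1 / Q powr (\<gamma> / (\<beta> + \<gamma>)) = Q powr (1 - \<gamma> / (\<beta> + \<gamma>))"
        by (rule powr_diff[symmetric])
      also have "1 - \<gamma> / (\<beta> + \<gamma>) = \<beta> / (\<beta> + \<gamma>)" using bg by (simp add: field_simps)
      finally show ?thesis .
    qed
    show ?thesis using L[of j] up down by (simp add: algebra_simps)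
  qed
qed

section \<open>Pointwise bounds\<close>

text \<open>The exponents \<open>\<beta>\<close> and \<open>- \<gamma>\<close> are the weighted means, with weights \<open>s\<close> and \<open>1 - s\<close>, of the exponents
  of the scale in the bounds for the differences and for the averages. Positive \<open>\<beta>\<close> makes the sum over
  fine scales converge.\<close>

lemma pointwise_subcritical:
  assumes K: "K > 0" and ctrl: "controlled_averages K N \<alpha> p D V M W L"
    and s: "0 < s" "s \<le> 1" and \<beta>: "\<beta> = 1 - (1 - s) * N / 2" "\<beta> > 0"
    and \<gamma>: "\<gamma> = (\<alpha> + (1 - s) * N) / (2 * p)" "\<gamma> > 0"
  shows "\<bar>L\<bar> \<le> (K * (1 / (1 - 2 powr (- \<beta>)) + 1) * (1 + 2 powr \<gamma>)) *
     ((M powr s * sqrt D powr (1 - s)) powr (\<gamma> / (\<beta> + \<gamma>))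
      * ((W powr s * sqrt V powr (1 - s)) powr (1 / p)) powr (\<beta> / (\<beta> + \<gamma>)))"
proof -
  obtain A :: "int \<Rightarrow> real" where lim: "(\<lambda>k. A (- int k)) \<longlonglongrightarrow> L"
    and d1: "\<And>j. \<bar>A (j - 1) - A j\<bar> \<le> K * (2 powi j * M)"
    and d2: "\<And>j. \<bar>A (j - 1) - A j\<bar> \<le> K * ((2 powi j) powr (1 - N / 2) * sqrt D)"
    and a1: "\<And>j. \<bar>A j\<bar> \<le> K * ((2 powi j) powr (- (\<alpha> / 2)) * W) powr (1 / p)"
    and a2: "\<And>j. \<bar>A j\<bar> \<le> K * ((2 powi j) powr (- ((N + \<alpha>) / 2)) * sqrt V) powr (1 / p)"
    using ctrl unfolding controlled_averages_def by blast
  define P where "P = M powr s * sqrt D powr (1 - s)"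
  define Q where "Q = (W powr s * sqrt V powr (1 - s)) powr (1 / p)"
  define B where "B = 1 / (1 - 2 powr (- \<beta>))"
  have B: "B \<ge> 0" using two_powr_neg_less_1[OF \<beta>(2)] by (simp add: B_def)
  have PQ: "P \<ge> 0" "Q \<ge> 0" by (auto simp: P_def Q_def)
  have diff: "\<bar>A (j - 1) - A j\<bar> \<le> K * P * (2 powi j) powr \<beta>" for j
  proof -
    have "\<bar>A (j - 1) - A j\<bar> / K \<le> (2 powi j * M) powr s * ((2 powi j) powr (1 - N / 2) * sqrt D) powr (1 - s)"
      using d1[of j] d2[of j] K s by (intro le_weighted_geometric_mean) (auto simp: pos_divide_le_eq mult.commute)
    also have "\<dots> = ((2 powi j) powr s * ((2 powi j) powr (1 - N / 2)) powr (1 - s)) * P"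
      by (simp add: P_def powr_mult mult_ac)
    also have "(2 powi j) powr s * ((2 powi j) powr (1 - N / 2)) powr (1 - s) = (2 powi j) powr \<beta>"
      by (simp add: dyadic_powr powr_powr \<beta> algebra_simps flip: powr_add)
    finally show ?thesis using K by (simp add: pos_divide_le_eq mult_ac)
  qed
  have avg: "\<bar>A j\<bar> \<le> K * ((2 powi j) powr (- \<gamma>) * Q)" for j
  proof -
    have "\<bar>A j\<bar> / K \<le> (((2 powi j) powr (- (\<alpha> / 2)) * W) powr (1 / p)) powr s
        * (((2 powi j) powr (- ((N + \<alpha>) / 2)) * sqrt V) powr (1 / p)) powr (1 - s)"
      using a1[of j] a2[of j] K s by (intro le_weighted_geometric_mean) (auto simp: pos_divide_le_eq mult.commute)
    also have "\<dots> = (((2 powi j) powr (- (\<alpha> / 2))) powr (s / p) * ((2 powi j) powr (- ((N + \<alpha>) / 2))) powr ((1 - s) / p)) * Q"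
      by (simp add: Q_def powr_mult powr_powr mult_ac)
    also have "((2 powi j) powr (- (\<alpha> / 2))) powr (s / p) * ((2 powi j) powr (- ((N + \<alpha>) / 2))) powr ((1 - s) / p) = (2 powi j) powr (- \<gamma>)"
    proof -
      have "- (\<alpha> / 2) * (s / p) + - ((N + \<alpha>) / 2) * ((1 - s) / p) = - \<gamma>"
      proof -
        have "p \<noteq> 0" using \<gamma> by auto
        then show ?thesis unfolding \<gamma>(1) by (simp add: field_simps)
      qed
      then show ?thesis by (simp only: powr_powr powr_add[symmetric])
    qed
    finally show ?thesis using K by (simp add: pos_divide_le_eq mult_ac)
  qed
  have "\<bar>L\<bar> / (K * (B + 1)) \<le> (1 + 2 powr \<gamma>) * (P powr (\<gamma> / (\<beta> + \<gamma>)) * Q powr (\<beta> / (\<beta> + \<gamma>)))"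
  proof (rule dyadic_balance[OF \<beta>(2) \<gamma>(2) PQ])
    fix j
    have "\<bar>L\<bar> \<le> \<bar>A j\<bar> + K * P * ((2 powi j) powr \<beta> * B)"
    proof (rule telescoping_down[OF lim diff])
      fix n :: nat
      show "(\<Sum>i<n. K * P * (2 powi (j - int i)) powr \<beta>) \<le> K * P * ((2 powi j) powr \<beta> * B)"
        unfolding sum_distrib_left[symmetric] B_def
        using K PQ by (intro mult_left_mono dyadic_sum_down \<beta>) auto
    qed
    also have "\<dots> \<le> K * ((2 powi j) powr (- \<gamma>) * Q) + K * (B * ((2 powi j) powr \<beta> * P))"
      using avg[of j] by (simp add: mult_ac)
    also have "\<dots> \<le> K * (B + 1) * ((2 powi j) powr \<beta> * P + (2 powi j) powr (- \<gamma>) * Q)"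
      using K B PQ by (simp add: algebra_simps)
    finally show "\<bar>L\<bar> / (K * (B + 1)) \<le> (2 powi j) powr \<beta> * P + (2 powi j) powr (- \<gamma>) * Q"
      using K B by (simp add: pos_divide_le_eq mult_ac)
  qed
  moreover have pos: "0 < K * (B + 1)" using K B by simp
  ultimately have "\<bar>L\<bar> \<le> K * (B + 1) * (1 + 2 powr \<gamma>) * (P powr (\<gamma> / (\<beta> + \<gamma>)) * Q powr (\<beta> / (\<beta> + \<gamma>)))"
    by (simp only: pos_divide_le_eq[OF pos] mult_ac)
  then show ?thesis by (simp only: P_def Q_def B_def)
qed

text \<open>For \<open>N > 2\<close> the bound of the differences by \<open>D\<close> is also summable over the coarse scales, and the
  averages themselves tend to 0 there because the potential is finite at the point. So the value is
  bounded by \<open>M\<close> and \<open>D\<close> alone.\<close>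

lemma pointwise_critical:
  assumes K: "K > 0" and ctrl: "controlled_averages K N \<alpha> p D V M W L"
    and nn: "0 \<le> D" "0 \<le> M" and N: "N > 2" and \<alpha>: "\<alpha> > 0" and p: "p \<ge> 1"
  shows "\<bar>L\<bar> \<le> (K * (1 / (1 - 2 powr (- (N / 2 - 1))) + 2) * (1 + 2 powr (N / 2 - 1))) *
     (M powr (1 - 2 / N) * sqrt D powr (2 / N))"
proof -
  obtain A :: "int \<Rightarrow> real" where lim: "(\<lambda>k. A (- int k)) \<longlonglongrightarrow> L"
    and d1: "\<And>j. \<bar>A (j - 1) - A j\<bar> \<le> K * (2 powi j * M)"
    and d2: "\<And>j. \<bar>A (j - 1) - A j\<bar> \<le> K * ((2 powi j) powr (1 - N / 2) * sqrt D)"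
    and a1: "\<And>j. \<bar>A j\<bar> \<le> K * ((2 powi j) powr (- (\<alpha> / 2)) * W) powr (1 / p)"
    using ctrl unfolding controlled_averages_def by blast
  define \<kappa> where "\<kappa> = N / 2 - 1"
  define B where "B = 1 / (1 - 2 powr (- \<kappa>))"
  have \<kappa>: "\<kappa> > 0" using N by (simp add: \<kappa>_def)
  have B: "B \<ge> 0" using two_powr_neg_less_1[OF \<kappa>] by (simp add: B_def)
  \<comment> \<open>Sum the differences over all coarser scales.\<close>
  have low: "\<bar>A j\<bar> \<le> K * sqrt D * ((2 powi j) powr (- \<kappa>) * B)" for j
  proof -
    have "\<bar>A j\<bar> - K * sqrt D * ((2 powi j) powr (- \<kappa>) * B) \<le> K * ((2 powi (j + int n)) powr (- (\<alpha> / 2 / p)) * W powr (1 / p))" for n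
    proof -
      have "\<bar>A j\<bar> \<le> \<bar>A (j + int n)\<bar> + (\<Sum>i<n. K * sqrt D * (2 powi (j + 1 + int i)) powr (- \<kappa>))"
        by (rule telescoping_up) (use d2 in \<open>simp add: \<kappa>_def mult_ac\<close>)
      also have "(\<Sum>i<n. K * sqrt D * (2 powi (j + 1 + int i)) powr (- \<kappa>)) \<le> K * sqrt D * ((2 powi j) powr (- \<kappa>) * B)"
        unfolding sum_distrib_left[symmetric] B_def
        using K nn by (intro mult_left_mono dyadic_sum_up \<kappa>) auto
      finally have "\<bar>A j\<bar> \<le> \<bar>A (j + int n)\<bar> + K * sqrt D * ((2 powi j) powr (- \<kappa>) * B)" by simp
      moreover have "\<bar>A (j + int n)\<bar> \<le> K * ((2 powi (j + int n)) powr (- (\<alpha> / 2 / p)) * W powr (1 / p))"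
        using a1[of "j + int n"] by (simp add: powr_mult powr_powr)
      ultimately show ?thesis by linarith
    qed
    moreover have "(\<lambda>n. K * ((2 powi (j + int n)) powr (- (\<alpha> / 2 / p)) * W powr (1 / p))) \<longlonglongrightarrow> K * 0"
      by (intro tendsto_mult tendsto_const dyadic_decay) (use \<alpha> p in auto)
    ultimately have "\<bar>A j\<bar> - K * sqrt D * ((2 powi j) powr (- \<kappa>) * B) \<le> K * 0"
      by (intro LIMSEQ_le_const) auto
    then show ?thesis by simp
  qed
  have "\<bar>L\<bar> / (K * (B + 2)) \<le> (1 + 2 powr \<kappa>) * (M powr (\<kappa> / (1 + \<kappa>)) * sqrt D powr (1 / (1 + \<kappa>)))"
  proof (rule dyadic_balance[OF _ \<kappa> nn(2) real_sqrt_ge_zero[OF nn(1)]])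
    fix j
    have "\<bar>L\<bar> \<le> \<bar>A j\<bar> + K * M * ((2 powi j) powr 1 * (1 / (1 - 2 powr (- 1))))"
    proof (rule telescoping_down[OF lim, where c = "\<lambda>j. K * M * (2 powi j) powr 1"])
      show "\<bar>A (i - 1) - A i\<bar> \<le> K * M * (2 powi i) powr 1" for i using d1[of i] by (simp add: mult_ac)
      fix n :: nat
      show "(\<Sum>i<n. K * M * (2 powi (j - int i)) powr 1) \<le> K * M * ((2 powi j) powr 1 * (1 / (1 - 2 powr (- 1))))"
        unfolding sum_distrib_left[symmetric]
        using K nn by (intro mult_left_mono dyadic_sum_down) auto
    qed
    also have "\<dots> \<le> K * (B * ((2 powi j) powr (- \<kappa>) * sqrt D)) + K * (2 * ((2 powi j) powr 1 * M))"
      using low[of j] by (simp add: powr_minus mult_ac)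
    also have "\<dots> \<le> K * (B + 2) * ((2 powi j) powr 1 * M + (2 powi j) powr (- \<kappa>) * sqrt D)"
      using K B nn by (simp add: algebra_simps)
    finally show "\<bar>L\<bar> / (K * (B + 2)) \<le> (2 powi j) powr 1 * M + (2 powi j) powr (- \<kappa>) * sqrt D"
      using K B by (simp add: pos_divide_le_eq mult_ac)
  qed simp
  moreover have "\<kappa> / (1 + \<kappa>) = 1 - 2 / N" "1 / (1 + \<kappa>) = 2 / N"
    using N by (simp_all add: \<kappa>_def field_simps)
  moreover have pos: "0 < K * (B + 2)" using K B by simp
  ultimately have "\<bar>L\<bar> \<le> K * (B + 2) * (1 + 2 powr \<kappa>) * (M powr (1 - 2 / N) * sqrt D powr (2 / N))"
    by (simp only: pos_divide_le_eq[OF pos] mult_ac)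
  then show ?thesis by (simp only: B_def \<kappa>_def)
qed

section \<open>Interpolation inequalities\<close>

text \<open>After division of the squares by \<open>a\<close> and \<open>b\<close>, Hoelder's inequality follows from
  \<open>x powr t * y powr (1 - t) \<le> x + y\<close>, which costs the factor 2.\<close>

lemma nn_integral_interpolate:
  fixes M W :: "'a::euclidean_space \<Rightarrow> real"
  assumes [measurable]: "M \<in> borel_measurable borel" "W \<in> borel_measurable borel"
    and nn: "\<And>x. 0 \<le> M x" "\<And>x. 0 \<le> W x" "0 \<le> a" "0 \<le> b" and t: "0 < t" "t < 1"
    and M: "(\<integral>\<^sup>+ x. ennreal ((M x)\<^sup>2) \<partial>lborel) \<le> ennreal a"
    and W: "(\<integral>\<^sup>+ x. ennreal ((W x)\<^sup>2) \<partial>lborel) \<le> ennreal b"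
  shows "(\<integral>\<^sup>+ x. ennreal (M x powr (2 * t) * W x powr (2 * (1 - t))) \<partial>lborel) \<le> ennreal (2 * (a powr t * b powr (1 - t)))"
proof -
  have zero: "AE x in lborel. f x = 0" if "(\<integral>\<^sup>+ x. ennreal ((f x)\<^sup>2) \<partial>lborel) \<le> ennreal 0" "f \<in> borel_measurable borel"
    for f :: "'a \<Rightarrow> real"
  proof -
    have "AE x in lborel. ennreal ((f x)\<^sup>2) = 0"
      using that by (subst nn_integral_0_iff_AE[symmetric]) auto
    then show ?thesis by eventually_elim (simp add: ennreal_eq_0_iff)
  qed
  show ?thesis
  proof (cases "a = 0 \<or> b = 0")
    case True
    then have "AE x in lborel. M x = 0 \<or> W x = 0"
      using zero[of M] zero[of W] M W by (auto elim: eventually_mono)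
    then have "AE x in lborel. ennreal (M x powr (2 * t) * W x powr (2 * (1 - t))) = 0"
      by eventually_elim auto
    then have "(\<integral>\<^sup>+ x. ennreal (M x powr (2 * t) * W x powr (2 * (1 - t))) \<partial>lborel) = 0"
      by (subst nn_integral_0_iff_AE) auto
    then show ?thesis by simp
  next
    case False
    then have ab: "a > 0" "b > 0" using nn by auto
    let ?c = "a powr t * b powr (1 - t)"
    have "M x powr (2 * t) * W x powr (2 * (1 - t)) \<le> ?c * (1 / a * (M x)\<^sup>2 + 1 / b * (W x)\<^sup>2)" for x
    proof -
      have sq: "((y::real)\<^sup>2) powr e = y powr (2 * e)" if "y \<ge> 0" for y e
        using that by (cases "y = 0") (simp_all add: powr_powr flip: powr_numeral)
      have "M x powr (2 * t) * W x powr (2 * (1 - t)) = ?c * (((M x)\<^sup>2 / a) powr t * ((W x)\<^sup>2 / b) powr (1 - t))"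
        using ab nn by (simp add: powr_divide sq)
      also have "\<dots> \<le> ?c * ((M x)\<^sup>2 / a + (W x)\<^sup>2 / b)"
        using ab t by (intro mult_left_mono weighted_geometric_mean_le_sum) auto
      finally show ?thesis by simp
    qed
    then have "(\<integral>\<^sup>+ x. ennreal (M x powr (2 * t) * W x powr (2 * (1 - t))) \<partial>lborel)
      \<le> (\<integral>\<^sup>+ x. ennreal ?c * (ennreal (1 / a) * ennreal ((M x)\<^sup>2) + ennreal (1 / b) * ennreal ((W x)\<^sup>2)) \<partial>lborel)"
      using ab by (intro nn_integral_mono) (auto simp: ennreal_mult[symmetric] ennreal_plus[symmetric] simp del: ennreal_plus intro!: ennreal_leI)
    also have "\<dots> = ennreal ?c * (ennreal (1 / a) * (\<integral>\<^sup>+ x. ennreal ((M x)\<^sup>2) \<partial>lborel) + ennreal (1 / b) * (\<integral>\<^sup>+ x. ennreal ((W x)\<^sup>2) \<partial>lborel))"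
      by (simp add: nn_integral_cmult nn_integral_add)
    also have "\<dots> \<le> ennreal ?c * (ennreal (1 / a) * ennreal a + ennreal (1 / b) * ennreal b)"
      by (intro mult_left_mono add_mono M W) auto
    also have "\<dots> = ennreal (2 * ?c)"
    proof -
      have "ennreal (1 / a) * ennreal a = 1" "ennreal (1 / b) * ennreal b = 1"
        using ab by (simp_all add: ennreal_mult[symmetric])
      then show ?thesis by (simp add: ennreal_mult mult.commute)
    qed
    finally show ?thesis .
  qed
qed

text \<open>The factor \<open>\<theta> + (1 - \<theta>) / p = 2 * T\<close> is the degree of \<open>P powr \<theta> * Q powr (1 - \<theta>)\<close> in \<open>(M, W)\<close> for
  \<open>s = 1\<close>, so \<open>s = 1 / (q * T)\<close> is the choice for which its power \<open>q\<close> has degree 2. The scaling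
  relation reads \<open>1 / q = T - (2 * p * \<theta> - (1 - \<theta>) * \<alpha>) / (2 * N * p)\<close>, so \<open>s \<le> 1\<close> is the lower
  bound for \<open>\<theta>\<close>. That the balanced exponent \<open>\<gamma> / (\<beta> + \<gamma>)\<close> is \<open>\<theta>\<close> again is forced by scaling.\<close>

lemma exponent_relations:
  fixes \<alpha> p q N \<theta> :: real
  assumes a: "0 < \<alpha>" and N: "1 \<le> N" and p: "1 \<le> p" and q: "1 \<le> q" and \<theta>: "0 < \<theta>" "\<theta> < 1"
    and low: "\<alpha> / (2 * p + \<alpha>) \<le> \<theta>"
    and scal: "1 / q = \<theta> * (1 / 2 - 1 / N) + (1 - \<theta>) * ((N + \<alpha>) / (2 * N * p))"
  defines "T \<equiv> (\<theta> + (1 - \<theta>) / p) / 2"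
  defines "s \<equiv> 1 / (q * T)"
  defines "\<beta> \<equiv> 1 - (1 - s) * N / 2" and "\<gamma> \<equiv> (\<alpha> + (1 - s) * N) / (2 * p)"
  shows "0 < s" "s \<le> 1" "0 < \<beta>" "0 < \<gamma>" "\<gamma> / (\<beta> + \<gamma>) = \<theta>" "\<beta> / (\<beta> + \<gamma>) = 1 - \<theta>"
    "1 - q * s * \<theta> / 2 = q * s * (1 - \<theta>) / (2 * p)"
proof -
  have T: "T > 0" unfolding T_def using \<theta> p by (intro divide_pos_pos add_pos_nonneg) auto
  show s0: "0 < s" using T q by (simp add: s_def)
  have sT: "s * T = 1 / q" using T q by (simp add: s_def)
  have scal': "1 / q = T - (2 * p * \<theta> - (1 - \<theta>) * \<alpha>) / (2 * N * p)"
    unfolding scal T_def using N p by (simp add: field_simps)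
  have "\<alpha> \<le> \<theta> * (2 * p + \<alpha>)" using low a p by (simp add: pos_divide_le_eq)
  then have "0 \<le> 2 * p * \<theta> - (1 - \<theta>) * \<alpha>" by (simp add: algebra_simps)
  then have "1 / q \<le> T" using scal' N p by simp
  then have "s * T \<le> 1 * T" using sT by simp
  then show s1: "s \<le> 1" using T by (simp only: mult_le_cancel_right_pos)
  show g: "0 < \<gamma>" unfolding \<gamma>_def using a s1 N p by (intro divide_pos_pos add_pos_nonneg) auto
  have key: "(1 - s) * T = (2 * p * \<theta> - (1 - \<theta>) * \<alpha>) / (2 * N * p)"
    using sT scal' by (simp add: algebra_simps)
  then have "(1 - s) * N * (2 * p * T) = 2 * p * \<theta> - (1 - \<theta>) * \<alpha>"
    using N p by (simp add: field_simps)
  moreover have "2 * p * T = p * \<theta> + (1 - \<theta>)" using p by (simp add: T_def field_simps)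
  ultimately have rel: "(1 - s) * N * (p * \<theta> + (1 - \<theta>)) = 2 * p * \<theta> - (1 - \<theta>) * \<alpha>" by simp
  define d where "d = (1 - s) * N"
  have bal: "(1 - \<theta>) * \<gamma> = \<theta> * \<beta>"
  proof -
    have "(1 - \<theta>) * (\<alpha> + d) = 2 * p * (\<theta> * (1 - d / 2))"
      using rel[folded d_def] by (simp add: algebra_simps)
    then have "(1 - \<theta>) * (\<alpha> + d) / (2 * p) = \<theta> * (1 - d / 2)" using p by simp
    moreover have "\<beta> = 1 - d / 2" "\<gamma> = (\<alpha> + d) / (2 * p)" by (simp_all add: \<beta>_def \<gamma>_def d_def)
    ultimately show ?thesis by (metis times_divide_eq_right)
  qed
  then have "\<beta> = (1 - \<theta>) * \<gamma> / \<theta>" using \<theta> by (simp add: field_simps)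
  then show "0 < \<beta>" using g \<theta> by simp
  have bg: "\<theta> * (\<beta> + \<gamma>) = \<gamma>" using bal by (simp add: algebra_simps)
  then have "\<beta> + \<gamma> > 0" using g \<theta> \<open>0 < \<beta>\<close> by simp
  then show r: "\<gamma> / (\<beta> + \<gamma>) = \<theta>" using bg by (simp add: field_simps)
  have "\<beta> / (\<beta> + \<gamma>) = 1 - \<gamma> / (\<beta> + \<gamma>)" using \<open>\<beta> + \<gamma> > 0\<close> by (simp add: field_simps)
  then show "\<beta> / (\<beta> + \<gamma>) = 1 - \<theta>" using r by simp
  have "q * s * T = 1" using sT q by (simp add: field_simps)
  then have "q * s * (\<theta> + (1 - \<theta>) / p) = 2" by (simp add: T_def)
  then show "1 - q * s * \<theta> / 2 = q * s * (1 - \<theta>) / (2 * p)" using p by (simp add: field_simps)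
qed

text \<open>In the pointwise bound for \<open>\<bar>u\<bar> powr q\<close> the exponents of \<open>M\<close> and \<open>W\<close> are \<open>2 * x\<close> and \<open>2 * (1 - x)\<close>, so
  Hoelder's inequality applies; the powers of \<open>D\<close> and \<open>V\<close> that it returns complete those with exponents
  proportional to \<open>1 - s\<close> in the pointwise bound.\<close>

theorem gagliardo_nirenberg_subcritical:
  fixes \<alpha> p q \<theta> :: real
  assumes a: "0 < \<alpha>" "\<alpha> < real CARD('n::finite)" and p: "1 \<le> p" and q: "1 \<le> q" and \<theta>: "0 < \<theta>" "\<theta> < 1"
    and low: "\<alpha> / (2 * p + \<alpha>) \<le> \<theta>"
    and scal: "1 / q = \<theta> * (1 / 2 - 1 / real CARD('n)) + (1 - \<theta>) * ((real CARD('n) + \<alpha>) / (2 * real CARD('n) * p))"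
  obtains C where "C > 0" "\<And>u :: real ^ 'n \<Rightarrow> real. u \<in> coulomb_sobolev \<alpha> p \<Longrightarrow>
    (\<integral>\<^sup>+ x. ennreal (\<bar>u x\<bar> powr q) \<partial>lborel)
      \<le> ennreal (C * (dirichlet_energy u powr (q * \<theta> / 2) * coulomb_energy \<alpha> p u powr (q * (1 - \<theta>) / (2 * p))))"
proof -
  let ?N = "real CARD('n)"
  have N: "1 \<le> ?N" by (simp add: Suc_leI)
  define s where "s = 1 / (q * ((\<theta> + (1 - \<theta>) / p) / 2))"
  define \<beta> where "\<beta> = 1 - (1 - s) * ?N / 2"
  define \<gamma> where "\<gamma> = (\<alpha> + (1 - s) * ?N) / (2 * p)"
  note ex = exponent_relations[OF a(1) N p q \<theta> low scal, folded s_def, folded \<beta>_def \<gamma>_def]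
  define x where "x = q * s * \<theta> / 2"
  have x: "0 < x" "1 - x = q * s * (1 - \<theta>) / (2 * p)" unfolding x_def using ex q \<theta> by auto
  have "0 < q * s * (1 - \<theta>) / (2 * p)" using ex q \<theta> p by simp
  then have x1: "x < 1" using x by linarith
  obtain K where K: "K > 0" and data: "\<And>u :: real ^ 'n \<Rightarrow> real. u \<in> coulomb_sobolev \<alpha> p \<Longrightarrow>
      \<exists>M W. M \<in> borel_measurable borel \<and> W \<in> borel_measurable borel \<and> (\<forall>x. 0 \<le> M x \<and> 0 \<le> W x) \<and>
        (\<integral>\<^sup>+ x. ennreal ((M x)\<^sup>2) \<partial>lborel) \<le> ennreal (K * dirichlet_energy u) \<and>
        (\<integral>\<^sup>+ x. ennreal ((W x)\<^sup>2) \<partial>lborel) \<le> ennreal (coulomb_energy \<alpha> p u) \<and>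
        (AE x in lborel. controlled_averages K ?N \<alpha> p
           (dirichlet_energy u) (coulomb_energy \<alpha> p u) (M x) (W x) (u x))"
    using pointwise_averages[OF a p] by blast
  define C0 where "C0 = K * (1 / (1 - 2 powr (- \<beta>)) + 1) * (1 + 2 powr \<gamma>)"
  have C0: "C0 > 0"
  proof -
    have "1 / (1 - 2 powr (- \<beta>)) \<ge> 0" using two_powr_neg_less_1[OF ex(3)] by simp
    moreover have "1 + 2 powr \<gamma> > 0" by (simp add: add_pos_pos)
    ultimately show ?thesis using K unfolding C0_def by (intro mult_pos_pos add_nonneg_pos) simp_all
  qed
  show ?thesis
  proof (rule that[of "C0 powr q * 2 * K powr x"])
    show "0 < C0 powr q * 2 * K powr x" using C0 K by simp
  next
    fix u :: "real ^ 'n \<Rightarrow> real" assume u: "u \<in> coulomb_sobolev \<alpha> p"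
    define D where "D = dirichlet_energy u"
    define V where "V = coulomb_energy \<alpha> p u"
    have DV: "D \<ge> 0" "V \<ge> 0" by (auto simp: D_def V_def dirichlet_energy_def coulomb_energy_def)
    obtain M W where [measurable]: "M \<in> borel_measurable borel" "W \<in> borel_measurable borel"
      and nn: "\<And>x. 0 \<le> M x" "\<And>x. 0 \<le> W x"
      and M2: "(\<integral>\<^sup>+ x. ennreal ((M x)\<^sup>2) \<partial>lborel) \<le> ennreal (K * D)"
      and W2: "(\<integral>\<^sup>+ x. ennreal ((W x)\<^sup>2) \<partial>lborel) \<le> ennreal V"
      and ae: "AE x in lborel. controlled_averages K ?N \<alpha> p D V (M x) (W x) (u x)"
      using data[OF u] unfolding D_def V_def by blast
    define E where "E = C0 powr q * (D powr ((1 - s) * \<theta> * q / 2) * V powr ((1 - s) * (1 - \<theta>) * q / (2 * p)))"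
    have E: "E \<ge> 0" by (simp add: E_def)
    have sq: "sqrt y = y powr (1/2)" if "y \<ge> 0" for y :: real using that by (simp add: powr_half_sqrt)
    have "AE x in lborel. \<bar>u x\<bar> powr q \<le> E * (M x powr (2 * x') * W x powr (2 * (1 - x')))" if x': "x' = x" for x'
      using ae
    proof eventually_elim
      case (elim z)
      have "\<bar>u z\<bar> \<le> C0 * ((M z powr s * sqrt D powr (1 - s)) powr (\<gamma> / (\<beta> + \<gamma>))
          * ((W z powr s * sqrt V powr (1 - s)) powr (1 / p)) powr (\<beta> / (\<beta> + \<gamma>)))"
        unfolding C0_def
        by (rule pointwise_subcritical[OF K elim ex(1,2) \<beta>_def ex(3) \<gamma>_def ex(4)])
      then have "\<bar>u z\<bar> powr q \<le> (C0 * ((M z powr s * sqrt D powr (1 - s)) powr \<theta>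
          * ((W z powr s * sqrt V powr (1 - s)) powr (1 / p)) powr (1 - \<theta>))) powr q"
        using q by (intro powr_mono2) (auto simp: ex)
      also have "\<dots> = C0 powr q * (D powr (1 / 2 * (1 - s) * \<theta> * q) * V powr (1 / 2 * (1 - s) * (1 / p) * (1 - \<theta>) * q))
          * (M z powr (s * \<theta> * q) * W z powr (s * (1 / p) * (1 - \<theta>) * q))"
        by (simp only: powr_mult powr_powr sq[OF DV(1)] sq[OF DV(2)] mult_ac)
      also have "s * \<theta> * q = 2 * x'" unfolding x' x_def by simp
      also have "s * (1 / p) * (1 - \<theta>) * q = 2 * (1 - x')" unfolding x' x(2) using p by (simp add: field_simps)
      also have "1 / 2 * (1 - s) * \<theta> * q = (1 - s) * \<theta> * q / 2" by simp
      also have "1 / 2 * (1 - s) * (1 / p) * (1 - \<theta>) * q = (1 - s) * (1 - \<theta>) * q / (2 * p)" by simp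
      finally show ?case by (simp add: E_def mult_ac)
    qed
    then have "(\<integral>\<^sup>+ z. ennreal (\<bar>u z\<bar> powr q) \<partial>lborel) \<le> (\<integral>\<^sup>+ z. ennreal E * ennreal (M z powr (2 * x) * W z powr (2 * (1 - x))) \<partial>lborel)"
      using E by (intro nn_integral_mono_AE) (auto simp: ennreal_mult[symmetric] ennreal_leI elim!: eventually_mono)
    also have "\<dots> = ennreal E * (\<integral>\<^sup>+ z. ennreal (M z powr (2 * x) * W z powr (2 * (1 - x))) \<partial>lborel)"
      by (rule nn_integral_cmult) measurable
    also have "\<dots> \<le> ennreal E * ennreal (2 * ((K * D) powr x * V powr (1 - x)))"
      using K DV by (intro mult_left_mono nn_integral_interpolate M2 W2 nn x x1) auto
    also have "\<dots> = ennreal (E * (2 * ((K * D) powr x * V powr (1 - x))))"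
      using E by (simp add: ennreal_mult)
    also have "E * (2 * ((K * D) powr x * V powr (1 - x))) = C0 powr q * 2 * K powr x *
        ((D powr ((1 - s) * \<theta> * q / 2) * D powr x) * (V powr ((1 - s) * (1 - \<theta>) * q / (2 * p)) * V powr (1 - x)))"
      by (simp add: E_def powr_mult mult_ac)
    also have "D powr ((1 - s) * \<theta> * q / 2) * D powr x = D powr (q * \<theta> / 2)"
    proof -
      have "(1 - s) * \<theta> * q / 2 + x = q * \<theta> / 2" by (simp add: x_def field_simps)
      then show ?thesis by (simp only: powr_add[symmetric])
    qed
    also have "V powr ((1 - s) * (1 - \<theta>) * q / (2 * p)) * V powr (1 - x) = V powr (q * (1 - \<theta>) / (2 * p))"
    proof -
      have "(1 - s) * (1 - \<theta>) * q / (2 * p) + (1 - x) = q * (1 - \<theta>) / (2 * p)"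
        unfolding x(2) add_divide_distrib[symmetric] by (simp add: algebra_simps)
      then show ?thesis by (simp only: powr_add[symmetric])
    qed
    finally show "(\<integral>\<^sup>+ z. ennreal (\<bar>u z\<bar> powr q) \<partial>lborel) \<le> ennreal (C0 powr q * 2 * K powr x *
       (dirichlet_energy u powr (q * \<theta> / 2) * coulomb_energy \<alpha> p u powr (q * (1 - \<theta>) / (2 * p))))"
      by (simp add: D_def V_def)
  qed
qed

text \<open>Sobolev's inequality. Finite Coulomb energy excludes functions that do not vanish at infinity, such
  as nonzero constants.\<close>

theorem sobolev_critical:
  fixes \<alpha> p :: real
  assumes a: "0 < \<alpha>" "\<alpha> < real CARD('n::finite)" and p: "1 \<le> p" and N: "2 < real CARD('n)"
  obtains C where "C > 0" "\<And>u :: real ^ 'n \<Rightarrow> real. u \<in> coulomb_sobolev \<alpha> p \<Longrightarrow>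
    (\<integral>\<^sup>+ x. ennreal (\<bar>u x\<bar> powr (2 * real CARD('n) / (real CARD('n) - 2))) \<partial>lborel)
      \<le> ennreal (C * dirichlet_energy u powr (real CARD('n) / (real CARD('n) - 2)))"
proof -
  let ?N = "real CARD('n)"
  let ?q = "2 * ?N / (?N - 2)"
  have q: "?q \<ge> 0" using N by simp
  obtain K where K: "K > 0" and data: "\<And>u :: real ^ 'n \<Rightarrow> real. u \<in> coulomb_sobolev \<alpha> p \<Longrightarrow>
      \<exists>M W. M \<in> borel_measurable borel \<and> W \<in> borel_measurable borel \<and> (\<forall>x. 0 \<le> M x \<and> 0 \<le> W x) \<and>
        (\<integral>\<^sup>+ x. ennreal ((M x)\<^sup>2) \<partial>lborel) \<le> ennreal (K * dirichlet_energy u) \<and>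
        (\<integral>\<^sup>+ x. ennreal ((W x)\<^sup>2) \<partial>lborel) \<le> ennreal (coulomb_energy \<alpha> p u) \<and>
        (AE x in lborel. controlled_averages K ?N \<alpha> p
           (dirichlet_energy u) (coulomb_energy \<alpha> p u) (M x) (W x) (u x))"
    using pointwise_averages[OF a p] by blast
  define C0 where "C0 = K * (1 / (1 - 2 powr (- (?N / 2 - 1))) + 2) * (1 + 2 powr (?N / 2 - 1))"
  have C0: "C0 > 0"
  proof -
    have "1 / (1 - 2 powr (- (?N / 2 - 1))) \<ge> 0" using two_powr_neg_less_1[of "?N / 2 - 1"] N by simp
    moreover have "1 + 2 powr (?N / 2 - 1) > 0" by (simp add: add_pos_pos)
    ultimately show ?thesis using K unfolding C0_def by (intro mult_pos_pos add_nonneg_pos) simp_all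
  qed
  show ?thesis
  proof (rule that[of "C0 powr ?q * K"])
    show "0 < C0 powr ?q * K" using C0 K by simp
  next
    fix u :: "real ^ 'n \<Rightarrow> real" assume u: "u \<in> coulomb_sobolev \<alpha> p"
    define D where "D = dirichlet_energy u"
    have D: "D \<ge> 0" by (auto simp: D_def dirichlet_energy_def)
    obtain M W where [measurable]: "M \<in> borel_measurable borel"
      and nn: "\<And>x. 0 \<le> M x"
      and M2: "(\<integral>\<^sup>+ x. ennreal ((M x)\<^sup>2) \<partial>lborel) \<le> ennreal (K * D)"
      and ae: "AE x in lborel. controlled_averages K ?N \<alpha> p D (coulomb_energy \<alpha> p u) (M x) (W x) (u x)"
      using data[OF u] unfolding D_def by blast
    define E where "E = C0 powr ?q * D powr (2 / (?N - 2))"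
    have E: "E \<ge> 0" by (simp add: E_def)
    have "AE x in lborel. \<bar>u x\<bar> powr ?q \<le> E * (M x)\<^sup>2"
      using ae
    proof eventually_elim
      case (elim z)
      have "\<bar>u z\<bar> \<le> C0 * (M z powr (1 - 2 / ?N) * sqrt D powr (2 / ?N))"
        unfolding C0_def
        by (rule pointwise_critical[OF K elim D nn(1) N a(1) p])
      then have "\<bar>u z\<bar> powr ?q \<le> (C0 * (M z powr (1 - 2 / ?N) * sqrt D powr (2 / ?N))) powr ?q"
        using q by (intro powr_mono2) auto
      also have "\<dots> = C0 powr ?q * (M z powr ((1 - 2 / ?N) * ?q) * D powr ((1 / 2) * (2 / ?N) * ?q))"
        using D by (simp only: powr_mult powr_powr powr_half_sqrt[symmetric] mult_ac)
      also have "(1 - 2 / ?N) * ?q = 2" using N by (simp add: field_simps)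
      also have "(1 / 2) * (2 / ?N) * ?q = 2 / (?N - 2)" using N by (simp add: field_simps)
      also have "M z powr 2 = (M z)\<^sup>2" using nn by simp
      finally show ?case by (simp add: E_def mult_ac)
    qed
    then have "(\<integral>\<^sup>+ z. ennreal (\<bar>u z\<bar> powr ?q) \<partial>lborel) \<le> (\<integral>\<^sup>+ z. ennreal E * ennreal ((M z)\<^sup>2) \<partial>lborel)"
      using E by (intro nn_integral_mono_AE) (auto simp: ennreal_mult[symmetric] ennreal_leI elim!: eventually_mono)
    also have "\<dots> = ennreal E * (\<integral>\<^sup>+ z. ennreal ((M z)\<^sup>2) \<partial>lborel)"
      by (rule nn_integral_cmult) measurable
    also have "\<dots> \<le> ennreal E * ennreal (K * D)"
      by (intro mult_left_mono M2) auto
    also have "\<dots> = ennreal (E * (K * D))"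
      using E D K by (simp add: ennreal_mult)
    also have "E * (K * D) = C0 powr ?q * K * (D powr (2 / (?N - 2)) * D powr 1)"
      using D by (simp add: E_def mult_ac)
    also have "D powr (2 / (?N - 2)) * D powr 1 = D powr (2 / (?N - 2) + 1)" by (rule powr_add[symmetric])
    also have "2 / (?N - 2) + 1 = ?N / (?N - 2)" using N by (simp add: field_simps)
    finally show "(\<integral>\<^sup>+ z. ennreal (\<bar>u z\<bar> powr ?q) \<partial>lborel)
        \<le> ennreal (C0 powr ?q * K * dirichlet_energy u powr (?N / (?N - 2)))"
      by (simp add: D_def)
  qed
qed

lemma integral_le_of_nn_integral_le:
  fixes u :: "'a::euclidean_space \<Rightarrow> real"
  assumes [measurable]: "u \<in> borel_measurable lebesgue"
    and le: "(\<integral>\<^sup>+ x. ennreal (\<bar>u x\<bar> powr q) \<partial>lborel) \<le> ennreal X" and X: "0 \<le> X"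
  shows "integrable lebesgue (\<lambda>x. \<bar>u x\<bar> powr q)" "(LINT x|lebesgue. \<bar>u x\<bar> powr q) \<le> X"
proof -
  have le': "(\<integral>\<^sup>+ x. ennreal (\<bar>u x\<bar> powr q) \<partial>lebesgue) \<le> ennreal X"
    using le by (simp only: nn_integral_completion)
  show int: "integrable lebesgue (\<lambda>x. \<bar>u x\<bar> powr q)"
    by (rule integrableI_nonneg) (use le' in \<open>auto intro: le_less_trans\<close>)
  have "ennreal (LINT x|lebesgue. \<bar>u x\<bar> powr q) \<le> ennreal X"
    using nn_integral_eq_integral[OF int] le' by simp
  then show "(LINT x|lebesgue. \<bar>u x\<bar> powr q) \<le> X" using X by simp
qed

text \<open>The smallest admissible \<open>\<theta>\<close> corresponds to the bound for \<open>1 / q\<close> in \<open>(Q)\<close> that depends on \<open>\<alpha>\<close>.\<close>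

lemma endpoint_exponent:
  fixes \<alpha> p N :: real
  assumes "0 < \<alpha>" "1 \<le> N" "1 \<le> p"
  defines "\<theta> \<equiv> \<alpha> / (2 * p + \<alpha>)"
  shows "0 < \<theta>" "\<theta> < 1"
    "\<theta> * (1 / 2 - 1 / N) + (1 - \<theta>) * ((N + \<alpha>) / (2 * N * p)) = 1 / 2 - (p - 1) / (\<alpha> + 2 * p)"
proof -
  have s: "2 * p + \<alpha> > 0" using assms by simp
  show "0 < \<theta>" "\<theta> < 1" using assms s by (auto simp: \<theta>_def pos_divide_less_eq)
  have "1 - \<theta> = 2 * p / (2 * p + \<alpha>)" using s by (simp add: \<theta>_def field_simps)
  then have "(1 - \<theta>) * ((N + \<alpha>) / (2 * N * p)) = (N + \<alpha>) / N / (2 * p + \<alpha>)"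
    using assms s by (simp add: divide_simps)
  moreover have "\<theta> * (1 / 2 - 1 / N) = \<alpha> * (1 / 2 - 1 / N) / (2 * p + \<alpha>)" by (simp add: \<theta>_def)
  ultimately have "\<theta> * (1 / 2 - 1 / N) + (1 - \<theta>) * ((N + \<alpha>) / (2 * N * p))
      = (\<alpha> * (1 / 2 - 1 / N) + (N + \<alpha>) / N) / (2 * p + \<alpha>)"
    by (simp only: add_divide_distrib)
  also have "\<alpha> * (1 / 2 - 1 / N) + (N + \<alpha>) / N = \<alpha> / 2 + 1" using assms by (simp add: field_simps)
  also have "(\<alpha> / 2 + 1) / (2 * p + \<alpha>) = 1 / 2 - (p - 1) / (\<alpha> + 2 * p)" using s by (simp add: field_simps)
  finally show "\<theta> * (1 / 2 - 1 / N) + (1 - \<theta>) * ((N + \<alpha>) / (2 * N * p)) = 1 / 2 - (p - 1) / (\<alpha> + 2 * p)" .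
qed

text \<open>As \<open>0 powr 0 = 0\<close>, the interpolation inequality for \<open>\<theta> = 1\<close> asserts that the function vanishes if
  its Coulomb energy does. This follows from the inequality at the endpoint, where \<open>\<theta> < 1\<close>.\<close>

lemma zero_energy_imp_zero:
  fixes u :: "real ^ 'n \<Rightarrow> real"
  assumes a: "0 < \<alpha>" "\<alpha> < real CARD('n)" and p: "1 \<le> p"
    and u: "u \<in> coulomb_sobolev \<alpha> p" and V: "coulomb_energy \<alpha> p u = 0"
  shows "AE x in lebesgue. u x = 0"
proof -
  let ?N = "real CARD('n)"
  have N: "1 \<le> ?N" by (simp add: Suc_leI)
  let ?t = "\<alpha> / (2 * p + \<alpha>)"
  note E = endpoint_exponent[OF a(1) N p]
  define q where "q = 2 * (2 * p + \<alpha>) / (2 + \<alpha>)"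
  have "1 * (2 + \<alpha>) \<le> 2 * (2 * p + \<alpha>)" using a p by simp
  then have q: "1 \<le> q" using a by (simp add: q_def pos_le_divide_eq)
  have "1 / q = 1 / 2 - (p - 1) / (\<alpha> + 2 * p)" using a p by (simp add: q_def field_simps)
  then have "1 / q = ?t * (1 / 2 - 1 / ?N) + (1 - ?t) * ((?N + \<alpha>) / (2 * ?N * p))" using E(3) by simp
  from gagliardo_nirenberg_subcritical[OF a p q E(1,2) order_refl this]
  obtain C where "(\<integral>\<^sup>+ x. ennreal (\<bar>u x\<bar> powr q) \<partial>lborel)
      \<le> ennreal (C * (dirichlet_energy u powr (q * ?t / 2) * coulomb_energy \<alpha> p u powr (q * (1 - ?t) / (2 * p))))"
    using u by metis
  then have z: "(\<integral>\<^sup>+ x. ennreal (\<bar>u x\<bar> powr q) \<partial>lebesgue) = 0"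
    using V by (simp add: nn_integral_completion)
  have [measurable]: "u \<in> borel_measurable lebesgue" using u by (simp add: coulomb_sobolev_def)
  have "AE x in lebesgue. ennreal (\<bar>u x\<bar> powr q) = 0"
    using z by (subst nn_integral_0_iff_AE[symmetric]) auto
  then show ?thesis by eventually_elim (auto simp: ennreal_eq_0_iff)
qed

theorem interpolation_inequality:
  fixes \<alpha> p q \<theta> :: real
  assumes a: "0 < \<alpha>" "\<alpha> < real CARD('n::finite)" and p: "1 \<le> p" and q: "1 \<le> q"
    and \<theta>: "\<alpha> / (2 * p + \<alpha>) \<le> \<theta>" "\<theta> \<le> 1"
    and scal: "1 / q = \<theta> * (1 / 2 - 1 / real CARD('n)) + (1 - \<theta>) * ((real CARD('n) + \<alpha>) / (2 * real CARD('n) * p))"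
  shows "\<exists>S>0. \<forall>u \<in> (coulomb_sobolev \<alpha> p :: (real ^ 'n \<Rightarrow> real) set).
    integrable lebesgue (\<lambda>x. \<bar>u x\<bar> powr q) \<and>
    S * (LINT x|lebesgue. \<bar>u x\<bar> powr q) powr (1 / q)
      \<le> dirichlet_energy u powr (\<theta> / 2) * coulomb_energy \<alpha> p u powr ((1 - \<theta>) / (2 * p))"
proof -
  let ?N = "real CARD('n)"
  have N: "1 \<le> ?N" by (simp add: Suc_leI)
  have root: "(C powr (- (1 / q))) * (LINT x|lebesgue. \<bar>u x\<bar> powr q) powr (1 / q) \<le> Y powr (1 / q)"
    if "(LINT x|lebesgue. \<bar>u x\<bar> powr q) \<le> C * Y" "C > 0" "Y \<ge> 0" for u :: "real ^ 'n \<Rightarrow> real" and C Y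
  proof -
    have "(LINT x|lebesgue. \<bar>u x\<bar> powr q) powr (1 / q) \<le> (C * Y) powr (1 / q)"
      using that q by (intro powr_mono2) auto
    then have "(C powr (- (1 / q))) * (LINT x|lebesgue. \<bar>u x\<bar> powr q) powr (1 / q)
        \<le> (C powr (- (1 / q))) * (C * Y) powr (1 / q)" by (intro mult_left_mono) auto
    also have "\<dots> = Y powr (1 / q)" using that by (simp add: powr_mult powr_minus)
    finally show ?thesis .
  qed
  show ?thesis
  proof (cases "\<theta> = 1")
    case False
    then have "\<theta> < 1" "0 < \<theta>" using \<theta> endpoint_exponent(1)[OF a(1) N p] by auto
    from gagliardo_nirenberg_subcritical[OF a p q this(2,1) \<theta>(1) scal]
    obtain C where C: "C > 0" and main: "\<And>u :: real ^ 'n \<Rightarrow> real. u \<in> coulomb_sobolev \<alpha> p \<Longrightarrow>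
      (\<integral>\<^sup>+ x. ennreal (\<bar>u x\<bar> powr q) \<partial>lborel)
      \<le> ennreal (C * (dirichlet_energy u powr (q * \<theta> / 2) * coulomb_energy \<alpha> p u powr (q * (1 - \<theta>) / (2 * p))))"
      by metis
    show ?thesis
    proof (intro exI[of _ "C powr (- (1 / q))"] conjI ballI)
      show "0 < C powr (- (1 / q))" using C by simp
      fix u :: "real ^ 'n \<Rightarrow> real" assume u: "u \<in> coulomb_sobolev \<alpha> p"
      let ?Y = "dirichlet_energy u powr (q * \<theta> / 2) * coulomb_energy \<alpha> p u powr (q * (1 - \<theta>) / (2 * p))"
      have um: "u \<in> borel_measurable lebesgue" using u by (simp add: coulomb_sobolev_def)
      note I = integral_le_of_nn_integral_le[OF um main[OF u]]
      have CY: "0 \<le> C * ?Y" using C by simp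
      show "integrable lebesgue (\<lambda>x. \<bar>u x\<bar> powr q)" by (rule I(1)[OF CY])
      have "?Y powr (1 / q) = dirichlet_energy u powr (\<theta> / 2) * coulomb_energy \<alpha> p u powr ((1 - \<theta>) / (2 * p))"
        using q by (simp add: powr_mult powr_powr)
      then show "C powr (- (1 / q)) * (LINT x|lebesgue. \<bar>u x\<bar> powr q) powr (1 / q)
        \<le> dirichlet_energy u powr (\<theta> / 2) * coulomb_energy \<alpha> p u powr ((1 - \<theta>) / (2 * p))"
        using root[OF I(2)[OF CY] C] by simp
    qed
  next
    case True
    then have scal1: "1 / q = 1 / 2 - 1 / ?N" using scal by simp
    have "1 / q > 0" using q by simp
    then have N2: "?N > 2" using scal1 N by (simp add: field_simps)
    have q_eq: "q = 2 * ?N / (?N - 2)" using scal1 N2 q by (simp add: field_simps)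
    from sobolev_critical[OF a p N2]
    obtain C where C: "C > 0" and main: "\<And>u :: real ^ 'n \<Rightarrow> real. u \<in> coulomb_sobolev \<alpha> p \<Longrightarrow>
      (\<integral>\<^sup>+ x. ennreal (\<bar>u x\<bar> powr q) \<partial>lborel) \<le> ennreal (C * dirichlet_energy u powr (?N / (?N - 2)))"
      unfolding q_eq by metis
    show ?thesis
    proof (intro exI[of _ "C powr (- (1 / q))"] conjI ballI)
      show "0 < C powr (- (1 / q))" using C by simp
      fix u :: "real ^ 'n \<Rightarrow> real" assume u: "u \<in> coulomb_sobolev \<alpha> p"
      let ?Y = "dirichlet_energy u powr (?N / (?N - 2))"
      have um: "u \<in> borel_measurable lebesgue" using u by (simp add: coulomb_sobolev_def)
      note I = integral_le_of_nn_integral_le[OF um main[OF u]]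
      have CY: "0 \<le> C * ?Y" using C by simp
      show "integrable lebesgue (\<lambda>x. \<bar>u x\<bar> powr q)" by (rule I(1)[OF CY])
      show "C powr (- (1 / q)) * (LINT x|lebesgue. \<bar>u x\<bar> powr q) powr (1 / q)
        \<le> dirichlet_energy u powr (\<theta> / 2) * coulomb_energy \<alpha> p u powr ((1 - \<theta>) / (2 * p))"
      proof (cases "coulomb_energy \<alpha> p u = 0")
        case True
        have "(LINT x|lebesgue. \<bar>u x\<bar> powr q) = 0"
          using zero_energy_imp_zero[OF a p u True]
          by (intro integral_eq_zero_AE) (auto elim: eventually_mono)
        then show ?thesis using q by simp
      next
        case False
        have "?Y powr (1 / q) = dirichlet_energy u powr (\<theta> / 2)"
          using N2 \<open>\<theta> = 1\<close> by (simp add: powr_powr q_eq)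
        then show ?thesis using root[OF I(2)[OF CY] C] False \<open>\<theta> = 1\<close> by simp
      qed
    qed
  qed
qed

section \<open>Sufficiency of the condition\<close>

text \<open>As a function of \<open>\<theta>\<close>, the right-hand side of the scaling relation is affine with value
  \<open>B = (N + \<alpha>) / (2 N p)\<close> at 0 and \<open>A = 1 / 2 - 1 / N\<close> at 1. Condition \<open>(Q)\<close> says that \<open>1 / q\<close> lies
  between its values at the smallest admissible \<open>\<theta>\<close> and at 1; the two alternatives are the two possible
  signs of \<open>B - A\<close>. If \<open>A = B\<close>, then \<open>(Q)\<close> forces \<open>1 / q = A\<close>, and
  every \<open>\<theta>\<close> solves the relation.\<close>

lemma condition_Q_imp_exponent:
  fixes \<alpha> p q :: real
  assumes a: "0 < \<alpha>" and N: "1 \<le> N" and p: "1 \<le> p" and q: "1 \<le> q" and Q: "condition_Q N \<alpha> p q"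
  obtains \<theta> where "\<alpha> / (2 * p + \<alpha>) \<le> \<theta>" "\<theta> \<le> 1"
    "1 / q = \<theta> * (1 / 2 - 1 / real N) + (1 - \<theta>) * ((real N + \<alpha>) / (2 * real N * p))"
proof -
  define A where "A = 1 / 2 - 1 / real N"
  define B where "B = (real N + \<alpha>) / (2 * real N * p)"
  define t where "t = \<alpha> / (2 * p + \<alpha>)"
  have N': "1 \<le> real N" using N by simp
  note E = endpoint_exponent[OF a N' p, folded t_def A_def B_def]
  have BA: "B - A = (real N + \<alpha> - p * (real N - 2)) / (2 * real N * p)"
    using N' p by (simp add: A_def B_def field_simps)
  have pos: "2 * real N * p > 0" using N' p by simp
  have thr: "1 / p \<ge> max (real N - 2) 0 / (real N + \<alpha>) \<longleftrightarrow> p * max (real N - 2) 0 \<le> real N + \<alpha>"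
    using p a N' by (simp add: field_simps)
  have gain: "p * (real N - 2) \<le> p * max (real N - 2) 0" using p by (intro mult_left_mono) auto
  show ?thesis
  proof (cases "A = B")
    case True
    then have "real N + \<alpha> = p * (real N - 2)" using BA N' p by simp
    moreover have "real N + \<alpha> > 0" using N' a by simp
    ultimately have "real N - 2 > 0" using p by (smt (verit) mult_nonneg_nonpos)
    then have "p * max (real N - 2) 0 = real N + \<alpha>" using \<open>real N + \<alpha> = p * (real N - 2)\<close> by simp
    then have "A \<le> 1 / q" "1 / q \<le> 1 / 2 - (p - 1) / (\<alpha> + 2 * p)"
      using Q thr unfolding condition_Q_def A_def by auto
    moreover have "1 / 2 - (p - 1) / (\<alpha> + 2 * p) = A" using E(3) True by (simp add: algebra_simps)
    ultimately have "1 / q = t * A + (1 - t) * B" using True by (simp add: algebra_simps)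
    then show ?thesis using that[of t] E by (simp add: t_def A_def B_def)
  next
    case False
    define \<theta> where "\<theta> = (B - 1 / q) / (B - A)"
    have eq: "1 / q = \<theta> * A + (1 - \<theta>) * B"
    proof -
      have "\<theta> * (B - A) = B - 1 / q" using False by (simp add: \<theta>_def)
      then show ?thesis by (simp add: algebra_simps)
    qed
    have "t \<le> \<theta> \<and> \<theta> \<le> 1"
    proof (cases "p * max (real N - 2) 0 \<le> real N + \<alpha>")
      case True
      then have "B - A \<ge> 0" unfolding BA using gain pos by simp
      then have BA0: "B - A > 0" using False by simp
      have "A \<le> 1 / q" "1 / q \<le> t * A + (1 - t) * B"
        using Q thr True E(3) unfolding condition_Q_def A_def by auto
      then have "\<theta> * (B - A) \<le> 1 * (B - A)" "t * (B - A) \<le> \<theta> * (B - A)"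
        using eq by (auto simp: algebra_simps)
      then show ?thesis using BA0 by (simp only: mult_le_cancel_right_pos)
    next
      case F: False
      then have "p * max (real N - 2) 0 > 0" using N' a by linarith
      then have "real N - 2 > 0" by (simp add: max_def split: if_splits)
      then have "B - A \<le> 0" unfolding BA using F pos by (simp add: divide_nonpos_pos)
      then have BA0: "A - B > 0" using False by simp
      have "A \<ge> 1 / q" "1 / q \<ge> t * A + (1 - t) * B"
        using Q thr F E(3) unfolding condition_Q_def A_def by auto
      then have "\<theta> * (A - B) \<le> 1 * (A - B)" "t * (A - B) \<le> \<theta> * (A - B)"
        using eq by (auto simp: algebra_simps)
      then show ?thesis using BA0 by (simp only: mult_le_cancel_right_pos)
    qed
    then show ?thesis using that[of \<theta>] eq by (simp add: t_def A_def B_def)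
  qed
qed

theorem condition_Q_imp_embedded:
  fixes \<alpha> p q :: real
  assumes a: "0 < \<alpha>" "\<alpha> < real CARD('n::finite)" and p: "1 \<le> p" and q: "1 \<le> q"
    and Q: "condition_Q CARD('n) \<alpha> p q"
  shows "continuously_embedded (coulomb_sobolev \<alpha> p :: (real ^ 'n \<Rightarrow> real) set) (coulomb_sobolev_norm \<alpha> p)
           (Lq_space q) (Lq_norm q)"
proof -
  have N: "1 \<le> CARD('n)" by (simp add: Suc_leI)
  from condition_Q_imp_exponent[OF a(1) N p q Q] obtain \<theta>
    where \<theta>: "\<alpha> / (2 * p + \<alpha>) \<le> \<theta>" "\<theta> \<le> 1"
    "1 / q = \<theta> * (1 / 2 - 1 / real CARD('n)) + (1 - \<theta>) * ((real CARD('n) + \<alpha>) / (2 * real CARD('n) * p))" .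
  have \<theta>0: "0 \<le> \<theta>" using \<theta>(1) a p by (smt (verit) divide_pos_pos)
  obtain S where S: "S > 0" and main: "\<And>u :: real ^ 'n \<Rightarrow> real. u \<in> coulomb_sobolev \<alpha> p \<Longrightarrow>
      integrable lebesgue (\<lambda>x. \<bar>u x\<bar> powr q) \<and> S * (LINT x|lebesgue. \<bar>u x\<bar> powr q) powr (1 / q)
      \<le> dirichlet_energy u powr (\<theta> / 2) * coulomb_energy \<alpha> p u powr ((1 - \<theta>) / (2 * p))"
    using interpolation_inequality[OF a p q \<theta>] by blast
  have "Lq_norm q u \<le> 1 / S * coulomb_sobolev_norm \<alpha> p u" if u: "u \<in> coulomb_sobolev \<alpha> p" for u :: "real ^ 'n \<Rightarrow> real"
  proof -
    let ?D = "dirichlet_energy u" and ?V = "coulomb_energy \<alpha> p u"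
    have DV: "?D \<ge> 0" "?V \<ge> 0" by (auto simp: dirichlet_energy_def coulomb_energy_def)
    have "?D powr (\<theta> / 2) * ?V powr ((1 - \<theta>) / (2 * p)) = sqrt (?D powr \<theta> * (?V powr (1 / p)) powr (1 - \<theta>))"
      by (simp add: powr_half_sqrt[symmetric] powr_mult powr_powr mult.commute)
    also have "\<dots> \<le> coulomb_sobolev_norm \<alpha> p u"
      unfolding coulomb_sobolev_norm_def using DV \<theta>0 \<theta>
      by (intro real_sqrt_le_mono weighted_geometric_mean_le_sum) auto
    finally have "S * Lq_norm q u \<le> coulomb_sobolev_norm \<alpha> p u"
      using main[OF u] by (simp add: Lq_norm_def)
    then show ?thesis using S by (simp add: pos_le_divide_eq mult.commute)
  qed
  moreover have "coulomb_sobolev \<alpha> p \<subseteq> (Lq_space q :: (real ^ 'n \<Rightarrow> real) set)"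
    using main by (auto simp: Lq_space_def coulomb_sobolev_def)
  ultimately show ?thesis unfolding continuously_embedded_def by blast
qed

text \<open>The parameter is unique because the two extreme values of the affine relation differ. In dimension 1
  its strict upper bound expresses that \<open>1 / q\<close> is positive.\<close>

theorem interpolation_inequality_condition_Q:
  fixes \<alpha> p q :: real
  assumes a: "0 < \<alpha>" "\<alpha> < real CARD('n::finite)" and p: "1 \<le> p" and q: "1 \<le> q"
    and Q: "condition_Q CARD('n) \<alpha> p q" and ne: "\<alpha> + real CARD('n) \<noteq> p * (real CARD('n) - 2)"
  shows "\<exists>\<theta>. (\<forall>t. 1 / q = t * (1 / 2 - 1 / real CARD('n))
                            + (1 - t) * ((real CARD('n) + \<alpha>) / (2 * real CARD('n) * p))
                    \<longleftrightarrow> t = \<theta>)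
           \<and> (CARD('n) \<ge> 2 \<longrightarrow> \<alpha> / (2 * p + \<alpha>) \<le> \<theta> \<and> \<theta> \<le> 1)
           \<and> (CARD('n) = 1 \<longrightarrow> \<alpha> / (2 * p + \<alpha>) \<le> \<theta> \<and> \<theta> < (1 + \<alpha>) / (1 + \<alpha> + p))
           \<and> (\<exists>S>0. \<forall>u \<in> (coulomb_sobolev \<alpha> p :: (real ^ 'n \<Rightarrow> real) set).
                integrable lebesgue (\<lambda>x. \<bar>u x\<bar> powr q) \<and>
                S * (LINT x|lebesgue. \<bar>u x\<bar> powr q) powr (1 / q)
                  \<le> dirichlet_energy u powr (\<theta> / 2)
                     * coulomb_energy \<alpha> p u powr ((1 - \<theta>) / (2 * p)))"
proof -
  have N: "1 \<le> CARD('n)" by (simp add: Suc_leI)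
  let ?A = "1 / 2 - 1 / real CARD('n)" and ?B = "(real CARD('n) + \<alpha>) / (2 * real CARD('n) * p)"
  from condition_Q_imp_exponent[OF a(1) N p q Q] obtain \<theta>
    where \<theta>: "\<alpha> / (2 * p + \<alpha>) \<le> \<theta>" "\<theta> \<le> 1" "1 / q = \<theta> * ?A + (1 - \<theta>) * ?B" .
  have "?A \<noteq> ?B"
  proof
    assume "?A = ?B"
    moreover have "?B - ?A = (real CARD('n) + \<alpha> - p * (real CARD('n) - 2)) / (2 * real CARD('n) * p)"
      using p by (simp add: field_simps)
    ultimately show False using ne p by simp
  qed
  have uniq: "t = \<theta>" if "1 / q = t * ?A + (1 - t) * ?B" for t
  proof -
    have "(t - \<theta>) * (?A - ?B) = (t * ?A + (1 - t) * ?B) - (\<theta> * ?A + (1 - \<theta>) * ?B)" by algebra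
    also have "\<dots> = 0" using that \<theta>(3) by simp
    finally show ?thesis using \<open>?A \<noteq> ?B\<close> by simp
  qed
  have one: "\<theta> < (1 + \<alpha>) / (1 + \<alpha> + p)" if "CARD('n) = 1"
  proof -
    have "0 < 1 / q" using q by simp
    then have "0 < (1 - \<theta>) * (1 + \<alpha>) / (2 * p) - \<theta> / 2" using \<theta>(3) that by simp
    then have "0 < ((1 - \<theta>) * (1 + \<alpha>) - p * \<theta>) / (2 * p)" using p by (simp add: diff_divide_distrib)
    then have "\<theta> * (1 + \<alpha> + p) < 1 + \<alpha>" using p by (simp add: zero_less_divide_iff algebra_simps)
    then show ?thesis using a p by (simp add: pos_less_divide_eq)
  qed
  show ?thesis
    by (rule exI[of _ \<theta>])
       (use uniq \<theta> one interpolation_inequality[OF a p q \<theta>] in blast)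
qed

text \<open>For this \<open>p\<close> the scaling relation does not depend on \<open>\<theta>\<close> and fixes \<open>q\<close>; the claim is the inequality
  for the smallest admissible \<open>\<theta>\<close>, raised to the power \<open>q\<close>.\<close>

theorem interpolation_inequality_critical:
  fixes \<alpha> :: real
  assumes a: "0 < \<alpha>" "\<alpha> < real CARD('n::finite)" and N3: "CARD('n) \<ge> 3"
  shows "\<exists>C>0. \<forall>u \<in> (coulomb_sobolev \<alpha> ((real CARD('n) + \<alpha>) / (real CARD('n) - 2)) :: (real ^ 'n \<Rightarrow> real) set).
     integrable lebesgue (\<lambda>x. \<bar>u x\<bar> powr (2 * real CARD('n) / (real CARD('n) - 2))) \<and>
     C * (LINT x|lebesgue. \<bar>u x\<bar> powr (2 * real CARD('n) / (real CARD('n) - 2)))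
       \<le> dirichlet_energy u powr (\<alpha> / (2 + \<alpha>))
          * coulomb_energy \<alpha> ((real CARD('n) + \<alpha>) / (real CARD('n) - 2)) u powr (2 / (2 + \<alpha>))"
proof -
  define N where "N = real CARD('n)"
  have N: "N \<ge> 3" "N - 2 > 0" "1 \<le> N" using N3 by (simp_all add: N_def)
  define p where "p = (N + \<alpha>) / (N - 2)"
  define q where "q = 2 * N / (N - 2)"
  define t where "t = \<alpha> / (2 * p + \<alpha>)"
  have p: "1 \<le> p" using N a by (simp add: p_def pos_le_divide_eq)
  have q: "1 \<le> q" using N by (simp add: q_def pos_le_divide_eq)
  note E = endpoint_exponent[OF a(1) N(3) p, folded t_def]
  have q1: "1 / q = 1 / 2 - 1 / N" using N by (simp add: q_def field_simps)
  have B: "(N + \<alpha>) / (2 * N * p) = 1 / 2 - 1 / N"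
  proof -
    have "N + \<alpha> = p * (N - 2)" using N by (simp add: p_def)
    then have "(N + \<alpha>) / (2 * N * p) = (N - 2) / (2 * N)" using p by simp
    then show ?thesis using N by (simp add: field_simps)
  qed
  have "1 / q = t * (1 / 2 - 1 / N) + (1 - t) * ((N + \<alpha>) / (2 * N * p))"
    unfolding B q1 by (simp add: distrib_right[symmetric])
  from gagliardo_nirenberg_subcritical[OF a p q E(1,2) _ this[unfolded N_def]]
  obtain C where C: "C > 0" and main: "\<And>u :: real ^ 'n \<Rightarrow> real. u \<in> coulomb_sobolev \<alpha> p \<Longrightarrow>
      (\<integral>\<^sup>+ x. ennreal (\<bar>u x\<bar> powr q) \<partial>lborel)
      \<le> ennreal (C * (dirichlet_energy u powr (q * t / 2) * coulomb_energy \<alpha> p u powr (q * (1 - t) / (2 * p))))"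
    unfolding t_def by (metis order_refl)
  have s: "2 * p + \<alpha> = N * (2 + \<alpha>) / (N - 2)" using N by (simp add: p_def field_simps)
  have qa: "q / (2 * p + \<alpha>) = 2 / (2 + \<alpha>)"
  proof -
    have nz: "N - 2 \<noteq> 0" "N \<noteq> 0" "2 + \<alpha> \<noteq> 0" using N a by auto
    have "2 * N / x / (N * (2 + \<alpha>) / x) = 2 / (2 + \<alpha>)" if "x \<noteq> 0" for x
      using that nz by simp
    from this[OF nz(1)] show ?thesis unfolding s q_def .
  qed
  have "q * t / 2 = q / (2 * p + \<alpha>) * (\<alpha> / 2)" by (simp add: t_def)
  also have "\<dots> = \<alpha> / (2 + \<alpha>)" unfolding qa using a by (simp add: field_simps)
  finally have ex1: "q * t / 2 = \<alpha> / (2 + \<alpha>)" .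
  have "q * (1 - t) / (2 * p) = q / (2 * p + \<alpha>)"
  proof -
    have "1 - t = 2 * p / (2 * p + \<alpha>)" using p a by (simp add: t_def field_simps)
    then show ?thesis using p by simp
  qed
  then have ex2: "q * (1 - t) / (2 * p) = 2 / (2 + \<alpha>)" using qa by (rule trans)
  note ex = ex1 ex2
  show ?thesis
    unfolding N_def[symmetric] p_def[symmetric] q_def[symmetric]
  proof (intro exI[of _ "1 / C"] conjI ballI)
    show "0 < 1 / C" using C by simp
    fix u :: "real ^ 'n \<Rightarrow> real" assume u: "u \<in> coulomb_sobolev \<alpha> p"
    have um: "u \<in> borel_measurable lebesgue" using u by (simp add: coulomb_sobolev_def)
    note I = integral_le_of_nn_integral_le[OF um main[OF u, unfolded ex]]
    show "integrable lebesgue (\<lambda>x. \<bar>u x\<bar> powr q)" using I(1) C by simp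
    show "1 / C * (LINT x|lebesgue. \<bar>u x\<bar> powr q)
      \<le> dirichlet_energy u powr (\<alpha> / (2 + \<alpha>)) * coulomb_energy \<alpha> p u powr (2 / (2 + \<alpha>))"
      using I(2) C by (simp add: pos_divide_le_eq mult.commute)
  qed
qed

section \<open>Continuously differentiable functions of compact support\<close>

text \<open>Keeping the gradient as an explicit second function avoids choosing one.\<close>

definition compact_C1 :: "('a::euclidean_space \<Rightarrow> real) \<Rightarrow> ('a \<Rightarrow> 'a) \<Rightarrow> bool" where
  "compact_C1 u g \<longleftrightarrow> (\<forall>x. (u has_derivative (\<lambda>v. g x \<bullet> v)) (at x)) \<and> continuous_on UNIV g \<and>
     (\<exists>R. \<forall>x. R < norm x \<longrightarrow> u x = 0 \<and> g x = 0)"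

lemma compact_C1D:
  assumes "compact_C1 u g"
  shows "(u has_derivative (\<lambda>v. g x \<bullet> v)) (at x)" "continuous_on UNIV g" "continuous_on UNIV u"
    "\<exists>R. \<forall>x. R < norm x \<longrightarrow> u x = 0 \<and> g x = 0"
proof -
  show d: "(u has_derivative (\<lambda>v. g x \<bullet> v)) (at x)" for x using assms by (simp add: compact_C1_def)
  show "continuous_on UNIV u"
    by (auto simp: continuous_on_eq_continuous_at intro: has_derivative_continuous[OF d])
qed (use assms in \<open>auto simp: compact_C1_def\<close>)

lemma integrable_continuous_compact_support:
  fixes f :: "'a::euclidean_space \<Rightarrow> 'b::{banach, second_countable_topology}"
  assumes "continuous_on UNIV f" "\<And>x. R < norm x \<Longrightarrow> f x = 0"
  shows "integrable lborel f"
proof -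
  have "integrable lborel (\<lambda>x. indicator (cball 0 R) x *\<^sub>R f x)"
    by (rule borel_integrable_compact[OF compact_cball continuous_on_subset[OF assms(1)]]) simp
  moreover have "indicator (cball 0 R) x *\<^sub>R f x = f x" for x
    using assms(2)[of x] by (auto simp: indicator_def not_le)
  ultimately show ?thesis by simp
qed

lemma locally_integrable_continuous:
  fixes f :: "'a::euclidean_space \<Rightarrow> 'b::euclidean_space"
  assumes "continuous_on UNIV f"
  shows "locally_integrable f"
  unfolding locally_integrable_def
proof safe
  fix K :: "'a set" assume K: "compact K"
  have "integrable lborel (\<lambda>x. indicator K x *\<^sub>R f x)"
    by (rule borel_integrable_compact[OF K continuous_on_subset[OF assms]]) simp
  moreover from this have "(\<lambda>x. indicator K x *\<^sub>R f x) \<in> borel_measurable borel" by auto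
  ultimately show "f absolutely_integrable_on K"
    by (simp add: set_integrable_def integrable_completion)
qed

lemma lborel_integral_translate:
  fixes f :: "'a::euclidean_space \<Rightarrow> real"
  assumes [measurable]: "f \<in> borel_measurable borel"
  shows "(LINT x|lborel. f (x + c)) = (LINT x|lborel. f x)"
proof -
  have "(LINT x|distr lborel borel ((+) c). f x) = (LINT x|lborel. f (c + x))"
    by (rule integral_distr) measurable
  then show ?thesis by (simp add: lborel_distr_plus add.commute)
qed

text \<open>By translation invariance the difference quotients in direction \<open>v\<close> have integral 0; the mean value
  theorem provides the bound for passing to the limit.\<close>

lemma integral_directional_derivative_eq_0:
  fixes f :: "'a::euclidean_space \<Rightarrow> real"
  assumes D: "\<And>x. (f has_derivative D x) (at x)" and cont: "continuous_on UNIV (\<lambda>x. D x v)"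
    and zero: "\<And>x. R < norm x \<Longrightarrow> f x = 0" "\<And>x. R < norm x \<Longrightarrow> D x v = 0"
  shows "(LINT x|lborel. D x v) = 0"
proof -
  define h where "h n = 1 / real (Suc n)" for n
  define s where "s n x = (f (x + h n *\<^sub>R v) - f x) / h n" for n x
  have h: "0 < h n" "h n \<le> 1" for n by (auto simp: h_def)
  have fcont: "continuous_on UNIV f"
    by (auto simp: continuous_on_eq_continuous_at intro: has_derivative_continuous[OF D])
  have [measurable]: "f \<in> borel_measurable borel" "(\<lambda>x. D x v) \<in> borel_measurable borel"
    using fcont cont by (auto intro: borel_measurable_continuous_onI)
  have fint: "integrable lborel f" by (rule integrable_continuous_compact_support[OF fcont zero(1)])
  have "D x v = 0" if "R < dist 0 x" for x using that zero(2) by simp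
  then obtain B where B: "B \<ge> 0" "\<And>x. \<bar>D x v\<bar> \<le> B"
    using bounded_continuous_compact_support[OF cont] by blast
  have line: "((\<lambda>t. f (x + t *\<^sub>R v)) has_real_derivative D (x + t *\<^sub>R v) v) (at t)" for x t
  proof -
    have "((\<lambda>t. x + t *\<^sub>R v) has_derivative (\<lambda>t. t *\<^sub>R v)) (at t)"
      by (auto intro!: derivative_eq_intros)
    from has_derivative_compose[OF this D]
    have "((\<lambda>t. f (x + t *\<^sub>R v)) has_derivative (\<lambda>a. D (x + t *\<^sub>R v) (a *\<^sub>R v))) (at t)" .
    moreover have "D (x + t *\<^sub>R v) (a *\<^sub>R v) = D (x + t *\<^sub>R v) v * a" for a
      using linear_scale[OF has_derivative_linear[OF D[of "x + t *\<^sub>R v"]], of a v] by simp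
    ultimately show ?thesis by (simp add: has_field_derivative_def)
  qed
  have bound: "\<bar>s n x\<bar> \<le> B * indicator (cball 0 (R + norm v)) x" for n x
  proof (cases "norm x \<le> R + norm v")
    case True
    have "\<exists>z>0. z < h n \<and> f (x + h n *\<^sub>R v) - f (x + 0 *\<^sub>R v) = (h n - 0) * D (x + z *\<^sub>R v) v"
      using MVT2[of 0 "h n" "\<lambda>t. f (x + t *\<^sub>R v)" "\<lambda>t. D (x + t *\<^sub>R v) v"] h(1)[of n] line by blast
    then obtain z where "f (x + h n *\<^sub>R v) - f x = h n * D (x + z *\<^sub>R v) v" by auto
    then have "s n x = D (x + z *\<^sub>R v) v" using h(1)[of n] by (simp add: s_def)
    then show ?thesis using B True by simp
  next
    case False
    have "norm (h n *\<^sub>R v) \<le> norm v" using h(1)[of n] h(2)[of n] by (simp add: mult_left_le_one_le)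
    then have "R < norm (x + h n *\<^sub>R v)"
      using False norm_triangle_ineq4[of "x + h n *\<^sub>R v" "h n *\<^sub>R v"] by simp
    moreover have "R < norm x" using False norm_ge_zero[of v] by linarith
    ultimately show ?thesis using B by (simp add: s_def zero)
  qed
  have "(\<lambda>n. LINT x|lborel. s n x) \<longlonglongrightarrow> (LINT x|lborel. D x v)"
  proof (rule integral_dominated_convergence[where w = "\<lambda>x. B * indicator (cball 0 (R + norm v)) x"])
    show "integrable lborel (\<lambda>x. B * indicator (cball 0 (R + norm v)) (x::'a))"
      by (intro integrable_mult_right integrable_real_indicator) (auto simp: emeasure_bounded_finite[OF bounded_cball, unfolded infinity_ennreal_def])
    show "AE x in lborel. (\<lambda>n. s n x) \<longlonglongrightarrow> D x v"
    proof (rule AE_I2)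
      fix x
      have "((\<lambda>y. (f (x + y *\<^sub>R v) - f (x + 0 *\<^sub>R v)) / (y - 0)) \<longlongrightarrow> D (x + 0 *\<^sub>R v) v) (at 0)"
        using line[of x 0] unfolding has_field_derivative_iff by simp
      moreover have "filterlim h (at 0) sequentially"
      proof -
        have "h \<longlonglongrightarrow> 0" unfolding h_def using LIMSEQ_inverse_real_of_nat by (simp add: inverse_eq_divide)
        then show ?thesis using h by (auto simp: filterlim_at intro!: always_eventually less_imp_neq[THEN not_sym])
      qed
      ultimately have "(\<lambda>n. (f (x + h n *\<^sub>R v) - f (x + 0 *\<^sub>R v)) / (h n - 0)) \<longlonglongrightarrow> D (x + 0 *\<^sub>R v) v"
        by (rule filterlim_compose)
      then show "(\<lambda>n. s n x) \<longlonglongrightarrow> D x v" by (simp add: s_def[abs_def])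
    qed
    show "AE x in lborel. norm (s n x) \<le> B * indicator (cball 0 (R + norm v)) x" for n
      using bound by auto
    show "s n \<in> borel_measurable lborel" for n unfolding s_def[abs_def] by measurable
  qed simp
  moreover have "(LINT x|lborel. s n x) = 0" for n
  proof -
    have "continuous_on UNIV (\<lambda>x. f (x + h n *\<^sub>R v))"
      by (intro continuous_on_compose2[OF fcont] continuous_intros) auto
    moreover have "f (x + h n *\<^sub>R v) = 0" if "R + norm v < norm x" for x
    proof -
      have "norm (h n *\<^sub>R v) \<le> norm v" using h(1)[of n] h(2)[of n] by (simp add: mult_left_le_one_le)
      then show ?thesis using that norm_triangle_ineq4[of "x + h n *\<^sub>R v" "h n *\<^sub>R v"] by (intro zero) auto
    qed
    ultimately have "integrable lborel (\<lambda>x. f (x + h n *\<^sub>R v))"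
      by (rule integrable_continuous_compact_support)
    then show ?thesis unfolding s_def using fint
      by (simp add: lborel_integral_translate)
  qed
  ultimately have "(\<lambda>_::nat. 0) \<longlonglongrightarrow> (LINT x|lborel. D x v)" by simp
  from LIMSEQ_unique[OF this tendsto_const] show ?thesis .
qed

text \<open>Integration by parts is the previous lemma for the product with a test function.\<close>

lemma compact_C1_has_weak_gradient:
  fixes u :: "real ^ 'n \<Rightarrow> real"
  assumes ug: "compact_C1 u g"
  shows "has_weak_gradient u g"
  unfolding has_weak_gradient_def
proof (intro conjI allI impI)
  note U = compact_C1D[OF ug]
  show "locally_integrable u" "locally_integrable g"
    by (rule locally_integrable_continuous; rule U)+
  fix \<phi> :: "real ^ 'n \<Rightarrow> real" and i :: 'n assume "test_function \<phi>"
  then have "C_k (Suc 0) \<phi>" by (simp only: test_function_def)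
  then have \<phi>: "\<And>x. (\<phi> has_derivative frechet_derivative \<phi> (at x)) (at x)"
      "\<And>v. continuous_on UNIV (\<lambda>x. frechet_derivative \<phi> (at x) v)"
    using frechet_derivative_works by auto
  have \<phi>c: "continuous_on UNIV \<phi>"
    by (auto simp: continuous_on_eq_continuous_at intro: has_derivative_continuous[OF \<phi>(1)])
  let ?e = "axis i 1 :: real ^ 'n"
  let ?d = "\<lambda>x. frechet_derivative \<phi> (at x) ?e"
  obtain R where R: "\<And>x. R < norm x \<Longrightarrow> u x = 0 \<and> g x = 0" using U(4) by blast
  have gi: "continuous_on UNIV (\<lambda>x. g x $ i)" by (intro continuous_intros U(2))
  have c1: "continuous_on UNIV (\<lambda>x. u x * ?d x)" by (intro continuous_on_mult U(3) \<phi>(2))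
  have c2: "continuous_on UNIV (\<lambda>x. g x $ i * \<phi> x)" by (intro continuous_on_mult gi \<phi>c)
  have i1: "integrable lborel (\<lambda>x. u x * ?d x)"
    by (rule integrable_continuous_compact_support[OF c1, of R]) (simp add: R)
  have i2: "integrable lborel (\<lambda>x. g x $ i * \<phi> x)"
    by (rule integrable_continuous_compact_support[OF c2, of R]) (simp add: R)
  have "(LINT x|lborel. u x * ?d x + (g x \<bullet> ?e) * \<phi> x) = 0"
  proof (rule integral_directional_derivative_eq_0[OF has_derivative_mult[OF U(1) \<phi>(1)], of _ R])
    show "continuous_on UNIV (\<lambda>x. u x * ?d x + (g x \<bullet> ?e) * \<phi> x)"
      using continuous_on_add[OF c1 c2] by (simp add: inner_axis)
  qed (simp_all add: R)
  then have "(LINT x|lborel. u x * ?d x) + (LINT x|lborel. g x $ i * \<phi> x) = 0"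
    using i1 i2 by (simp add: inner_axis)
  moreover have "(\<lambda>x. u x * ?d x) \<in> borel_measurable borel" "(\<lambda>x. g x $ i * \<phi> x) \<in> borel_measurable borel"
    using c1 c2 by (auto intro: borel_measurable_continuous_onI)
  ultimately show "(LINT x|lebesgue. u x * ?d x) = - (LINT x|lebesgue. g x $ i * \<phi> x)"
    by (simp add: integral_completion)
qed

lemma compact_C1_coulomb_sobolev:
  fixes u :: "real ^ 'n \<Rightarrow> real"
  assumes ug: "compact_C1 u g" and fin: "ennreal_coulomb_energy \<alpha> p u < \<infinity>"
  shows "u \<in> coulomb_sobolev \<alpha> p" "ennreal (dirichlet_energy u) = (\<integral>\<^sup>+ x. ennreal ((norm (g x))\<^sup>2) \<partial>lborel)"
proof -
  note U = compact_C1D[OF ug]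
  have wg: "has_weak_gradient u g" by (rule compact_C1_has_weak_gradient[OF ug])
  then have wd: "weakly_differentiable u" by (auto simp: weakly_differentiable_def)
  then have "has_weak_gradient u (weak_gradient u)" by (rule has_weak_gradient_weak_gradient)
  note ae = weak_gradient_unique[OF wg this]
  have [measurable]: "weak_gradient u \<in> borel_measurable lebesgue"
    using \<open>has_weak_gradient u (weak_gradient u)\<close> by (intro locally_integrable_measurable) (simp add: has_weak_gradient_def)
  have um: "u \<in> borel_measurable lebesgue"
    using wg by (intro locally_integrable_measurable) (simp add: has_weak_gradient_def)
  obtain R where R: "\<And>x. R < norm x \<Longrightarrow> u x = 0 \<and> g x = 0" using U(4) by blast
  have c: "continuous_on UNIV (\<lambda>x. (norm (g x))\<^sup>2)" by (intro continuous_intros U(2))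
  have i: "integrable lborel (\<lambda>x. (norm (g x))\<^sup>2)"
    by (rule integrable_continuous_compact_support[OF c, of R]) (simp add: R)
  have m: "(\<lambda>x. (norm (g x))\<^sup>2) \<in> borel_measurable borel" using c by (rule borel_measurable_continuous_onI)
  have "integrable lebesgue (\<lambda>x. (norm (g x))\<^sup>2)" using i m by (simp add: integrable_completion)
  then have i': "integrable lebesgue (\<lambda>x. (norm (weak_gradient u x))\<^sup>2)"
    by (rule integrable_cong_AE_imp) (use ae in \<open>auto elim: eventually_mono\<close>)
  show "u \<in> coulomb_sobolev \<alpha> p"
    using um fin wd i' by (simp add: coulomb_sobolev_def)
  have "dirichlet_energy u = (LINT x|lebesgue. (norm (g x))\<^sup>2)"
    unfolding dirichlet_energy_def
    by (rule integral_cong_AE) (use ae m in \<open>auto elim: eventually_mono intro: measurable_completion\<close>)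
  also have "\<dots> = (LINT x|lborel. (norm (g x))\<^sup>2)" using m by (simp add: integral_completion)
  finally show "ennreal (dirichlet_energy u) = (\<integral>\<^sup>+ x. ennreal ((norm (g x))\<^sup>2) \<partial>lborel)"
    using nn_integral_eq_integral[OF i] by simp
qed

section \<open>Finiteness of the Coulomb energy\<close>

lemma nn_integral_annulus_powr_le:
  assumes "e > 0"
  shows "(\<integral>\<^sup>+ z\<in>{z. 2 powi i \<le> norm z \<and> norm z < 2 powi (i + 1)}. ennreal (norm (z::'a::euclidean_space) powr (- e)) \<partial>lborel)
    \<le> ennreal (unit_ball_vol (real DIM('a)) * 2 powr real DIM('a) * 2 powr (of_int i * (real DIM('a) - e)))"
proof -
  let ?N = "real DIM('a)"
  have "(\<integral>\<^sup>+ z\<in>{z. 2 powi i \<le> norm z \<and> norm z < 2 powi (i + 1)}. ennreal (norm (z::'a) powr (- e)) \<partial>lborel)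
    \<le> (\<integral>\<^sup>+ z. ennreal ((2 powi i) powr (- e)) * indicator (ball 0 (2 powi (i + 1))) (z::'a) \<partial>lborel)"
  proof (rule nn_integral_mono)
    fix z :: 'a
    show "ennreal (norm z powr (- e)) * indicator {z. 2 powi i \<le> norm z \<and> norm z < 2 powi (i + 1)} z
      \<le> ennreal ((2 powi i) powr (- e)) * indicator (ball 0 (2 powi (i + 1))) z"
      using assms by (auto simp: indicator_def intro!: ennreal_leI powr_mono2')
  qed
  also have "\<dots> = ennreal ((2 powi i) powr (- e)) * emeasure lborel (ball (0::'a) (2 powi (i + 1)))"
    by (rule nn_integral_cmult_indicator) simp
  also have "\<dots> = ennreal ((2 powi i) powr (- e) * (unit_ball_vol ?N * (2 powi (i + 1)) powr ?N))"
    by (subst emeasure_ball_powr) (auto simp: ennreal_mult)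
  also have "(2 powi i) powr (- e) * (unit_ball_vol ?N * (2 powi (i + 1)) powr ?N)
     = unit_ball_vol ?N * 2 powr ?N * 2 powr (of_int i * (?N - e))"
  proof -
    have "(2::real) powr (of_int i * - e) * 2 powr (of_int (i + 1) * ?N) = 2 powr ?N * 2 powr (of_int i * (?N - e))"
      by (simp add: algebra_simps flip: powr_add)
    then show ?thesis by (simp only: dyadic_powr mult_ac)
  qed
  finally show ?thesis .
qed

lemma nn_integral_UN_geometric_finite:
  assumes [measurable]: "f \<in> borel_measurable M" "\<And>n::nat. S n \<in> sets M"
    and T: "T \<subseteq> (\<Union>n. S n)" and le: "\<And>n. (\<integral>\<^sup>+ x\<in>S n. f x \<partial>M) \<le> ennreal (c * r ^ n)"
    and c: "0 \<le> c" "0 \<le> r" "r < 1"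
  shows "(\<integral>\<^sup>+ x\<in>T. f x \<partial>M) < \<infinity>"
proof -
  have "(\<integral>\<^sup>+ x\<in>T. f x \<partial>M) \<le> (\<integral>\<^sup>+ x. (\<Sum>n. f x * indicator (S n) x) \<partial>M)"
  proof (rule nn_integral_mono)
    fix x
    show "f x * indicator T x \<le> (\<Sum>n. f x * indicator (S n) x)"
    proof (cases "x \<in> T")
      case True
      then obtain n where "x \<in> S n" using T by auto
      have "(\<Sum>k\<in>{n}. f x * indicator (S k) x) \<le> (\<Sum>n. f x * indicator (S n) x)"
        by (rule sum_le_suminf) auto
      then show ?thesis using \<open>x \<in> S n\<close> True by simp
    qed simp
  qed
  also have "\<dots> = (\<Sum>n. \<integral>\<^sup>+ x\<in>S n. f x \<partial>M)"
    by (rule nn_integral_suminf) measurable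
  also have "\<dots> \<le> (\<Sum>n. ennreal (c * r ^ n))" by (intro suminf_le le) auto
  also have "\<dots> = ennreal (\<Sum>n. c * r ^ n)"
    using c by (intro suminf_ennreal2) (auto intro!: summable_mult summable_geometric)
  finally show ?thesis by (auto intro: le_less_trans)
qed

lemma nn_integral_powr_near_0:
  assumes "0 < e" "e < real DIM('a::euclidean_space)"
  shows "(\<integral>\<^sup>+ z\<in>ball 0 1. ennreal (norm (z::'a) powr (- e)) \<partial>lborel) < \<infinity>"
proof -
  let ?N = "real DIM('a)"
  define S where "S n = {z::'a. 2 powi (- int n - 1) \<le> norm z \<and> norm z < 2 powi ((- int n - 1) + 1)}" for n
  have "(\<integral>\<^sup>+ z\<in>ball 0 1 - {0}. ennreal (norm (z::'a) powr (- e)) \<partial>lborel) < \<infinity>"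
  proof (rule nn_integral_UN_geometric_finite[where S = S and r = "2 powr (- (?N - e))"
        and c = "unit_ball_vol ?N * 2 powr ?N * 2 powr (- (?N - e))"])
    show "ball 0 1 - {0} \<subseteq> (\<Union>n. S n)"
    proof
      fix z :: 'a assume z: "z \<in> ball 0 1 - {0}"
      define l where "l = \<lfloor>log 2 (norm z)\<rfloor>"
      have "norm z > 0" using z by auto
      from dyadic_bracket[OF this] have l: "2 powi l \<le> norm z" "norm z < 2 powi (l + 1)"
        by (simp_all add: l_def)
      have "log 2 (norm z) < 0" using z by simp
      then have "l < 0" by (simp add: l_def floor_less_zero)
      then have "l = - int (nat (- l - 1)) - 1" by simp
      then show "z \<in> (\<Union>n. S n)" using l unfolding S_def by (metis (mono_tags, lifting) UN_I UNIV_I mem_Collect_eq)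
    qed
    show "(\<integral>\<^sup>+ z\<in>S n. ennreal (norm z powr (- e)) \<partial>lborel)
      \<le> ennreal (unit_ball_vol ?N * 2 powr ?N * 2 powr (- (?N - e)) * (2 powr (- (?N - e))) ^ n)" for n
    proof -
      have "2 powr (of_int (- int n - 1) * (?N - e)) = 2 powr (- (?N - e)) * (2 powr (- (?N - e))) ^ n"
        by (simp add: powr_power algebra_simps flip: powr_add)
      then show ?thesis
        using nn_integral_annulus_powr_le[OF assms(1), of "- int n - 1", where 'a = 'a]
        unfolding S_def by (simp only: mult.assoc)
    qed
    show "S n \<in> sets lborel" for n unfolding S_def by measurable
  qed (use assms two_powr_neg_less_1[of "?N - e"] in auto)
  also have "(\<integral>\<^sup>+ z\<in>ball 0 1 - {0}. ennreal (norm (z::'a) powr (- e)) \<partial>lborel) = (\<integral>\<^sup>+ z\<in>ball 0 1. ennreal (norm (z::'a) powr (- e)) \<partial>lborel)"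
    by (intro nn_integral_cong) (auto simp: indicator_def)
  finally show ?thesis .
qed

lemma nn_integral_powr_near_infinity:
  assumes "e > real DIM('a::euclidean_space)"
  shows "(\<integral>\<^sup>+ z\<in>{z. 1 \<le> norm z}. ennreal (norm (z::'a) powr (- e)) \<partial>lborel) < \<infinity>"
proof -
  let ?N = "real DIM('a)"
  have e: "e > 0" using assms by (smt (verit) of_nat_0_le_iff)
  define S where "S n = {z::'a. 2 powi (int n) \<le> norm z \<and> norm z < 2 powi (int n + 1)}" for n
  show ?thesis
  proof (rule nn_integral_UN_geometric_finite[where S = S and r = "2 powr (- (e - ?N))" and c = "unit_ball_vol ?N * 2 powr ?N"])
    show "{z. 1 \<le> norm z} \<subseteq> (\<Union>n. S n)"
    proof
      fix z :: 'a assume z: "z \<in> {z. 1 \<le> norm z}"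
      define l where "l = \<lfloor>log 2 (norm z)\<rfloor>"
      have "norm z > 0" using z by auto
      from dyadic_bracket[OF this] have l: "2 powi l \<le> norm z" "norm z < 2 powi (l + 1)"
        by (simp_all add: l_def)
      have "log 2 (norm z) \<ge> 0" using z \<open>norm z > 0\<close> by (subst zero_le_log_cancel_iff) auto
      then have "l = int (nat l)" by (simp add: l_def)
      then show "z \<in> (\<Union>n. S n)" using l unfolding S_def by (metis (mono_tags, lifting) UN_I UNIV_I mem_Collect_eq)
    qed
    show "(\<integral>\<^sup>+ z\<in>S n. ennreal (norm z powr (- e)) \<partial>lborel)
      \<le> ennreal (unit_ball_vol ?N * 2 powr ?N * (2 powr (- (e - ?N))) ^ n)" for n
    proof -
      have "2 powr (of_int (int n) * (?N - e)) = (2 powr (- (e - ?N))) ^ n"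
        by (simp add: powr_power algebra_simps)
      then show ?thesis
        using nn_integral_annulus_powr_le[OF e, of "int n", where 'a = 'a]
        unfolding S_def by (simp only: mult.assoc)
    qed
    show "S n \<in> sets lborel" for n unfolding S_def by measurable
  qed (use assms two_powr_neg_less_1[of "e - ?N"] in auto)
qed

text \<open>The potential is bounded, because the singularity of the kernel is integrable, and at infinity it
  decays like the kernel, whose square is integrable there as \<open>2 * (N - a) > N\<close>.\<close>

lemma riesz_energy_finite:
  fixes f :: "real ^ 'n \<Rightarrow> real"
  assumes [measurable]: "f \<in> borel_measurable borel" and a: "0 < a" "2 * a < real CARD('n)"
    and f: "\<And>x. 0 \<le> f x" "\<And>x. f x \<le> B" "\<And>x. R < norm x \<Longrightarrow> f x = 0"
  shows "(\<integral>\<^sup>+ x. (riesz_potential a f x)\<^sup>2 \<partial>lborel) < \<infinity>"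
proof -
  let ?N = "real CARD('n)"
  define e where "e = ?N - a"
  define c where "c = riesz_const TYPE('n) a"
  define r where "r = max R 0"
  have r: "r \<ge> 0" "\<And>x. r < norm x \<Longrightarrow> f x = 0" using f(3) by (auto simp: r_def)
  have e: "0 < e" "e < ?N" "?N < 2 * e" using a by (auto simp: e_def)
  have c: "c > 0" unfolding c_def using a by (intro riesz_const_pos) auto
  have B: "B \<ge> 0" using f(1,2)[of undefined] by linarith
  have ker: "riesz_kernel a x = c * norm x powr (- e)" for x :: "real ^ 'n"
    by (simp add: riesz_kernel_eq c_def e_def)
  let ?k1 = "\<integral>\<^sup>+ z\<in>ball 0 1. ennreal (norm (z::real ^ 'n) powr (- e)) \<partial>lborel"
  let ?m = "emeasure lborel (cball (0::real ^ 'n) r)"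
  let ?B1 = "ennreal (c * B) * (?k1 + ?m)"
  have m: "?m < \<infinity>" using r by (simp add: emeasure_cball)
  have B1: "?B1 < \<infinity>"
    using nn_integral_powr_near_0[of e, where 'a = "real ^ 'n"] e m by (auto simp: ennreal_mult_less_top)
  have W1: "riesz_potential a f x \<le> ?B1" for x
  proof -
    have "riesz_potential a f x \<le> (\<integral>\<^sup>+ y. ennreal (c * B) * (ennreal (norm (x - y) powr (- e)) * indicator (ball 0 1) (x - y) + indicator (cball 0 r) y) \<partial>lborel)"
      unfolding riesz_potential_lborel
    proof (rule nn_integral_mono)
      fix y
      show "ennreal (riesz_kernel a (x - y) * f y) \<le> ennreal (c * B) * (ennreal (norm (x - y) powr (- e)) * indicator (ball 0 1) (x - y) + indicator (cball 0 r) y)"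
      proof (cases "norm y \<le> r")
        case True
        have "riesz_kernel a (x - y) * f y \<le> (c * norm (x - y) powr (- e)) * B"
          unfolding ker using c f by (intro mult_left_mono) auto
        then have 1: "ennreal (riesz_kernel a (x - y) * f y) \<le> ennreal (c * B) * ennreal (norm (x - y) powr (- e))"
          using c B by (simp add: ennreal_mult[symmetric] ennreal_leI mult_ac)
        show ?thesis
        proof (cases "norm (x - y) < 1")
          case True
          then show ?thesis by (intro order_trans[OF 1] mult_left_mono) auto
        next
          case False
          then have "norm (x - y) powr (- e) \<le> 1"
            using powr_mono2'[of "- e" 1 "norm (x - y)"] e by simp
          then have "ennreal (norm (x - y) powr (- e)) \<le> 1" by simp
          then show ?thesis using False \<open>norm y \<le> r\<close> by (intro order_trans[OF 1] mult_left_mono) auto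
        qed
      qed (simp add: r)
    qed
    also have "\<dots> = ennreal (c * B) * ((\<integral>\<^sup>+ y. ennreal (norm (x - y) powr (- e)) * indicator (ball 0 1) (x - y) \<partial>lborel) + ?m)"
      by (simp add: nn_integral_cmult nn_integral_add)
    also have "(\<integral>\<^sup>+ y. ennreal (norm (x - y) powr (- e)) * indicator (ball 0 1) (x - y) \<partial>lborel) = ?k1"
      using nn_integral_lborel_affine[of "\<lambda>z. ennreal (norm z powr (- e)) * indicator (ball 0 1) (z :: real ^ 'n)" "-1" x] by simp
    finally show ?thesis .
  qed
  let ?C = "c * B * 2 powr e"
  have W2: "riesz_potential a f x \<le> ennreal ?C * ?m * ennreal (norm x powr (- e))" if x: "2 * r + 1 \<le> norm x" for x
  proof -
    have "riesz_potential a f x \<le> (\<integral>\<^sup>+ y. (ennreal ?C * ennreal (norm x powr (- e))) * indicator (cball 0 r) (y :: real ^ 'n) \<partial>lborel)"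
      unfolding riesz_potential_lborel
    proof (rule nn_integral_mono)
      fix y
      show "ennreal (riesz_kernel a (x - y) * f y) \<le> (ennreal ?C * ennreal (norm x powr (- e))) * indicator (cball 0 r) y"
      proof (cases "norm y \<le> r")
        case True
        have "norm x / 2 \<le> norm (x - y)" using x True r norm_triangle_ineq2[of x y] by linarith
        moreover have "0 < norm x / 2" using x r by linarith
        ultimately have "norm (x - y) powr (- e) \<le> (norm x / 2) powr (- e)"
          using e by (intro powr_mono2') auto
        also have "\<dots> = 2 powr e * norm x powr (- e)" by (simp add: powr_divide powr_minus_divide)
        finally have "riesz_kernel a (x - y) * f y \<le> (c * (2 powr e * norm x powr (- e))) * B"
          unfolding ker using c f by (intro mult_mono) auto
        then show ?thesis using True c B by (simp add: ennreal_mult[symmetric] ennreal_leI mult_ac)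
      qed (simp add: r)
    qed
    also have "\<dots> = (ennreal ?C * ennreal (norm x powr (- e))) * ?m"
      by (rule nn_integral_cmult_indicator) simp
    finally show ?thesis by (simp add: mult_ac)
  qed
  let ?E = "(ennreal ?C * ?m)\<^sup>2"
  have "(\<integral>\<^sup>+ x. (riesz_potential a f x)\<^sup>2 \<partial>lborel)
     \<le> (\<integral>\<^sup>+ x. ?B1\<^sup>2 * indicator (cball 0 (2 * r + 1)) (x :: real ^ 'n) + ?E * (ennreal (norm x powr (- (2 * e))) * indicator {z. 1 \<le> norm z} x) \<partial>lborel)"
  proof (rule nn_integral_mono)
    fix x
    show "(riesz_potential a f x)\<^sup>2 \<le> ?B1\<^sup>2 * indicator (cball 0 (2 * r + 1)) x + ?E * (ennreal (norm x powr (- (2 * e))) * indicator {z. 1 \<le> norm z} x)"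
    proof (cases "norm x \<le> 2 * r + 1")
      case True
      have "(riesz_potential a f x)\<^sup>2 \<le> ?B1\<^sup>2" by (intro power_mono W1) auto
      then show ?thesis using True by (auto intro: add_increasing2)
    next
      case False
      have "(riesz_potential a f x)\<^sup>2 \<le> (ennreal ?C * ?m * ennreal (norm x powr (- e)))\<^sup>2"
        using False by (intro power_mono W2) auto
      also have "\<dots> = ?E * ennreal (norm x powr (- (2 * e)))"
      proof -
        have "(norm x powr (- e))\<^sup>2 = norm x powr (- (2 * e))"
          by (simp add: power2_eq_square flip: powr_add)
        then show ?thesis by (simp only: power_mult_distrib ennreal_power[OF powr_ge_zero])
      qed
      finally show ?thesis using False r by (auto intro: add_increasing)
    qed
  qed
  also have "\<dots> = ?B1\<^sup>2 * emeasure lborel (cball (0::real ^ 'n) (2 * r + 1)) + ?E * (\<integral>\<^sup>+ z\<in>{z. 1 \<le> norm z}. ennreal (norm (z::real ^ 'n) powr (- (2 * e))) \<partial>lborel)"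
    by (subst nn_integral_add) (auto simp: nn_integral_cmult nn_integral_cmult_indicator)
  also have "\<dots> < \<infinity>"
  proof -
    have "?B1\<^sup>2 < \<infinity>" "?E < \<infinity>" using B1 m by (auto simp: power_less_top_ennreal ennreal_mult_less_top)
    moreover have "(\<integral>\<^sup>+ z\<in>{z. 1 \<le> norm z}. ennreal (norm (z::real ^ 'n) powr (- (2 * e))) \<partial>lborel) < \<infinity>"
      by (rule nn_integral_powr_near_infinity) (use e in simp)
    ultimately show ?thesis using r by (auto simp: ennreal_mult_less_top emeasure_cball)
  qed
  finally show ?thesis .
qed

lemma compact_C1_measurable:
  assumes "compact_C1 u g"
  shows "u \<in> borel_measurable borel" "g \<in> borel_measurable borel"
  using compact_C1D(2,3)[OF assms] by (auto intro: borel_measurable_continuous_onI)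

lemma compact_C1_energy_finite:
  fixes u :: "real ^ 'n \<Rightarrow> real"
  assumes ug: "compact_C1 u g" and a: "0 < \<alpha>" "\<alpha> < real CARD('n)" and p: "1 \<le> p"
  shows "ennreal_coulomb_energy \<alpha> p u < \<infinity>"
proof -
  note U = compact_C1D[OF ug]
  have [measurable]: "u \<in> borel_measurable borel" using compact_C1_measurable[OF ug] by simp
  obtain R where R: "\<And>x. R < norm x \<Longrightarrow> u x = 0" using U(4) by blast
  have "u x = 0" if "R < dist 0 x" for x using that R by simp
  then obtain B where B: "\<And>x. \<bar>u x\<bar> \<le> B" using bounded_continuous_compact_support[OF U(3)] by blast
  show ?thesis
    unfolding coulomb_energy_lborel
  proof (rule riesz_energy_finite[where B = "B powr p" and R = R])
    show "\<bar>u x\<bar> powr p \<le> B powr p" for x using B p by (intro powr_mono2) auto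
  qed (use a R in auto)
qed

section \<open>Distant copies and dilations\<close>

text \<open>If \<open>\<bar>z\<bar> \<ge> 2 n\<close>, then at each point one of the two factors is evaluated at distance at least \<open>n\<close> from
  the origin, where little of the square integral of \<open>W\<close> is left.\<close>

lemma tail_product_small:
  fixes W :: "'a::euclidean_space \<Rightarrow> ennreal"
  assumes [measurable]: "W \<in> borel_measurable borel" and fin: "(\<integral>\<^sup>+ x. (W x)\<^sup>2 \<partial>lborel) < \<infinity>" and e: "0 < e"
  obtains \<rho> where "\<And>z. \<rho> \<le> norm z \<Longrightarrow> (\<integral>\<^sup>+ x. W x * W (x - z) \<partial>lborel) \<le> ennreal e"
proof -
  define V where "V = enn2real (\<integral>\<^sup>+ x. (W x)\<^sup>2 \<partial>lborel)"
  have V: "(\<integral>\<^sup>+ x. (W x)\<^sup>2 \<partial>lborel) = ennreal V" "V \<ge> 0" using fin by (auto simp: V_def)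
  define T where "T n = (\<integral>\<^sup>+ x. (W x * indicator {x. real n \<le> norm x} x)\<^sup>2 \<partial>lborel)" for n
  have "(\<lambda>n. T n) \<longlonglongrightarrow> (\<integral>\<^sup>+ x. 0 \<partial>(lborel :: 'a measure))"
    unfolding T_def
  proof (rule nn_integral_dominated_convergence[where w = "\<lambda>x. (W x)\<^sup>2"])
    show "AE x in lborel. (W x * indicator {x. real j \<le> norm x} x)\<^sup>2 \<le> (W x)\<^sup>2" for j
      by (intro AE_I2) (auto simp: indicator_def)
    show "AE x in lborel. (\<lambda>n. (W x * indicator {x. real n \<le> norm x} x)\<^sup>2) \<longlonglongrightarrow> 0"
    proof (rule AE_I2)
      fix x :: 'a
      obtain m :: nat where m: "norm x < real m" using reals_Archimedean2 by blast
      have "\<forall>\<^sub>F n in sequentially. (W x * indicator {x. real n \<le> norm x} x)\<^sup>2 = 0"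
        using eventually_ge_at_top[of m] by eventually_elim (use m in \<open>auto simp: indicator_def\<close>)
      then show "(\<lambda>n. (W x * indicator {x. real n \<le> norm x} x)\<^sup>2) \<longlonglongrightarrow> 0" by (rule tendsto_eventually)
    qed
  qed (use fin in auto)
  then have T0: "T \<longlonglongrightarrow> 0" by simp
  define d where "d = (e / 2)\<^sup>2 / (V + 1)"
  have d: "d > 0" using e V by (simp add: d_def)
  have "\<forall>\<^sub>F n in sequentially. T n < ennreal d" by (rule order_tendstoD(2)[OF T0]) (use d in auto)
  then obtain n where n: "T n < ennreal d" by (auto dest: eventually_happens)
  have dV: "ennreal d * ennreal V \<le> ennreal ((e / 2)\<^sup>2)"
  proof -
    have "d * V \<le> d * (V + 1)" using d by (intro mult_left_mono) auto
    also have "\<dots> = (e / 2)\<^sup>2" using V by (simp add: d_def)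
    finally show ?thesis using d V by (simp add: ennreal_mult[symmetric] ennreal_leI)
  qed
  have half: "I \<le> ennreal (e / 2)" if "I\<^sup>2 \<le> T n * ennreal V" for I
  proof -
    have "I\<^sup>2 \<le> ennreal d * ennreal V" using n by (intro order_trans[OF that] mult_right_mono) auto
    also note dV
    finally show ?thesis using ennreal_square_le_imp_le_sqrt[of I "(e / 2)\<^sup>2"] e by simp
  qed
  show ?thesis
  proof (rule that[of "2 * real n"])
    fix z :: 'a assume z: "2 * real n \<le> norm z"
    let ?A = "\<lambda>x. W x * indicator {x. real n \<le> norm x} x"
    have W1: "(\<integral>\<^sup>+ x. (W (x - z))\<^sup>2 \<partial>lborel) = ennreal V"
      using nn_integral_lborel_translate[of "\<lambda>x. (W x)\<^sup>2" "- z"] V by simp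
    have T1: "(\<integral>\<^sup>+ x. (?A (x - z))\<^sup>2 \<partial>lborel) = T n"
      using nn_integral_lborel_translate[of "\<lambda>x. (?A x)\<^sup>2" "- z"] by (simp add: T_def)
    have "(\<integral>\<^sup>+ x. W x * W (x - z) \<partial>lborel) \<le> (\<integral>\<^sup>+ x. ?A x * W (x - z) + ?A (x - z) * W x \<partial>lborel)"
    proof (rule nn_integral_mono)
      fix x
      have "real n \<le> norm x \<or> real n \<le> norm (x - z)"
        using z norm_triangle_ineq4[of x "x - z"] by auto
      then show "W x * W (x - z) \<le> ?A x * W (x - z) + ?A (x - z) * W x"
        by (auto simp: indicator_def mult.commute)
    qed
    also have "\<dots> = (\<integral>\<^sup>+ x. ?A x * W (x - z) \<partial>lborel) + (\<integral>\<^sup>+ x. ?A (x - z) * W x \<partial>lborel)"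
      by (rule nn_integral_add) measurable
    also have "\<dots> \<le> ennreal (e / 2) + ennreal (e / 2)"
    proof (intro add_mono half)
      show "(\<integral>\<^sup>+ x. ?A x * W (x - z) \<partial>lborel)\<^sup>2 \<le> T n * ennreal V"
        using Cauchy_Schwarz_nn_integral[of ?A lborel "\<lambda>x. W (x - z)"] by (simp add: W1 T_def)
      show "(\<integral>\<^sup>+ x. ?A (x - z) * W x \<partial>lborel)\<^sup>2 \<le> T n * ennreal V"
        using Cauchy_Schwarz_nn_integral[of "\<lambda>x. ?A (x - z)" lborel W] by (simp only: T1 V) simp
    qed
    also have "\<dots> = ennreal e" using e by (simp add: ennreal_plus[symmetric] del: ennreal_plus)
    finally show "(\<integral>\<^sup>+ x. W x * W (x - z) \<partial>lborel) \<le> ennreal e" .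
  qed
qed

lemma riesz_potential_translate:
  assumes [measurable]: "f \<in> borel_measurable borel"
  shows "riesz_potential a (\<lambda>y. f (y - z)) x = riesz_potential a f (x - z)"
  using nn_integral_lborel_translate[of "\<lambda>y. ennreal (riesz_kernel a (x - z - y) * f y)" "- z"]
  by (simp add: riesz_potential_lborel algebra_simps)

lemma riesz_potential_add:
  fixes f1 f2 :: "real ^ 'n \<Rightarrow> real"
  assumes [measurable]: "f1 \<in> borel_measurable borel" "f2 \<in> borel_measurable borel"
    and nn: "\<And>x. 0 \<le> f1 x" "\<And>x. 0 \<le> f2 x" and a: "0 < a" "a < real CARD('n)"
  shows "riesz_potential a (\<lambda>y. f1 y + f2 y) x = riesz_potential a f1 x + riesz_potential a f2 x"
proof -
  have k: "riesz_kernel a y \<ge> 0" for y :: "real ^ 'n"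
    using riesz_const_pos[OF a] by (simp add: riesz_kernel_eq)
  have "riesz_potential a (\<lambda>y. f1 y + f2 y) x
      = (\<integral>\<^sup>+ y. ennreal (riesz_kernel a (x - y) * f1 y) + ennreal (riesz_kernel a (x - y) * f2 y) \<partial>lborel)"
    unfolding riesz_potential_lborel
    by (intro nn_integral_cong) (simp add: k nn distrib_left)
  also have "\<dots> = riesz_potential a f1 x + riesz_potential a f2 x"
    unfolding riesz_potential_lborel by (rule nn_integral_add) measurable
  finally show ?thesis .
qed

text \<open>Add a translate of the function. If it is far away, the supports are disjoint, so the local
  integrals double exactly, and the mixed term of the Coulomb energy is small.\<close>

lemma compact_C1_doubling:
  fixes u :: "real ^ 'n \<Rightarrow> real"
  assumes ug: "compact_C1 u g" and a: "0 < \<alpha>" "\<alpha> < real CARD('n)" and p: "1 \<le> p" and q: "1 \<le> q" and e: "0 < e"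
  obtains u' :: "real ^ 'n \<Rightarrow> real" and g' where "compact_C1 u' g'"
    "(\<integral>\<^sup>+ x. ennreal (\<bar>u' x\<bar> powr q) \<partial>lborel) = 2 * (\<integral>\<^sup>+ x. ennreal (\<bar>u x\<bar> powr q) \<partial>lborel)"
    "(\<integral>\<^sup>+ x. ennreal ((norm (g' x))\<^sup>2) \<partial>lborel) = 2 * (\<integral>\<^sup>+ x. ennreal ((norm (g x))\<^sup>2) \<partial>lborel)"
    "ennreal_coulomb_energy \<alpha> p u' \<le> 2 * ennreal_coulomb_energy \<alpha> p u + ennreal e"
proof -
  note U = compact_C1D[OF ug]
  note [measurable] = compact_C1_measurable[OF ug]
  obtain R where R: "\<And>x. R < norm x \<Longrightarrow> u x = 0 \<and> g x = 0" using U(4) by blast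
  let ?f = "\<lambda>y. \<bar>u y\<bar> powr p"
  let ?W = "riesz_potential (\<alpha> / 2) ?f"
  have a2: "0 < \<alpha> / 2" "\<alpha> / 2 < real CARD('n)" using a by auto
  have [measurable]: "?W \<in> borel_measurable borel" by (rule borel_measurable_riesz_potential) measurable
  have fin: "(\<integral>\<^sup>+ x. (?W x)\<^sup>2 \<partial>lborel) < \<infinity>"
    using compact_C1_energy_finite[OF ug a p] by (simp add: coulomb_energy_lborel)
  obtain \<rho> where \<rho>: "\<And>z. \<rho> \<le> norm z \<Longrightarrow> (\<integral>\<^sup>+ x. ?W x * ?W (x - z) \<partial>lborel) \<le> ennreal (e / 2)"
    using tail_product_small[of ?W "e / 2"] fin e by auto
  define z where "z = (max \<rho> (2 * max R 0 + 1)) *\<^sub>R (axis undefined 1 :: real ^ 'n)"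
  have "norm z = max \<rho> (2 * max R 0 + 1)" by (simp add: z_def)
  then have z: "\<rho> \<le> norm z" "2 * R < norm z" by auto
  define u' where "u' x = u x + u (x - z)" for x
  define g' where "g' x = g x + g (x - z)" for x
  have disj: "(u x = 0 \<and> g x = 0) \<or> (u (x - z) = 0 \<and> g (x - z) = 0)" for x
    using R[of x] R[of "x - z"] z(2) norm_triangle_ineq4[of x "x - z"] by fastforce
  have sumf: "\<bar>u' x\<bar> powr r = \<bar>u x\<bar> powr r + \<bar>u (x - z)\<bar> powr r" for x r
    using disj[of x] by (auto simp: u'_def)
  have sumg: "(norm (g' x))\<^sup>2 = (norm (g x))\<^sup>2 + (norm (g (x - z)))\<^sup>2" for x
    using disj[of x] by (auto simp: g'_def)
  show ?thesis
  proof (rule that[of u' g'])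
    show "compact_C1 u' g'"
      unfolding compact_C1_def
    proof (intro conjI allI)
      fix x :: "real ^ 'n"
      have "((\<lambda>x. x - z) has_derivative (\<lambda>v. v)) (at x)" by (auto intro!: derivative_eq_intros)
      from has_derivative_add[OF U(1) has_derivative_compose[OF this U(1)]]
      show "(u' has_derivative (\<lambda>v. g' x \<bullet> v)) (at x)"
        by (simp add: u'_def[abs_def] g'_def inner_add_left)
      show "continuous_on UNIV g'"
        unfolding g'_def by (intro continuous_on_add U(2) continuous_on_compose2[OF U(2)] continuous_intros) auto
      have "u' x = 0 \<and> g' x = 0" if "max R 0 + norm z < norm x" for x
      proof -
        have "R < norm x" "R < norm (x - z)"
          using that norm_ge_zero[of z] norm_triangle_ineq2[of x z] by linarith+
        then show ?thesis by (simp add: u'_def g'_def R)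
      qed
      then show "\<exists>R. \<forall>x. R < norm x \<longrightarrow> u' x = 0 \<and> g' x = 0" by blast
    qed
    have "(\<integral>\<^sup>+ x. ennreal (\<bar>u' x\<bar> powr q) \<partial>lborel) = (\<integral>\<^sup>+ x. ennreal (\<bar>u x\<bar> powr q) + ennreal (\<bar>u (x - z)\<bar> powr q) \<partial>lborel)"
      by (simp add: sumf)
    also have "\<dots> = (\<integral>\<^sup>+ x. ennreal (\<bar>u x\<bar> powr q) \<partial>lborel) + (\<integral>\<^sup>+ x. ennreal (\<bar>u (x - z)\<bar> powr q) \<partial>lborel)"
      by (rule nn_integral_add) measurable
    also have "(\<integral>\<^sup>+ x. ennreal (\<bar>u (x - z)\<bar> powr q) \<partial>lborel) = (\<integral>\<^sup>+ x. ennreal (\<bar>u x\<bar> powr q) \<partial>lborel)"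
      using nn_integral_lborel_translate[of "\<lambda>x. ennreal (\<bar>u x\<bar> powr q)" "- z"] by simp
    finally show "(\<integral>\<^sup>+ x. ennreal (\<bar>u' x\<bar> powr q) \<partial>lborel) = 2 * (\<integral>\<^sup>+ x. ennreal (\<bar>u x\<bar> powr q) \<partial>lborel)"
      by (simp add: mult_2)
    have "(\<integral>\<^sup>+ x. ennreal ((norm (g' x))\<^sup>2) \<partial>lborel) = (\<integral>\<^sup>+ x. ennreal ((norm (g x))\<^sup>2) + ennreal ((norm (g (x - z)))\<^sup>2) \<partial>lborel)"
      by (simp add: sumg)
    also have "\<dots> = (\<integral>\<^sup>+ x. ennreal ((norm (g x))\<^sup>2) \<partial>lborel) + (\<integral>\<^sup>+ x. ennreal ((norm (g (x - z)))\<^sup>2) \<partial>lborel)"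
      by (rule nn_integral_add) measurable
    also have "(\<integral>\<^sup>+ x. ennreal ((norm (g (x - z)))\<^sup>2) \<partial>lborel) = (\<integral>\<^sup>+ x. ennreal ((norm (g x))\<^sup>2) \<partial>lborel)"
      using nn_integral_lborel_translate[of "\<lambda>x. ennreal ((norm (g x))\<^sup>2)" "- z"] by simp
    finally show "(\<integral>\<^sup>+ x. ennreal ((norm (g' x))\<^sup>2) \<partial>lborel) = 2 * (\<integral>\<^sup>+ x. ennreal ((norm (g x))\<^sup>2) \<partial>lborel)"
      by (simp add: mult_2)
    have W': "riesz_potential (\<alpha> / 2) (\<lambda>y. \<bar>u' y\<bar> powr p) x = ?W x + ?W (x - z)" for x
    proof -
      have "riesz_potential (\<alpha> / 2) (\<lambda>y. ?f y + ?f (y - z)) x = ?W x + riesz_potential (\<alpha> / 2) (\<lambda>y. ?f (y - z)) x"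
        by (rule riesz_potential_add) (use a2 in auto)
      moreover have "riesz_potential (\<alpha> / 2) (\<lambda>y. ?f (y - z)) x = ?W (x - z)"
        by (rule riesz_potential_translate[of ?f]) measurable
      ultimately show ?thesis by (simp add: sumf)
    qed
    have "ennreal_coulomb_energy \<alpha> p u' = (\<integral>\<^sup>+ x. ((?W x)\<^sup>2 + (?W (x - z))\<^sup>2) + 2 * (?W x * ?W (x - z)) \<partial>lborel)"
      unfolding coulomb_energy_lborel W' by (simp add: power2_eq_square algebra_simps mult_2)
    also have "\<dots> = ((\<integral>\<^sup>+ x. (?W x)\<^sup>2 \<partial>lborel) + (\<integral>\<^sup>+ x. (?W (x - z))\<^sup>2 \<partial>lborel)) + 2 * (\<integral>\<^sup>+ x. ?W x * ?W (x - z) \<partial>lborel)"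
      by (simp add: nn_integral_add nn_integral_cmult)
    also have "(\<integral>\<^sup>+ x. (?W (x - z))\<^sup>2 \<partial>lborel) = (\<integral>\<^sup>+ x. (?W x)\<^sup>2 \<partial>lborel)"
      using nn_integral_lborel_translate[of "\<lambda>x. (?W x)\<^sup>2" "- z"] by simp
    also have "(\<integral>\<^sup>+ x. (?W x)\<^sup>2 \<partial>lborel) + (\<integral>\<^sup>+ x. (?W x)\<^sup>2 \<partial>lborel) + 2 * (\<integral>\<^sup>+ x. ?W x * ?W (x - z) \<partial>lborel)
        \<le> 2 * ennreal_coulomb_energy \<alpha> p u + 2 * ennreal (e / 2)"
      unfolding coulomb_energy_lborel by (intro add_mono mult_left_mono \<rho> z) (auto simp: mult_2)
    also have "2 * ennreal (e / 2) = ennreal e"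
      using e by (simp add: mult_2 ennreal_plus[symmetric] del: ennreal_plus)
    finally show "ennreal_coulomb_energy \<alpha> p u' \<le> 2 * ennreal_coulomb_energy \<alpha> p u + ennreal e" .
  qed
qed

lemma riesz_potential_scale:
  fixes f :: "real ^ 'n \<Rightarrow> real"
  assumes [measurable]: "f \<in> borel_measurable borel" and l: "l > 0"
  shows "riesz_potential a (\<lambda>y. f (y /\<^sub>R l)) x = ennreal (l powr a) * riesz_potential a f (x /\<^sub>R l)"
proof -
  let ?N = "real CARD('n)"
  have "riesz_potential a (\<lambda>y. f (y /\<^sub>R l)) x
      = ennreal (\<bar>l\<bar> ^ DIM(real ^ 'n)) * (\<integral>\<^sup>+ y. ennreal (riesz_kernel a (x - (0 + l *\<^sub>R y)) * f ((0 + l *\<^sub>R y) /\<^sub>R l)) \<partial>lborel)"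
    unfolding riesz_potential_lborel by (rule nn_integral_lborel_affine) (use l in auto)
  also have "\<dots> = ennreal (l powr ?N) * (\<integral>\<^sup>+ y. ennreal (l powr (a - ?N)) * ennreal (riesz_kernel a (x /\<^sub>R l - y) * f y) \<partial>lborel)"
  proof -
    have "riesz_kernel a (x - l *\<^sub>R y) = l powr (a - ?N) * riesz_kernel a (x /\<^sub>R l - y)" for y :: "real ^ 'n"
    proof -
      have "x - l *\<^sub>R y = l *\<^sub>R (x /\<^sub>R l - y)" using l by (simp add: scaleR_diff_right)
      then have "norm (x - l *\<^sub>R y) = l * norm (x /\<^sub>R l - y)" using l by simp
      then show ?thesis using l by (simp add: riesz_kernel_eq powr_mult)
    qed
    then show ?thesis using l by (simp add: powr_realpow ennreal_mult' mult.assoc)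
  qed
  also have "\<dots> = ennreal (l powr ?N) * (ennreal (l powr (a - ?N)) * riesz_potential a f (x /\<^sub>R l))"
    unfolding riesz_potential_lborel by (subst nn_integral_cmult) auto
  also have "\<dots> = ennreal (l powr ?N * l powr (a - ?N)) * riesz_potential a f (x /\<^sub>R l)"
    by (simp add: ennreal_mult' mult.assoc)
  also have "l powr ?N * l powr (a - ?N) = l powr a" by (simp flip: powr_add)
  finally show ?thesis .
qed

lemma compact_C1_scale:
  fixes u :: "real ^ 'n \<Rightarrow> real"
  assumes ug: "compact_C1 u g" and l: "l > 0"
  defines "ul \<equiv> \<lambda>x. u (x /\<^sub>R l)" and "gl \<equiv> \<lambda>x. g (x /\<^sub>R l) /\<^sub>R l"
  shows "compact_C1 ul gl"
    "(\<integral>\<^sup>+ x. ennreal (\<bar>ul x\<bar> powr q) \<partial>lborel) = ennreal (l powr real CARD('n)) * (\<integral>\<^sup>+ x. ennreal (\<bar>u x\<bar> powr q) \<partial>lborel)"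
    "(\<integral>\<^sup>+ x. ennreal ((norm (gl x))\<^sup>2) \<partial>lborel) = ennreal (l powr (real CARD('n) - 2)) * (\<integral>\<^sup>+ x. ennreal ((norm (g x))\<^sup>2) \<partial>lborel)"
    "ennreal_coulomb_energy \<alpha> p ul = ennreal (l powr (real CARD('n) + \<alpha>)) * ennreal_coulomb_energy \<alpha> p u"
proof -
  let ?N = "real CARD('n)"
  note U = compact_C1D[OF ug]
  note [measurable] = compact_C1_measurable[OF ug]
  obtain R where R: "\<And>x. R < norm x \<Longrightarrow> u x = 0 \<and> g x = 0" using U(4) by blast
  show "compact_C1 ul gl"
    unfolding compact_C1_def
  proof (intro conjI allI)
    fix x :: "real ^ 'n"
    have "((\<lambda>x. x /\<^sub>R l) has_derivative (\<lambda>v. v /\<^sub>R l)) (at x)" by (auto intro!: derivative_eq_intros)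
    from has_derivative_compose[OF this U(1)]
    show "(ul has_derivative (\<lambda>v. gl x \<bullet> v)) (at x)" by (simp add: ul_def gl_def)
    show "continuous_on UNIV gl"
      unfolding gl_def by (intro continuous_on_scaleR continuous_on_const continuous_on_compose2[OF U(2)] continuous_intros) auto
    have "ul x = 0 \<and> gl x = 0" if "R * l < norm x" for x
      using R[of "x /\<^sub>R l"] that l by (auto simp: ul_def gl_def field_simps)
    then show "\<exists>R. \<forall>x. R < norm x \<longrightarrow> ul x = 0 \<and> gl x = 0" by blast
  qed
  have scale: "(\<integral>\<^sup>+ x. h (x /\<^sub>R l) \<partial>lborel) = ennreal (l powr ?N) * (\<integral>\<^sup>+ x. h x \<partial>lborel)"
    if [measurable]: "h \<in> borel_measurable borel" for h :: "real ^ 'n \<Rightarrow> ennreal"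
    using nn_integral_lborel_affine[of "\<lambda>x. h (x /\<^sub>R l)" l 0] l by (simp add: powr_realpow)
  show "(\<integral>\<^sup>+ x. ennreal (\<bar>ul x\<bar> powr q) \<partial>lborel) = ennreal (l powr ?N) * (\<integral>\<^sup>+ x. ennreal (\<bar>u x\<bar> powr q) \<partial>lborel)"
    unfolding ul_def by (rule scale) measurable
  have "(\<integral>\<^sup>+ x. ennreal ((norm (gl x))\<^sup>2) \<partial>lborel) = (\<integral>\<^sup>+ x. ennreal (l powr (- 2)) * ennreal ((norm (g (x /\<^sub>R l)))\<^sup>2) \<partial>lborel)"
  proof (rule nn_integral_cong)
    fix x
    have "(norm (gl x))\<^sup>2 = l powr (- 2) * (norm (g (x /\<^sub>R l)))\<^sup>2"
      using l by (simp add: gl_def powr_minus power_mult_distrib power_inverse)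
    then show "ennreal ((norm (gl x))\<^sup>2) = ennreal (l powr (- 2)) * ennreal ((norm (g (x /\<^sub>R l)))\<^sup>2)"
      by (simp add: ennreal_mult')
  qed
  also have "\<dots> = ennreal (l powr (- 2)) * (\<integral>\<^sup>+ x. ennreal ((norm (g (x /\<^sub>R l)))\<^sup>2) \<partial>lborel)"
    by (rule nn_integral_cmult) measurable
  also have "(\<integral>\<^sup>+ x. ennreal ((norm (g (x /\<^sub>R l)))\<^sup>2) \<partial>lborel) = ennreal (l powr ?N) * (\<integral>\<^sup>+ x. ennreal ((norm (g x))\<^sup>2) \<partial>lborel)"
    by (rule scale) measurable
  also have "ennreal (l powr (- 2)) * (ennreal (l powr ?N) * (\<integral>\<^sup>+ x. ennreal ((norm (g x))\<^sup>2) \<partial>lborel))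
      = ennreal (l powr (- 2) * l powr ?N) * (\<integral>\<^sup>+ x. ennreal ((norm (g x))\<^sup>2) \<partial>lborel)"
    by (simp add: ennreal_mult' mult.assoc)
  also have "l powr (- 2) * l powr ?N = l powr (?N - 2)" by (simp flip: powr_add)
  finally show "(\<integral>\<^sup>+ x. ennreal ((norm (gl x))\<^sup>2) \<partial>lborel) = ennreal (l powr (?N - 2)) * (\<integral>\<^sup>+ x. ennreal ((norm (g x))\<^sup>2) \<partial>lborel)" .
  let ?W = "riesz_potential (\<alpha> / 2) (\<lambda>y. \<bar>u y\<bar> powr p)"
  have [measurable]: "?W \<in> borel_measurable borel" by (rule borel_measurable_riesz_potential) measurable
  have "ennreal_coulomb_energy \<alpha> p ul = (\<integral>\<^sup>+ x. (ennreal (l powr (\<alpha> / 2)) * ?W (x /\<^sub>R l))\<^sup>2 \<partial>lborel)"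
    unfolding coulomb_energy_lborel ul_def by (subst riesz_potential_scale) (use l in auto)
  also have "\<dots> = (\<integral>\<^sup>+ x. ennreal (l powr \<alpha>) * (?W (x /\<^sub>R l))\<^sup>2 \<partial>lborel)"
  proof -
    have "(l powr (\<alpha> / 2))\<^sup>2 = l powr \<alpha>" by (simp add: power2_eq_square flip: powr_add)
    then show ?thesis by (simp add: power_mult_distrib ennreal_power)
  qed
  also have "\<dots> = ennreal (l powr \<alpha>) * (\<integral>\<^sup>+ x. (?W (x /\<^sub>R l))\<^sup>2 \<partial>lborel)"
    by (rule nn_integral_cmult) measurable
  also have "(\<integral>\<^sup>+ x. (?W (x /\<^sub>R l))\<^sup>2 \<partial>lborel) = ennreal (l powr ?N) * (\<integral>\<^sup>+ x. (?W x)\<^sup>2 \<partial>lborel)"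
    by (rule scale) measurable
  also have "ennreal (l powr \<alpha>) * (ennreal (l powr ?N) * (\<integral>\<^sup>+ x. (?W x)\<^sup>2 \<partial>lborel))
     = ennreal (l powr (?N + \<alpha>)) * ennreal_coulomb_energy \<alpha> p u"
    by (simp add: coulomb_energy_lborel powr_add ennreal_mult' mult_ac)
  finally show "ennreal_coulomb_energy \<alpha> p ul = ennreal (l powr (?N + \<alpha>)) * ennreal_coulomb_energy \<alpha> p u" .
qed

lemma exists_nonzero_compact_C1:
  fixes q :: real
  assumes q: "1 \<le> q"
  obtains u :: "real ^ 'n \<Rightarrow> real" and g where "compact_C1 u g"
    "0 < (\<integral>\<^sup>+ x. ennreal (\<bar>u x\<bar> powr q) \<partial>lborel)" "(\<integral>\<^sup>+ x. ennreal (\<bar>u x\<bar> powr q) \<partial>lborel) < \<infinity>"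
    "(\<integral>\<^sup>+ x. ennreal ((norm (g x))\<^sup>2) \<partial>lborel) < \<infinity>"
proof -
  obtain b' where b': "\<And>s. (annulus_bump has_real_derivative b' s) (at s)" "continuous_on UNIV b'"
    using smooth_upto_annulus_bump[of "Suc 0"] by auto
  define u where "u x = annulus_bump (x \<bullet> x)" for x :: "real ^ 'n"
  define g where "g x = (2 * b' (x \<bullet> x)) *\<^sub>R x" for x :: "real ^ 'n"
  have out: "u x = 0 \<and> g x = 0" if "1 < norm x" for x
  proof -
    have n: "1 < x \<bullet> x" using that by (simp add: power2_norm_eq_inner[symmetric])
    have "(annulus_bump has_real_derivative 0) (at (x \<bullet> x))"
      by (rule has_real_derivative_locally_zero[of "{1<..}"]) (use n in \<open>auto intro: annulus_bump_eq_0\<close>)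
    then have "b' (x \<bullet> x) = 0" using b'(1) DERIV_unique by blast
    then show ?thesis using n by (simp add: u_def g_def annulus_bump_eq_0)
  qed
  have ug: "compact_C1 u g"
    unfolding compact_C1_def
  proof (intro conjI allI)
    show "(u has_derivative (\<lambda>v. g x \<bullet> v)) (at x)" for x
      using has_derivative_radial[of annulus_bump b' 0 x, OF b'(1)] by (simp add: u_def[abs_def] g_def mult_ac)
    show "continuous_on UNIV g"
      unfolding g_def by (intro continuous_intros continuous_on_compose2[OF b'(2)]) auto
    show "\<exists>R. \<forall>x. R < norm x \<longrightarrow> u x = 0 \<and> g x = 0" using out by blast
  qed
  note U = compact_C1D[OF ug]
  note [measurable] = compact_C1_measurable[OF ug]
  have fin: "(\<integral>\<^sup>+ x. ennreal (h x) \<partial>lborel) < \<infinity>" if "continuous_on UNIV h" "\<And>x. 0 \<le> h x" "\<And>x. 1 < norm x \<Longrightarrow> h x = 0" for h :: "real ^ 'n \<Rightarrow> real"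
    using nn_integral_eq_integral[OF integrable_continuous_compact_support[OF that(1,3)]] that(2) by simp
  have 1: "(\<integral>\<^sup>+ x. ennreal (\<bar>u x\<bar> powr q) \<partial>lborel) < \<infinity>"
  proof (rule fin)
    have "continuous_on UNIV (\<lambda>t::real. \<bar>t\<bar> powr q)"
      using q by (intro continuous_on_powr' continuous_intros) auto
    then show "continuous_on UNIV (\<lambda>x. \<bar>u x\<bar> powr q)"
      by (rule continuous_on_compose2[OF _ U(3)]) simp
  qed (use out q in auto)
  have 2: "(\<integral>\<^sup>+ x. ennreal ((norm (g x))\<^sup>2) \<partial>lborel) < \<infinity>"
    by (rule fin) (use out in \<open>auto intro!: continuous_intros U(2)\<close>)
  have "(\<integral>\<^sup>+ x. ennreal (\<bar>u x\<bar> powr q) \<partial>lborel) \<noteq> 0"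
  proof
    assume "(\<integral>\<^sup>+ x. ennreal (\<bar>u x\<bar> powr q) \<partial>lborel) = 0"
    then have ae: "AE x in lborel. ennreal (\<bar>u x\<bar> powr q) = 0"
      by (subst (asm) nn_integral_0_iff_AE) auto
    have pos: "shell_kernel 1 x = 0" if "u x = 0" for x using that by (simp add: u_def shell_kernel_def)
    from ae have "AE x in lborel. ennreal (shell_kernel 1 (x - 0 :: real ^ 'n)) = 0"
    proof eventually_elim
      case (elim x)
      then have "u x = 0" by (auto simp: ennreal_eq_0_iff)
      then show ?case using pos by simp
    qed
    then have "(\<integral>\<^sup>+ x. ennreal (shell_kernel 1 (x - 0 :: real ^ 'n)) \<partial>lborel) = 0"
      by (subst nn_integral_0_iff_AE) auto
    then show False
      using shell_kernel_integral(1)[of 1 "0 :: real ^ 'n"] shell_kernel_integral(2)[of 1, where 'a = "real ^ 'n"]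
      by (simp add: ennreal_eq_0_iff)
  qed
  then have "0 < (\<integral>\<^sup>+ x. ennreal (\<bar>u x\<bar> powr q) \<partial>lborel)" by (simp add: zero_less_iff_neq_zero)
  from that[OF ug this 1 2] show ?thesis .
qed

text \<open>If each doubling step increases the energy by at most \<open>v\<close> beyond the factor 2, the bound
  \<open>(2 * 2\<^sup>k - 1) * v\<close> is reproduced, so the energy grows linearly in the number of bumps.\<close>

lemma exists_separated_bumps:
  fixes \<alpha> p q :: real
  assumes a: "0 < \<alpha>" "\<alpha> < real CARD('n::finite)" and p: "1 \<le> p" and q: "1 \<le> q"
  obtains L0 D0 v :: real where "0 < L0" "0 \<le> D0" "0 < v"
    "\<And>k. \<exists>u g. compact_C1 (u :: real ^ 'n \<Rightarrow> real) g \<and>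
       (\<integral>\<^sup>+ x. ennreal (\<bar>u x\<bar> powr q) \<partial>lborel) = ennreal (2 ^ k * L0) \<and>
       (\<integral>\<^sup>+ x. ennreal ((norm (g x))\<^sup>2) \<partial>lborel) = ennreal (2 ^ k * D0) \<and>
       ennreal_coulomb_energy \<alpha> p u \<le> ennreal ((2 * 2 ^ k - 1) * v)"
proof -
  obtain u0 :: "real ^ 'n \<Rightarrow> real" and g0 where ug: "compact_C1 u0 g0"
    "0 < (\<integral>\<^sup>+ x. ennreal (\<bar>u0 x\<bar> powr q) \<partial>lborel)" "(\<integral>\<^sup>+ x. ennreal (\<bar>u0 x\<bar> powr q) \<partial>lborel) < \<infinity>"
    "(\<integral>\<^sup>+ x. ennreal ((norm (g0 x))\<^sup>2) \<partial>lborel) < \<infinity>"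
    using exists_nonzero_compact_C1[OF q] by metis
  define L0 where "L0 = enn2real (\<integral>\<^sup>+ x. ennreal (\<bar>u0 x\<bar> powr q) \<partial>lborel)"
  define D0 where "D0 = enn2real (\<integral>\<^sup>+ x. ennreal ((norm (g0 x))\<^sup>2) \<partial>lborel)"
  \<comment> \<open>The summand 1 makes v positive, so that it can serve as the error in each doubling step.\<close>
  define v where "v = enn2real (ennreal_coulomb_energy \<alpha> p u0) + 1"
  have L0: "(\<integral>\<^sup>+ x. ennreal (\<bar>u0 x\<bar> powr q) \<partial>lborel) = ennreal L0" using ug by (simp add: L0_def)
  have D0: "(\<integral>\<^sup>+ x. ennreal ((norm (g0 x))\<^sup>2) \<partial>lborel) = ennreal D0" using ug by (simp add: D0_def)
  have v0: "ennreal_coulomb_energy \<alpha> p u0 \<le> ennreal v"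
  proof -
    have "ennreal_coulomb_energy \<alpha> p u0 = ennreal (enn2real (ennreal_coulomb_energy \<alpha> p u0))"
      using compact_C1_energy_finite[OF ug(1) a p] by simp
    also have "\<dots> \<le> ennreal v" by (intro ennreal_leI) (simp add: v_def)
    finally show ?thesis .
  qed
  show ?thesis
  proof (rule that[of L0 D0 v])
    show "0 < L0" using ug(2) L0 by (metis ennreal_less_zero_iff)
    show "0 \<le> D0" by (simp add: D0_def)
    show v: "0 < v" unfolding v_def by (intro add_nonneg_pos) auto
    fix k
    show "\<exists>u g. compact_C1 (u :: real ^ 'n \<Rightarrow> real) g \<and>
       (\<integral>\<^sup>+ x. ennreal (\<bar>u x\<bar> powr q) \<partial>lborel) = ennreal (2 ^ k * L0) \<and>
       (\<integral>\<^sup>+ x. ennreal ((norm (g x))\<^sup>2) \<partial>lborel) = ennreal (2 ^ k * D0) \<and>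
       ennreal_coulomb_energy \<alpha> p u \<le> ennreal ((2 * 2 ^ k - 1) * v)"
    proof (induction k)
      case 0
      show ?case using ug(1) L0 D0 v0 by (intro exI[of _ u0] exI[of _ g0]) simp
    next
      case (Suc k)
      then obtain u :: "real ^ 'n \<Rightarrow> real" and g where IH: "compact_C1 u g"
         "(\<integral>\<^sup>+ x. ennreal (\<bar>u x\<bar> powr q) \<partial>lborel) = ennreal (2 ^ k * L0)"
         "(\<integral>\<^sup>+ x. ennreal ((norm (g x))\<^sup>2) \<partial>lborel) = ennreal (2 ^ k * D0)"
         "ennreal_coulomb_energy \<alpha> p u \<le> ennreal ((2 * 2 ^ k - 1) * v)" by blast
      have two: "2 * ennreal t = ennreal (2 * t)" if "t \<ge> 0" for t using that by (simp add: ennreal_mult)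
      have pk: "(1::real) \<le> 2 ^ k" by simp
      obtain u' :: "real ^ 'n \<Rightarrow> real" and g' where N: "compact_C1 u' g'"
        "(\<integral>\<^sup>+ x. ennreal (\<bar>u' x\<bar> powr q) \<partial>lborel) = 2 * (\<integral>\<^sup>+ x. ennreal (\<bar>u x\<bar> powr q) \<partial>lborel)"
        "(\<integral>\<^sup>+ x. ennreal ((norm (g' x))\<^sup>2) \<partial>lborel) = 2 * (\<integral>\<^sup>+ x. ennreal ((norm (g x))\<^sup>2) \<partial>lborel)"
        "ennreal_coulomb_energy \<alpha> p u' \<le> 2 * ennreal_coulomb_energy \<alpha> p u + ennreal v"
        by (rule compact_C1_doubling[OF IH(1) a p q v]) blast
      have "2 * ennreal_coulomb_energy \<alpha> p u + ennreal v \<le> 2 * ennreal ((2 * 2 ^ k - 1) * v) + ennreal v"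
        by (intro add_mono mult_left_mono IH) auto
      also have "\<dots> = ennreal (2 * ((2 * 2 ^ k - 1) * v) + v)"
      proof -
        have nk: "0 \<le> (2 * 2 ^ k - 1) * v" using v pk by (intro mult_nonneg_nonneg) linarith+
        have "ennreal (2 * ((2 * 2 ^ k - 1) * v) + v) = ennreal (2 * ((2 * 2 ^ k - 1) * v)) + ennreal v"
          by (rule ennreal_plus) (use nk v in linarith)+
        then show ?thesis by (simp only: two[OF nk])
      qed
      also have "2 * ((2 * 2 ^ k - 1) * v) + v = (2 * 2 ^ Suc k - 1) * v" by (simp add: algebra_simps)
      finally have V: "ennreal_coulomb_energy \<alpha> p u' \<le> ennreal ((2 * 2 ^ Suc k - 1) * v)"
        using N(4) order_trans by blast
      have "L0 \<ge> 0" "D0 \<ge> 0" by (auto simp: L0_def D0_def)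
      then show ?case
        using N(1-3) V IH by (intro exI[of _ u'] exI[of _ g']) (simp add: two mult.assoc)
    qed
  qed
qed

section \<open>Necessity of the condition\<close>

text \<open>The logarithm to base 2 of the embedding inequality for \<open>2\<^sup>k\<close> separated bumps dilated by \<open>2\<^sup>t\<close>.
  The two arguments of the maximum come from the two parts of the norm.\<close>

lemma embedded_imp_growth:
  fixes \<alpha> p q :: real
  assumes a: "0 < \<alpha>" "\<alpha> < real CARD('n::finite)" and p: "1 \<le> p" and q: "1 \<le> q"
    and emb: "continuously_embedded (coulomb_sobolev \<alpha> p :: (real ^ 'n \<Rightarrow> real) set) (coulomb_sobolev_norm \<alpha> p)
           (Lq_space q) (Lq_norm q)"
  obtains c where "\<And>t (k::nat). real CARD('n) / q * t + real k / q
     \<le> c + max ((real CARD('n) - 2) / 2 * t + real k / 2) ((real CARD('n) + \<alpha>) / (2 * p) * t + real k / (2 * p))"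
proof -
  let ?N = "real CARD('n)"
  obtain C0 where C0: "\<And>u :: real ^ 'n \<Rightarrow> real. u \<in> coulomb_sobolev \<alpha> p \<Longrightarrow> Lq_norm q u \<le> C0 * coulomb_sobolev_norm \<alpha> p u"
    using emb by (auto simp: continuously_embedded_def)
  \<comment> \<open>The constant of the embedding may be negative a priori.\<close>
  define C where "C = max C0 1"
  have C: "C \<ge> 1" "C0 \<le> C" by (auto simp: C_def)
  obtain L0 D0 v :: real where pos: "0 < L0" "0 \<le> D0" "0 < v" and bumps:
    "\<And>k. \<exists>u g. compact_C1 (u :: real ^ 'n \<Rightarrow> real) g \<and>
       (\<integral>\<^sup>+ x. ennreal (\<bar>u x\<bar> powr q) \<partial>lborel) = ennreal (2 ^ k * L0) \<and>
       (\<integral>\<^sup>+ x. ennreal ((norm (g x))\<^sup>2) \<partial>lborel) = ennreal (2 ^ k * D0) \<and>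
       ennreal_coulomb_energy \<alpha> p u \<le> ennreal ((2 * 2 ^ k - 1) * v)"
    using exists_separated_bumps[OF a p q] by metis
  define K where "K = C * (sqrt D0 + (2 * v) powr (1 / (2 * p)))"
  have K: "K > 0" unfolding K_def using C pos by (intro mult_pos_pos add_nonneg_pos) auto
  define c where "c = log 2 (K / L0 powr (1 / q))"
  have "?N / q * t + real k / q \<le> c + max ((?N - 2) / 2 * t + real k / 2) ((?N + \<alpha>) / (2 * p) * t + real k / (2 * p))"
    (is "?lhs \<le> c + max ?A ?B") for t and k :: nat
  proof -
    define l :: real where "l = 2 powr t"
    have l: "l > 0" by (simp add: l_def)
    obtain u g where ug: "compact_C1 (u :: real ^ 'n \<Rightarrow> real) g"
       "(\<integral>\<^sup>+ x. ennreal (\<bar>u x\<bar> powr q) \<partial>lborel) = ennreal (2 ^ k * L0)"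
       "(\<integral>\<^sup>+ x. ennreal ((norm (g x))\<^sup>2) \<partial>lborel) = ennreal (2 ^ k * D0)"
       "ennreal_coulomb_energy \<alpha> p u \<le> ennreal ((2 * 2 ^ k - 1) * v)" using bumps by blast
    define w where "w x = u (x /\<^sub>R l)" for x
    define h where "h x = g (x /\<^sub>R l) /\<^sub>R l" for x
    note S = compact_C1_scale[OF ug(1) l, folded w_def h_def]
    have fin: "ennreal_coulomb_energy \<alpha> p w < \<infinity>" by (rule compact_C1_energy_finite[OF S(1) a p])
    note E = compact_C1_coulomb_sobolev[OF S(1) fin]
    have D: "dirichlet_energy w = 2 powr ((?N - 2) * t + real k) * D0"
    proof -
      have "ennreal (dirichlet_energy w) = ennreal (l powr (?N - 2) * (2 ^ k * D0))"
        unfolding E(2) S(3) ug(3) using pos by (simp add: ennreal_mult)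
      then have "dirichlet_energy w = l powr (?N - 2) * (2 ^ k * D0)"
        using pos by (subst (asm) ennreal_inj) (auto simp: dirichlet_energy_def)
      also have "\<dots> = 2 powr ((?N - 2) * t + real k) * D0"
        by (simp add: l_def powr_powr powr_add powr_realpow mult.commute)
      finally show ?thesis .
    qed
    have V: "coulomb_energy \<alpha> p w \<le> 2 powr ((?N + \<alpha>) * t + real k) * (2 * v)"
    proof -
      have "ennreal (coulomb_energy \<alpha> p w) = ennreal_coulomb_energy \<alpha> p w"
        using fin by (simp add: coulomb_energy_def)
      also have "\<dots> \<le> ennreal (l powr (?N + \<alpha>)) * ennreal ((2 * 2 ^ k - 1) * v)"
        unfolding S(4) by (intro mult_left_mono ug) auto
      also have "\<dots> = ennreal (l powr (?N + \<alpha>) * ((2 * 2 ^ k - 1) * v))"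
      proof (rule ennreal_mult[symmetric])
        have "(1::real) \<le> 2 ^ k" by simp
        then show "0 \<le> (2 * 2 ^ k - 1) * v" using pos by (intro mult_nonneg_nonneg) linarith+
      qed simp
      also have "\<dots> \<le> ennreal (l powr (?N + \<alpha>) * ((2 * 2 ^ k) * v))"
        using pos by (intro ennreal_leI mult_left_mono mult_right_mono) auto
      also have "l powr (?N + \<alpha>) * ((2 * 2 ^ k) * v) = 2 powr ((?N + \<alpha>) * t + real k) * (2 * v)"
      proof -
        have "l powr (?N + \<alpha>) = 2 powr ((?N + \<alpha>) * t)" by (simp add: l_def powr_powr mult.commute)
        moreover have "2 powr ((?N + \<alpha>) * t + real k) = 2 powr ((?N + \<alpha>) * t) * 2 ^ k"
          by (simp only: powr_add powr_realpow[OF zero_less_numeral])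
        ultimately show ?thesis by simp
      qed
      finally show ?thesis using pos by (subst (asm) ennreal_le_iff) auto
    qed
    have Lq: "Lq_norm q w = 2 powr ?lhs * L0 powr (1 / q)"
    proof -
      have w: "w \<in> borel_measurable borel" using compact_C1_measurable[OF S(1)] by simp
      have "(LINT x|lebesgue. \<bar>w x\<bar> powr q) = (LINT x|lborel. \<bar>w x\<bar> powr q)"
        by (rule integral_completion) (use w in measurable)
      also have "\<dots> = enn2real (\<integral>\<^sup>+ x. ennreal (\<bar>w x\<bar> powr q) \<partial>lborel)"
        by (rule integral_eq_nn_integral) (use w in auto)
      also have "\<dots> = l powr ?N * (2 ^ k * L0)"
        unfolding S(2) ug(2) using pos by (simp add: ennreal_mult[symmetric])
      also have "\<dots> = 2 powr (?N * t + real k) * L0"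
        by (simp add: l_def powr_powr powr_add powr_realpow mult_ac)
      finally have I: "(LINT x|lebesgue. \<bar>w x\<bar> powr q) = 2 powr (?N * t + real k) * L0" .
      have "(?N * t + real k) * (1 / q) = ?lhs" by (simp add: add_divide_distrib)
      then show ?thesis unfolding Lq_norm_def I powr_mult powr_powr by simp
    qed
    have "coulomb_sobolev_norm \<alpha> p w \<le> sqrt (dirichlet_energy w) + sqrt (coulomb_energy \<alpha> p w powr (1 / p))"
      unfolding coulomb_sobolev_norm_def
      by (rule sqrt_add_le_add_sqrt) (auto simp: dirichlet_energy_def)
    also have "sqrt (dirichlet_energy w) = 2 powr ?A * sqrt D0"
    proof -
      have "((?N - 2) * t + real k) * (1 / 2) = ?A" by (simp add: add_divide_distrib)
      then have "sqrt (2 powr ((?N - 2) * t + real k)) = 2 powr ?A"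
        by (simp only: powr_half_sqrt[OF powr_ge_zero, symmetric] powr_powr)
      then show ?thesis unfolding D real_sqrt_mult by (rule arg_cong)
    qed
    also have "sqrt (coulomb_energy \<alpha> p w powr (1 / p)) \<le> 2 powr ?B * (2 * v) powr (1 / (2 * p))"
    proof -
      have "sqrt (coulomb_energy \<alpha> p w powr (1 / p)) = coulomb_energy \<alpha> p w powr (1 / (2 * p))"
        by (simp add: powr_half_sqrt[symmetric] powr_powr mult.commute)
      also have "\<dots> \<le> (2 powr ((?N + \<alpha>) * t + real k) * (2 * v)) powr (1 / (2 * p))"
        using V p by (intro powr_mono2) (auto simp: coulomb_energy_def)
      also have "\<dots> = 2 powr (((?N + \<alpha>) * t + real k) * (1 / (2 * p))) * (2 * v) powr (1 / (2 * p))"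
        by (simp only: powr_mult powr_powr)
      also have "((?N + \<alpha>) * t + real k) * (1 / (2 * p)) = ?B" using p by (simp add: field_simps)
      finally show ?thesis .
    qed
    finally have "coulomb_sobolev_norm \<alpha> p w \<le> 2 powr ?A * sqrt D0 + 2 powr ?B * (2 * v) powr (1 / (2 * p))" by simp
    also have "\<dots> \<le> 2 powr (max ?A ?B) * sqrt D0 + 2 powr (max ?A ?B) * (2 * v) powr (1 / (2 * p))"
      using pos by (intro add_mono mult_right_mono powr_mono) auto
    finally have norm_le: "coulomb_sobolev_norm \<alpha> p w \<le> 2 powr (max ?A ?B) * (sqrt D0 + (2 * v) powr (1 / (2 * p)))"
      by (simp add: algebra_simps)
    have "0 \<le> coulomb_sobolev_norm \<alpha> p w" by (simp add: coulomb_sobolev_norm_def dirichlet_energy_def)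
    then have "Lq_norm q w \<le> C * coulomb_sobolev_norm \<alpha> p w"
      using C0[OF E(1)] mult_right_mono[OF C(2), of "coulomb_sobolev_norm \<alpha> p w"] by linarith
    also have "\<dots> \<le> C * (2 powr (max ?A ?B) * (sqrt D0 + (2 * v) powr (1 / (2 * p))))"
      using C norm_le by (intro mult_left_mono) auto
    finally have "2 powr ?lhs * L0 powr (1 / q) \<le> K * 2 powr (max ?A ?B)"
      unfolding Lq K_def by (simp add: mult_ac)
    then have "2 powr ?lhs \<le> K / L0 powr (1 / q) * 2 powr (max ?A ?B)"
      using pos by (simp add: field_simps)
    also have "K / L0 powr (1 / q) = 2 powr c" using K pos by (simp add: c_def)
    finally have "2 powr ?lhs \<le> 2 powr (c + max ?A ?B)" by (simp only: powr_add)
    then show ?thesis by simp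
  qed
  then show ?thesis by (rule that)
qed

lemma growth_imp_slope_le:
  fixes x y c :: real
  assumes "\<And>k::nat. x * real k \<le> c + y * real k"
  shows "x \<le> y"
proof (rule ccontr)
  assume "\<not> x \<le> y"
  then obtain k :: nat where "c / (x - y) < real k" using reals_Archimedean2 by blast
  then have "c < (x - y) * real k" using \<open>\<not> x \<le> y\<close> by (simp add: pos_divide_less_eq mult.commute)
  then show False using assms[of k] by (simp add: algebra_simps)
qed

text \<open>The growth of the inequality is read off along three rays: \<open>k = 0\<close> with \<open>t\<close> tending to infinity and to
  minus infinity, which compares \<open>N / q\<close> with \<open>A\<close> and \<open>B\<close>, and the ray on which both parts of the norm
  grow equally fast, which gives the bound that depends on \<open>\<alpha>\<close>.\<close>

theorem embedded_imp_condition_Q: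
  fixes \<alpha> p q :: real
  assumes a: "0 < \<alpha>" "\<alpha> < real CARD('n::finite)" and p: "1 \<le> p" and q: "1 \<le> q"
    and emb: "continuously_embedded (coulomb_sobolev \<alpha> p :: (real ^ 'n \<Rightarrow> real) set) (coulomb_sobolev_norm \<alpha> p)
           (Lq_space q) (Lq_norm q)"
  shows "condition_Q CARD('n) \<alpha> p q"
proof -
  define N where "N = real CARD('n)"
  have N: "1 \<le> N" by (simp add: N_def Suc_leI)
  define A where "A = (N - 2) / 2"
  define B where "B = (N + \<alpha>) / (2 * p)"
  obtain c where c: "\<And>t (k::nat). N / q * t + real k / q \<le> c + max (A * t + real k / 2) (B * t + real k / (2 * p))"
    using embedded_imp_growth[OF a p q emb] unfolding N_def A_def B_def by blast
  have up: "N / q \<le> max A B"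
  proof (rule growth_imp_slope_le[where c = c])
    fix k :: nat
    show "N / q * real k \<le> c + max A B * real k"
      using c[of "real k" 0] by (simp add: max_mult_distrib_right)
  qed
  have down: "min A B \<le> N / q"
  proof -
    have "- (N / q) \<le> - min A B"
    proof (rule growth_imp_slope_le[where c = c])
      fix k :: nat
      show "- (N / q) * real k \<le> c + - min A B * real k"
        using c[of "- real k" 0] by (simp add: minus_min_eq_max max_mult_distrib_right)
    qed
    then show ?thesis by simp
  qed
  \<comment> \<open>The ray of direction (t, 1), for every t at once.\<close>
  have tilt: "N / q * t + 1 / q \<le> max (A * t + 1 / 2) (B * t + 1 / (2 * p))" for t
  proof (rule growth_imp_slope_le[where c = c])
    fix k :: nat
    show "(N / q * t + 1 / q) * real k \<le> c + max (A * t + 1 / 2) (B * t + 1 / (2 * p)) * real k"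
    proof -
      have "A * (real k * t) + real k / 2 = (A * t + 1 / 2) * real k"
        "B * (real k * t) + real k / (2 * p) = (B * t + 1 / (2 * p)) * real k"
        "N / q * (real k * t) + real k / q = (N / q * t + 1 / q) * real k"
        by (simp_all add: algebra_simps)
      then show ?thesis using c[of "real k * t" k] by (simp only: max_mult_distrib_right[of _ _ "real k"]) simp
    qed
  qed
  have BA: "2 * p * (B - A) = N + \<alpha> - p * (N - 2)" using p by (simp add: A_def B_def field_simps)
  have thr: "1 / p \<ge> max (N - 2) 0 / (N + \<alpha>) \<longleftrightarrow> p * max (N - 2) 0 \<le> N + \<alpha>"
    using p a N by (simp add: field_simps)
  have NA: "N * (1 / 2 - 1 / N) = A" using N by (simp add: A_def field_simps)
  have lowq: "1 / 2 - 1 / N \<le> 1 / q \<longleftrightarrow> A \<le> N / q"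
    using mult_le_cancel_left_pos[of N "1 / 2 - 1 / N" "1 / q"] N NA by simp
  have highq: "1 / q \<le> 1 / 2 - 1 / N \<longleftrightarrow> N / q \<le> A"
    using mult_le_cancel_left_pos[of N "1 / q" "1 / 2 - 1 / N"] N NA by simp
  have s: "\<alpha> + 2 * p > 0" using a p by simp
  have end_val: "1 / 2 - (p - 1) / (\<alpha> + 2 * p) = (\<alpha> + 2) / 2 / (\<alpha> + 2 * p)" using s by (simp add: field_simps)
  have end_le: "1 / q \<le> 1 / 2 - (p - 1) / (\<alpha> + 2 * p) \<longleftrightarrow> (\<alpha> + 2 * p) / q \<le> (\<alpha> + 2) / 2"
    unfolding end_val by (subst pos_le_divide_eq[OF s]) simp
  have end_ge: "1 / 2 - (p - 1) / (\<alpha> + 2 * p) \<le> 1 / q \<longleftrightarrow> (\<alpha> + 2) / 2 \<le> (\<alpha> + 2 * p) / q"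
    unfolding end_val by (subst pos_divide_le_eq[OF s]) simp
  \<comment> \<open>the slope at which both branches of the maximum agree\<close>
  define t where "t = (1 / 2 - 1 / (2 * p)) / (B - A)"
  have balance: "N / q * t + 1 / q \<le> A * t + 1 / 2" if "A \<noteq> B"
  proof -
    have "t * (B - A) = 1 / 2 - 1 / (2 * p)" using that by (simp add: t_def)
    then have "A * t + 1 / 2 = B * t + 1 / (2 * p)" by (simp add: algebra_simps)
    then show ?thesis using tilt[of t] by simp
  qed
  have key1: "(N / q * t + 1 / q) * (2 * p * (B - A)) = (\<alpha> + 2 * p) / q" if "A \<noteq> B"
  proof -
    have t2: "t * (2 * p * (B - A)) = p - 1" using that p by (simp add: t_def field_simps)
    have "(N / q * t + 1 / q) * (2 * p * (B - A)) = (N * (t * (2 * p * (B - A))) + 2 * p * (B - A)) / q"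
      by (simp add: algebra_simps add_divide_distrib diff_divide_distrib)
    also have "\<dots> = (\<alpha> + 2 * p) / q" unfolding t2 unfolding BA by (simp add: algebra_simps)
    finally show ?thesis .
  qed
  have key2: "(A * t + 1 / 2) * (2 * p * (B - A)) = (\<alpha> + 2) / 2" if "A \<noteq> B"
  proof -
    have t2: "t * (2 * p * (B - A)) = p - 1" using that p by (simp add: t_def field_simps)
    have "(A * t + 1 / 2) * (2 * p * (B - A)) = A * (t * (2 * p * (B - A))) + 2 * p * (B - A) / 2"
      by (simp add: field_simps)
    also have "\<dots> = (\<alpha> + 2) / 2" unfolding t2 unfolding BA by (simp add: A_def field_simps)
    finally show ?thesis .
  qed
  have "p * (N - 2) \<le> p * max (N - 2) 0" using p by (intro mult_left_mono) auto
  show ?thesis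
  proof (cases "A = B")
    case True
    then have e: "N + \<alpha> = p * (N - 2)" using BA by simp
    moreover have "N + \<alpha> > 0" using N a by simp
    ultimately have "N - 2 > 0" using p by (smt (verit) mult_nonneg_nonpos)
    then have thr': "1 / p \<ge> max (N - 2) 0 / (N + \<alpha>)" using thr e by simp
    have Nq: "N / q = A" using up down True by simp
    have "1 / q = 1 / 2 - 1 / N" using Nq NA N by (metis mult_cancel_left not_one_le_zero times_divide_eq_right mult.right_neutral)
    moreover have "(\<alpha> + 2 * p) * (1 / 2 - 1 / N) = (\<alpha> + 2) / 2"
    proof -
      have "2 * N * ((\<alpha> + 2 * p) * (1 / 2 - 1 / N)) = (\<alpha> + 2 * p) * (N - 2)" using N by (simp add: field_simps)
      also have "\<dots> = N * (\<alpha> + 2)" using e by (simp add: algebra_simps)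
      finally have "N * (2 * ((\<alpha> + 2 * p) * (1 / 2 - 1 / N))) = N * (\<alpha> + 2)" by (simp only: mult_ac)
      then have "2 * ((\<alpha> + 2 * p) * (1 / 2 - 1 / N)) = \<alpha> + 2"
        using N by (simp only: mult_cancel_left) linarith
      moreover have "x = y / 2" if "2 * x = y" for x y :: real using that by simp
      ultimately show ?thesis by blast
    qed
    ultimately have "(\<alpha> + 2 * p) / q \<le> (\<alpha> + 2) / 2" by (metis order_refl times_divide_eq_right mult.right_neutral)
    then show ?thesis
      unfolding condition_Q_def N_def[symmetric] using thr' lowq Nq end_le by simp
  next
    case False
    show ?thesis
    proof (cases "A < B")
      case True
      have "(N / q * t + 1 / q) * (2 * p * (B - A)) \<le> (A * t + 1 / 2) * (2 * p * (B - A))"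
        using balance[OF False] True p by (intro mult_right_mono) auto
      then have "(\<alpha> + 2 * p) / q \<le> (\<alpha> + 2) / 2" by (simp only: key1[OF False] key2[OF False])
      moreover have "A \<le> N / q" using down True by simp
      moreover have "1 / p \<ge> max (N - 2) 0 / (N + \<alpha>)"
      proof -
        have "0 < 2 * p * (B - A)" using True p by simp
        then have "p * (N - 2) \<le> N + \<alpha>" using BA by linarith
        then show ?thesis unfolding thr using N a by (auto simp: max_def)
      qed
      ultimately show ?thesis
        unfolding condition_Q_def N_def[symmetric] using lowq end_le by simp
    next
      case F: False
      then have BA0: "B < A" using False by simp
      then have "0 > 2 * p * (B - A)" using p by (simp add: mult_pos_neg)
      then have neg: "N + \<alpha> < p * (N - 2)" using BA by linarith
      have "(A * t + 1 / 2) * (2 * p * (B - A)) \<le> (N / q * t + 1 / q) * (2 * p * (B - A))"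
        using balance[OF False] \<open>0 > 2 * p * (B - A)\<close> by (intro mult_right_mono_neg) auto
      then have "(\<alpha> + 2) / 2 \<le> (\<alpha> + 2 * p) / q" by (simp only: key1[OF False] key2[OF False])
      moreover have "N / q \<le> A" using up BA0 by simp
      moreover have "1 / p < max (N - 2) 0 / (N + \<alpha>)"
        using thr neg \<open>p * (N - 2) \<le> p * max (N - 2) 0\<close> by linarith
      ultimately show ?thesis
        unfolding condition_Q_def N_def[symmetric] using highq end_ge by simp
    qed
  qed
qed

section \<open>The embedding theorem\<close>

theorem theorem1:
  fixes \<alpha> :: real
  assumes "0 < \<alpha>" and "\<alpha> < real CARD('n::finite)"
  shows
    "(\<forall>p q. 1 \<le> p \<longrightarrow> 1 \<le> q \<longrightarrow>
        (continuously_embedded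
           (coulomb_sobolev \<alpha> p :: (real ^ 'n \<Rightarrow> real) set) (coulomb_sobolev_norm \<alpha> p)
           (Lq_space q) (Lq_norm q)
         \<longleftrightarrow> condition_Q CARD('n) \<alpha> p q))
     \<and>
     (\<forall>p q. 1 \<le> p \<longrightarrow> 1 \<le> q \<longrightarrow>
        condition_Q CARD('n) \<alpha> p q \<longrightarrow>
        \<alpha> + real CARD('n) \<noteq> p * (real CARD('n) - 2) \<longrightarrow>
        (\<exists>\<theta>. (\<forall>t. 1 / q = t * (1 / 2 - 1 / real CARD('n))
                            + (1 - t) * ((real CARD('n) + \<alpha>) / (2 * real CARD('n) * p))
                    \<longleftrightarrow> t = \<theta>)
           \<and> (CARD('n) \<ge> 2 \<longrightarrow> \<alpha> / (2 * p + \<alpha>) \<le> \<theta> \<and> \<theta> \<le> 1)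
           \<and> (CARD('n) = 1 \<longrightarrow> \<alpha> / (2 * p + \<alpha>) \<le> \<theta> \<and> \<theta> < (1 + \<alpha>) / (1 + \<alpha> + p))
           \<and> (\<exists>S>0. \<forall>u \<in> (coulomb_sobolev \<alpha> p :: (real ^ 'n \<Rightarrow> real) set).
                integrable lebesgue (\<lambda>x. \<bar>u x\<bar> powr q) \<and>
                S * (LINT x|lebesgue. \<bar>u x\<bar> powr q) powr (1 / q)
                  \<le> dirichlet_energy u powr (\<theta> / 2)
                     * coulomb_energy \<alpha> p u powr ((1 - \<theta>) / (2 * p)))))
     \<and>
     (CARD('n) \<ge> 3 \<longrightarrow>
        (\<exists>C>0. \<forall>p\<ge>1. \<alpha> + real CARD('n) = p * (real CARD('n) - 2) \<longrightarrow>
           (\<forall>u \<in> (coulomb_sobolev \<alpha> ((real CARD('n) + \<alpha>) / (real CARD('n) - 2))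
                     :: (real ^ 'n \<Rightarrow> real) set).
              integrable lebesgue (\<lambda>x. \<bar>u x\<bar> powr (2 * real CARD('n) / (real CARD('n) - 2))) \<and>
              C * (LINT x|lebesgue. \<bar>u x\<bar> powr (2 * real CARD('n) / (real CARD('n) - 2)))
                \<le> dirichlet_energy u powr (\<alpha> / (2 + \<alpha>))
                   * coulomb_energy \<alpha> ((real CARD('n) + \<alpha>) / (real CARD('n) - 2)) u
                       powr (2 / (2 + \<alpha>)))))"
proof (intro conjI allI impI)
  fix p q :: real assume "1 \<le> p" "1 \<le> q"
  then show "continuously_embedded
           (coulomb_sobolev \<alpha> p :: (real ^ 'n \<Rightarrow> real) set) (coulomb_sobolev_norm \<alpha> p)
           (Lq_space q) (Lq_norm q)
         \<longleftrightarrow> condition_Q CARD('n) \<alpha> p q"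
    using condition_Q_imp_embedded[OF assms] embedded_imp_condition_Q[OF assms] by blast
next
  fix p q :: real
  assume "1 \<le> p" "1 \<le> q" "condition_Q CARD('n) \<alpha> p q" "\<alpha> + real CARD('n) \<noteq> p * (real CARD('n) - 2)"
  from interpolation_inequality_condition_Q[OF assms this]
  show "\<exists>\<theta>. (\<forall>t. 1 / q = t * (1 / 2 - 1 / real CARD('n))
                            + (1 - t) * ((real CARD('n) + \<alpha>) / (2 * real CARD('n) * p))
                    \<longleftrightarrow> t = \<theta>)
           \<and> (CARD('n) \<ge> 2 \<longrightarrow> \<alpha> / (2 * p + \<alpha>) \<le> \<theta> \<and> \<theta> \<le> 1)
           \<and> (CARD('n) = 1 \<longrightarrow> \<alpha> / (2 * p + \<alpha>) \<le> \<theta> \<and> \<theta> < (1 + \<alpha>) / (1 + \<alpha> + p))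
           \<and> (\<exists>S>0. \<forall>u \<in> (coulomb_sobolev \<alpha> p :: (real ^ 'n \<Rightarrow> real) set).
                integrable lebesgue (\<lambda>x. \<bar>u x\<bar> powr q) \<and>
                S * (LINT x|lebesgue. \<bar>u x\<bar> powr q) powr (1 / q)
                  \<le> dirichlet_energy u powr (\<theta> / 2)
                     * coulomb_energy \<alpha> p u powr ((1 - \<theta>) / (2 * p)))" .
next
  assume "CARD('n) \<ge> 3"
  from interpolation_inequality_critical[OF assms this]
  show "\<exists>C>0. \<forall>p\<ge>1. \<alpha> + real CARD('n) = p * (real CARD('n) - 2) \<longrightarrow>
           (\<forall>u \<in> (coulomb_sobolev \<alpha> ((real CARD('n) + \<alpha>) / (real CARD('n) - 2))
                     :: (real ^ 'n \<Rightarrow> real) set).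
              integrable lebesgue (\<lambda>x. \<bar>u x\<bar> powr (2 * real CARD('n) / (real CARD('n) - 2))) \<and>
              C * (LINT x|lebesgue. \<bar>u x\<bar> powr (2 * real CARD('n) / (real CARD('n) - 2)))
                \<le> dirichlet_energy u powr (\<alpha> / (2 + \<alpha>))
                   * coulomb_energy \<alpha> ((real CARD('n) + \<alpha>) / (real CARD('n) - 2)) u
                       powr (2 / (2 + \<alpha>)))"
    by blast
qed

end
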